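(* Let $\Omega$ be a smooth bounded domain of $\mathbb{R}^n$. Let $u\in C^3_0(\overline{\Omega})$ be a positive function and $v(x,x_{n+1}):=u(x)-x_{n+1}$ for all $(x,x_{n+1})\in\Omega\times\mathbb{R}$. Let $\nu=-\frac{\nabla v}{|\nabla v|}\in\mathbb{R}^{n+1}$ be the unit normal vector to $\mathrm{Graph}(u)$, let $A^2$ be the (squared norm of the) second fundamental form of $\mathrm{Graph}(u)$, and let $\nabla_T\varphi:=\nabla\varphi-(\nu\cdot\nabla\varphi)\nu$ for every $\varphi\in C^1(\mathbb{R}^{n+1})$. Then $$\left(\Delta|\nabla v|+\nu\cdot\nabla\Delta v\right)|\nabla v|=A^2|\nabla v|^2+|\nabla_T|\nabla v||^2\quad\text{in }\Omega.$$ In particular, if $\lambda>0$, $f\in C^1(\mathbb{R})$, and $u\in C^2(\overline{\Omega})$ is a solution of $-\Delta u=\lambda f(u)$ in $\Omega$, $u=0$ on $\partial\Omega$, then, with $v$, $\nu$, $A^2$, $\nabla_T$ defined from $u$ in the same way, $$\left(\Delta|\nabla v|+\lambda f'(u)|\nabla v|\right)|\nabla v|=\lambda f'(u)+A^2|\nabla v|^2+|\nabla_T|\nabla v||^2\quad\text{in }\Omega.$$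
   Context: $C^3_0(\overline\Omega)$ denotes the functions in $C^3(\overline\Omega)$ vanishing on $\partial\Omega$. $\mathrm{Graph}(u)=\{(x,x_{n+1})\in\Omega\times\mathbb{R}:x_{n+1}=u(x)\}\subset\mathbb{R}^{n+1}$. The symbols $\nabla$ and $\Delta$ applied to $v$, $|\nabla v|$ and $\Delta v$ are the gradient and Laplacian in $\mathbb{R}^{n+1}$. All quantities built from $v$ here ($|\nabla v|=\sqrt{1+|\nabla u|^2}$, $\nu$, $\Delta v=\Delta u$, etc.) do not depend on $x_{n+1}$ and are regarded as functions of $x\in\Omega$. $A^2:=\kappa_1^2+\cdots+\kappa_n^2$, where $\kappa_1,\dots,\kappa_n$ are the principal curvatures of $\mathrm{Graph}(u)$ at $(x,u(x))$ (equivalently, of the level sets of $v$, which are vertical translates of the graph). Equivalently, $A^2=\sum_{i,j=1}^{n+1}\partial_j\nu^i\,\partial_i\nu^j$. *)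

theory Defs
  imports "HOL-Analysis.Analysis"
begin

section \<open>Differential operators on Euclidean spaces\<close>

definition partial_deriv :: "'a::euclidean_space \<Rightarrow> ('a \<Rightarrow> real) \<Rightarrow> 'a \<Rightarrow> real" where
  "partial_deriv b g p = deriv (\<lambda>t. g (p + t *\<^sub>R b)) 0"

definition grad :: "('a::euclidean_space \<Rightarrow> real) \<Rightarrow> 'a \<Rightarrow> 'a" where
  "grad g p = (\<Sum>b\<in>Basis. partial_deriv b g p *\<^sub>R b)"

definition laplacian :: "('a::euclidean_space \<Rightarrow> real) \<Rightarrow> 'a \<Rightarrow> real" where
  "laplacian g p = (\<Sum>b\<in>Basis. partial_deriv b (partial_deriv b g) p)"

section \<open>Classes of continuously differentiable functions\<close>

(* cont_diff k U S f, for U open and U \<subseteq> S \<subseteq> closure U: the partial derivatives of f of order \<le> k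
   exist in U, and each of them agrees on U with a function that is continuous on S.
   Thus S = U gives C^k(U), and S = closure U gives C^k of the closure of U. *)
primrec cont_diff ::
  "nat \<Rightarrow> 'a::euclidean_space set \<Rightarrow> 'a set \<Rightarrow> ('a \<Rightarrow> real) \<Rightarrow> bool" where
  "cont_diff 0 U S f = continuous_on S f"
| "cont_diff (Suc k) U S f =
    (continuous_on S f \<and>
     (\<forall>b\<in>Basis. \<exists>g. cont_diff k U S g \<and>
        (\<forall>x\<in>U. ((\<lambda>t. f (x + t *\<^sub>R b)) has_real_derivative g x) (at 0))))"

abbreviation Ck_closure :: "nat \<Rightarrow> 'a::euclidean_space set \<Rightarrow> ('a \<Rightarrow> real) \<Rightarrow> bool" where
  "Ck_closure k \<Omega> u \<equiv> cont_diff k \<Omega> (closure \<Omega>) u"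

(* The boundary is locally a regular level set of a C^\<infinity> function, with \<Omega> on one side of it. *)
definition smooth_bounded_domain :: "'a::euclidean_space set \<Rightarrow> bool" where
  "smooth_bounded_domain \<Omega> \<longleftrightarrow>
     open \<Omega> \<and> connected \<Omega> \<and> \<Omega> \<noteq> {} \<and> bounded \<Omega> \<and>
     (\<forall>p\<in>frontier \<Omega>. \<exists>U \<rho>. open U \<and> p \<in> U \<and> (\<forall>k. cont_diff k U U \<rho>) \<and>
        (\<forall>x\<in>U. grad \<rho> x \<noteq> 0) \<and> \<Omega> \<inter> U = {x \<in> U. \<rho> x < 0})"

section \<open>The graph of a function\<close>

text \<open>
  If \<open>u\<close> is a function on \<open>'a\<close>, the space \<open>'a \<times> real\<close>, with the Euclidean structure of the
  product, contains the graph of \<open>u\<close>.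
\<close>

definition graph_fun :: "('a::euclidean_space \<Rightarrow> real) \<Rightarrow> 'a \<times> real \<Rightarrow> real" where
  "graph_fun u = (\<lambda>(x, s). u x - s)"

definition norm_grad :: "('a::euclidean_space \<Rightarrow> real) \<Rightarrow> 'a \<times> real \<Rightarrow> real" where
  "norm_grad u p = norm (grad (graph_fun u) p)"

definition unit_normal :: "('a::euclidean_space \<Rightarrow> real) \<Rightarrow> 'a \<times> real \<Rightarrow> 'a \<times> real" where
  "unit_normal u p = - (grad (graph_fun u) p /\<^sub>R norm_grad u p)"

definition tangential_grad ::
  "('a::euclidean_space \<Rightarrow> real) \<Rightarrow> ('a \<times> real \<Rightarrow> real) \<Rightarrow> 'a \<times> real \<Rightarrow> 'a \<times> real" where
  "tangential_grad u \<phi> p =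
     grad \<phi> p - (unit_normal u p \<bullet> grad \<phi> p) *\<^sub>R unit_normal u p"

definition graph_tangent_space :: "('a::euclidean_space \<Rightarrow> real) \<Rightarrow> 'a \<Rightarrow> ('a \<times> real) set" where
  "graph_tangent_space u x = range (\<lambda>h. (h, grad u x \<bullet> h))"

(* The principal curvatures are the eigenvalues of the Weingarten map, i.e. of the differential of
   the unit normal restricted to the tangent space. Some authors use the opposite sign, which makes
   no difference to the sum of squares below. *)
definition curvature_space ::
  "('a::euclidean_space \<Rightarrow> real) \<Rightarrow> 'a \<Rightarrow> real \<Rightarrow> ('a \<times> real) set" where
  "curvature_space u x \<kappa> =
     {w \<in> graph_tangent_space u x.
        frechet_derivative (unit_normal u) (at (x, u x)) w = \<kappa> *\<^sub>R w}"

definition principal_curvature :: "('a::euclidean_space \<Rightarrow> real) \<Rightarrow> 'a \<Rightarrow> real \<Rightarrow> bool" where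
  "principal_curvature u x \<kappa> \<longleftrightarrow> (\<exists>w\<in>curvature_space u x \<kappa>. w \<noteq> 0)"

(* The sum of the squares of the principal curvatures, counted with multiplicity. The Weingarten
   map is self-adjoint, so the multiplicity of an eigenvalue is the dimension of its eigenspace. *)
definition second_form_sq :: "('a::euclidean_space \<Rightarrow> real) \<Rightarrow> 'a \<Rightarrow> real" where
  "second_form_sq u x =
     (\<Sum>\<kappa> | principal_curvature u x \<kappa>. real (dim (curvature_space u x \<kappa>)) * \<kappa>\<^sup>2)"

end

(*
  The pointwise identity is a computation with W = |grad v| = sqrt (1 + |grad u|^2): the principal
  curvatures are the nonzero eigenvalues of the self-adjoint map obtained by composing D nu with the
  projection onto the tangent space, so A^2 is the squared Hilbert-Schmidt norm of that map.

  In the semilinear case u is only of class C^2, and Delta W must be shown to exist in the classical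
  sense. Where F' = f, the function psi = |grad u|^2 / 2 + l F(u) has the weak Laplacian
  |D^2 u|^2 - (Delta u)^2, which contains no third derivatives of u and no derivative of f. As
  Delta u = - l f(u) is locally Lipschitz, D^2 u is locally Hoelder continuous, and so is the
  Laplacian of psi; hence psi is twice differentiable. Both regularity steps use mollification with
  a compactly supported radial kernel k for which k(z) z is a gradient: the derivative of a second
  derivative of the mollified function in the mollification radius r is then O(r^(alpha - 1)).
*)
theory Submission
  imports Defs
begin

section \<open>Integration by parts against compactly supported functions\<close>

text \<open>\<open>laplacian\<close> is a sum of values of \<open>deriv\<close>, which say nothing
  where a derivative fails to exist. In the semilinear case every pure second derivative of |grad v|
  must therefore be shown to exist; a weak Laplacian alone controls only their sum.

  The rate r^(\<alpha> - 1) has two sources. Differentiating the kernel in r produces a Laplacian of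
  its potential L, which can be moved to the mollified function, where only the weak Laplacian h is
  known; the remaining two derivatives stay on L. Second derivatives of L have integral 0, so h
  enters through its increments, which are O(r^\<alpha>). Since r^(\<alpha> - 1) is integrable at 0,
  the mollified second derivatives converge uniformly in the centre and with a rate, and no singular
  integral has to be defined.

  The Hoelder exponent 1/3 obtained for the Hessian comes from a crude balance of two errors; any
  positive exponent serves the second regularity step.

  The dilation always acts on the mollified function, never on the kernel, so all integrals are
  taken over one fixed cube.\<close>

abbreviation domain_box :: "'a::euclidean_space set" where
  "domain_box \<equiv> cbox (- (2 *\<^sub>R One)) (2 *\<^sub>R One)"

text \<open>Bounds the norm on the cube by the sum of the coordinates. The cube has half-side 2 so
  that it contains the unit ball, where the kernels live, after any translation of length at most
  1.\<close>

abbreviation box_radius :: "'a::euclidean_space itself \<Rightarrow> real" where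
  "box_radius _ \<equiv> 2 * real DIM('a)"

lemma domain_boxI:
  fixes z :: "'a::euclidean_space"
  assumes "norm z \<le> 2"
  shows "z \<in> domain_box"
  unfolding mem_box
proof (intro ballI)
  fix i :: 'a assume i: "i \<in> Basis"
  have "\<bar>z \<bullet> i\<bar> \<le> 2"
    using Basis_le_norm[OF i, of z] assms by linarith
  then show "- (2 *\<^sub>R One) \<bullet> i \<le> z \<bullet> i \<and> z \<bullet> i \<le> (2 *\<^sub>R One) \<bullet> i"
    using i by (simp add: abs_le_iff)
qed

lemma norm_domain_box:
  fixes z :: "'a::euclidean_space"
  assumes "z \<in> domain_box"
  shows "norm z \<le> box_radius TYPE('a)"
proof -
  have "norm z \<le> (\<Sum>i\<in>Basis. \<bar>z \<bullet> i\<bar>)"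
    by (rule norm_le_l1)
  also have "\<dots> \<le> (\<Sum>i\<in>(Basis::'a set). 2)"
    using assms by (intro sum_mono) (fastforce simp: mem_box)
  finally show ?thesis by simp
qed

text \<open>Each domain contains the support of its integrand, so both integrals equal the one over
  the whole space. Cutting the integrand off outside the domain does not change it, whether or not
  it is integrable.\<close>

lemma integral_translate_unit_support:
  fixes F :: "'a::euclidean_space \<Rightarrow> real"
  assumes supp: "\<And>z. norm z \<ge> 1 \<Longrightarrow> F z = 0" and \<tau>: "norm \<tau> \<le> 1"
  shows "integral domain_box (\<lambda>z. F (z + \<tau>)) = integral domain_box F"
proof -
  let ?a = "- (2 *\<^sub>R One) :: 'a" and ?b = "2 *\<^sub>R One :: 'a"
  let ?G = "\<lambda>z. F (z + \<tau>)"
  have restrict: "integral S ?G = integral UNIV ?G" if "\<And>z. norm (z + \<tau>) < 1 \<Longrightarrow> z \<in> S" for S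
  proof -
    have "(\<lambda>z. if z \<in> S then ?G z else 0) = ?G"
      using supp that by (fastforce simp: not_le)
    then show ?thesis
      using integral_restrict_UNIV[of S ?G] by simp
  qed
  have "integral domain_box F = integral (cbox (?a - \<tau>) (?b - \<tau>)) ?G"
    by (rule integral_shift_cbox[symmetric])
  also have "\<dots> = integral UNIV ?G"
  proof (rule restrict)
    fix z assume "norm (z + \<tau>) < 1"
    then have "z + \<tau> \<in> domain_box" by (intro domain_boxI) simp
    then show "z \<in> cbox (?a - \<tau>) (?b - \<tau>)"
      by (auto simp: mem_box inner_diff_left inner_add_left algebra_simps)
  qed
  also have "\<dots> = integral domain_box ?G"
  proof (rule restrict[symmetric])
    fix z assume "norm (z + \<tau>) < 1"
    then have "norm z \<le> 2"
      using \<tau> norm_triangle_ineq4[of "z + \<tau>" \<tau>] by simp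
    then show "z \<in> domain_box" by (rule domain_boxI)
  qed
  finally show ?thesis by simp
qed

text \<open>Leibniz rule with a two-sided derivative, available because the parameter runs through
  an open interval.\<close>

lemma integral_has_real_derivative:
  fixes f :: "real \<Rightarrow> 'a::euclidean_space \<Rightarrow> real"
  assumes der: "\<And>t z. t \<in> {a<..<b} \<Longrightarrow> z \<in> cbox c d \<Longrightarrow>
      ((\<lambda>t. f t z) has_real_derivative f' t z) (at t)"
    and int: "\<And>t. t \<in> {a<..<b} \<Longrightarrow> continuous_on (cbox c d) (f t)"
    and cont: "continuous_on ({a<..<b} \<times> cbox c d) (\<lambda>(t, z). f' t z)"
    and t: "t \<in> {a<..<b}"
  shows "((\<lambda>t. integral (cbox c d) (f t)) has_real_derivative integral (cbox c d) (f' t)) (at t)"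
proof -
  have "((\<lambda>t. integral (cbox c d) (f t)) has_real_derivative integral (cbox c d) (f' t))
      (at t within {a<..<b})"
  proof (rule leibniz_rule_field_derivative[OF _ _ cont t])
    show "((\<lambda>t. f t z) has_real_derivative f' t z) (at t within {a<..<b})"
      if "t \<in> {a<..<b}" "z \<in> cbox c d" for t z
      using der[OF that] by (rule has_field_derivative_at_within)
    show "f t integrable_on cbox c d" if "t \<in> {a<..<b}" for t
      using int[OF that] by (rule integrable_continuous)
  qed (rule convex_real_interval)
  then show ?thesis
    unfolding at_within_open[OF t open_greaterThanLessThan] .
qed

lemma GDERIV_continuous_on:
  assumes "\<And>x. x \<in> S \<Longrightarrow> GDERIV f x :> f' x"
  shows "continuous_on S f"
  using assms unfolding gderiv_def
  by (intro continuous_at_imp_continuous_on ballI) (rule has_derivative_continuous)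

lemma GDERIV_compose_line:
  assumes "GDERIV f (x + t *\<^sub>R b) :> D"
  shows "((\<lambda>t. f (x + t *\<^sub>R b)) has_real_derivative D \<bullet> b) (at t)"
proof -
  have "((\<lambda>t. f (x + t *\<^sub>R b)) has_derivative (\<lambda>s. (s *\<^sub>R b) \<bullet> D)) (at t)"
    using assms unfolding gderiv_def
    by (rule has_derivative_compose[rotated]) (auto intro!: derivative_eq_intros)
  then show ?thesis
    by (simp add: has_field_derivative_def inner_commute mult_commute_abs)
qed

lemma GDERIV_compose_affine:
  assumes "GDERIV f (x + r *\<^sub>R z) :> D"
  shows "GDERIV (\<lambda>z. f (x + r *\<^sub>R z)) z :> r *\<^sub>R D"
proof -
  have "((\<lambda>z. x + r *\<^sub>R z) has_derivative (\<lambda>h. r *\<^sub>R h)) (at z)"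
    by (auto intro!: derivative_eq_intros)
  from has_derivative_compose[OF this assms[unfolded gderiv_def]]
  show ?thesis
    by (simp add: gderiv_def)
qed

lemma GDERIV_translate: "GDERIV f (z + c) :> D \<Longrightarrow> GDERIV (\<lambda>z. f (z + c)) z :> D"
  using GDERIV_compose_affine[of f c 1 z D] by (simp add: add.commute)

lemma norm_domain_box_add:
  fixes z :: "'a::euclidean_space"
  assumes "z \<in> domain_box" "norm \<tau> \<le> d"
  shows "norm (z + \<tau>) \<le> box_radius TYPE('a) + d"
  using norm_domain_box[OF assms(1)] norm_triangle_ineq[of z \<tau>] assms(2) by linarith

text \<open>Translation leaves the integral of a function supported in the unit ball unchanged, so
  its derivative along b at t = 0 vanishes. The hypotheses reach beyond the cube by 1 because its
  translates do.\<close>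

lemma integral_gradient_eq_0:
  fixes \<alpha> :: "'a::euclidean_space \<Rightarrow> real"
  assumes der: "\<And>z. norm z \<le> box_radius TYPE('a) + 1 \<Longrightarrow> GDERIV \<alpha> z :> \<alpha>' z"
    and cont: "continuous_on (cball 0 (box_radius TYPE('a) + 1)) \<alpha>'"
    and supp: "\<And>z. norm z \<ge> 1 \<Longrightarrow> \<alpha> z = 0"
    and b: "norm b \<le> 1"
  shows "integral domain_box (\<lambda>z. \<alpha>' z \<bullet> b) = 0"
proof -
  let ?I = "\<lambda>t. integral domain_box (\<lambda>z. \<alpha> (z + t *\<^sub>R b))"
  have small: "norm (t *\<^sub>R b) \<le> 1" if "t \<in> {-1<..<1}" for t
    using that b by (auto intro!: mult_le_one)
  have near: "norm (z + t *\<^sub>R b) \<le> box_radius TYPE('a) + 1" if "t \<in> {-1<..<1}" "z \<in> domain_box" for t z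
    using norm_domain_box_add[OF that(2) small[OF that(1)]] .
  have "(?I has_real_derivative integral domain_box (\<lambda>z. \<alpha>' (z + 0 *\<^sub>R b) \<bullet> b)) (at 0)"
  proof (rule integral_has_real_derivative[where a="-1" and b=1])
    fix t z assume tz: "t \<in> {-1<..<1::real}" "z \<in> (domain_box::'a set)"
    show "((\<lambda>t. \<alpha> (z + t *\<^sub>R b)) has_real_derivative \<alpha>' (z + t *\<^sub>R b) \<bullet> b) (at t)"
      by (intro GDERIV_compose_line der near tz)
  next
    fix t :: real assume t: "t \<in> {-1<..<1}"
    have "continuous_on (cball 0 (box_radius TYPE('a) + 1)) \<alpha>"
      by (rule GDERIV_continuous_on[where f'=\<alpha>']) (simp add: der)
    then show "continuous_on domain_box (\<lambda>z. \<alpha> (z + t *\<^sub>R b))"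
      by (rule continuous_on_compose2) (auto intro!: continuous_intros near t)
  next
    have "continuous_on ({-1<..<1} \<times> domain_box) (\<lambda>p. \<alpha>' (snd p + fst p *\<^sub>R b))"
      by (rule continuous_on_compose2[OF cont]) (auto intro!: continuous_intros near)
    then show "continuous_on ({-1<..<1} \<times> domain_box) (\<lambda>(t, z). \<alpha>' (z + t *\<^sub>R b) \<bullet> b)"
      by (auto simp: split_beta intro!: continuous_intros)
  qed simp
  moreover have "(?I has_real_derivative 0) (at 0)"
  proof (rule has_field_derivative_transform_within_open[where S="{-1<..<1}" and f="\<lambda>t. integral domain_box \<alpha>"])
    show "integral domain_box \<alpha> = ?I t" if "t \<in> {-1<..<1}" for t
      using integral_translate_unit_support[of \<alpha>, OF supp small[OF that]] by simp
  qed auto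
  ultimately show ?thesis
    by (auto dest: DERIV_unique)
qed

text \<open>The product of \<phi> and \<beta> inherits the support of \<phi>, so the integral of its
  gradient vanishes.\<close>

lemma integral_by_parts_domain_box:
  fixes \<phi> \<beta> :: "'a::euclidean_space \<Rightarrow> real"
  assumes \<phi>: "\<And>z. norm z \<le> box_radius TYPE('a) + 1 \<Longrightarrow> GDERIV \<phi> z :> \<phi>' z"
    and c\<phi>: "continuous_on (cball 0 (box_radius TYPE('a) + 1)) \<phi>'"
    and supp: "\<And>z. norm z \<ge> 1 \<Longrightarrow> \<phi> z = 0"
    and \<beta>: "\<And>z. norm z \<le> box_radius TYPE('a) + 1 \<Longrightarrow> GDERIV \<beta> z :> \<beta>' z"
    and c\<beta>: "continuous_on (cball 0 (box_radius TYPE('a) + 1)) \<beta>'"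
    and b: "norm b \<le> 1"
  shows "integral domain_box (\<lambda>z. (\<phi>' z \<bullet> b) * \<beta> z) = - integral domain_box (\<lambda>z. \<phi> z * (\<beta>' z \<bullet> b))"
proof -
  let ?D = "cball 0 (box_radius TYPE('a) + 1) :: 'a set"
  have sub: "domain_box \<subseteq> ?D"
    using norm_domain_box by fastforce
  have c: "continuous_on ?D \<phi>" "continuous_on ?D \<beta>"
    by (auto intro!: GDERIV_continuous_on \<phi> \<beta>)
  note cs = c[THEN continuous_on_subset, OF sub] c\<phi>[THEN continuous_on_subset, OF sub]
    c\<beta>[THEN continuous_on_subset, OF sub]
  have "integral domain_box (\<lambda>z. (\<phi> z *\<^sub>R \<beta>' z + \<beta> z *\<^sub>R \<phi>' z) \<bullet> b) = 0"
  proof (rule integral_gradient_eq_0[OF _ _ _ b])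
    show "GDERIV (\<lambda>z. \<phi> z * \<beta> z) z :> \<phi> z *\<^sub>R \<beta>' z + \<beta> z *\<^sub>R \<phi>' z"
      if "norm z \<le> box_radius TYPE('a) + 1" for z
      using GDERIV_mult[OF \<phi>[OF that] \<beta>[OF that]] by (simp add: add.commute)
    show "continuous_on ?D (\<lambda>z. \<phi> z *\<^sub>R \<beta>' z + \<beta> z *\<^sub>R \<phi>' z)"
      by (intro continuous_intros c c\<phi> c\<beta>)
  qed (simp add: supp)
  moreover have "(\<lambda>z. (\<phi> z *\<^sub>R \<beta>' z + \<beta> z *\<^sub>R \<phi>' z) \<bullet> b) =
      (\<lambda>z. \<phi> z * (\<beta>' z \<bullet> b) + (\<phi>' z \<bullet> b) * \<beta> z)"
    by (simp add: inner_add_left mult.commute)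
  moreover have "integral domain_box (\<lambda>z. \<phi> z * (\<beta>' z \<bullet> b) + (\<phi>' z \<bullet> b) * \<beta> z) =
     integral domain_box (\<lambda>z. \<phi> z * (\<beta>' z \<bullet> b)) + integral domain_box (\<lambda>z. (\<phi>' z \<bullet> b) * \<beta> z)"
    by (intro integral_add integrable_continuous continuous_intros cs)
  ultimately show ?thesis by simp
qed

text \<open>
  For twice differentiable \<open>\<beta>\<close> both sides are minus the integral of \<open>\<alpha>\<close> times a third derivative.
  For \<open>\<beta>\<close> of class \<open>C\<^sup>1\<close>, differentiate the integration by parts formula along a translation.
\<close>

lemma integral_gradient_swap:
  fixes \<alpha> \<beta> :: "'a::euclidean_space \<Rightarrow> real"
  assumes \<alpha>: "\<And>z. norm z \<le> box_radius TYPE('a) + 1 \<Longrightarrow> GDERIV \<alpha> z :> \<alpha>' z"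
    and c\<alpha>: "continuous_on (cball 0 (box_radius TYPE('a) + 1)) \<alpha>'"
    and supp: "\<And>z. norm z \<ge> 1 \<Longrightarrow> \<alpha> z = 0"
    and \<beta>: "\<And>z. norm z \<le> box_radius TYPE('a) + 2 \<Longrightarrow> GDERIV \<beta> z :> \<beta>' z"
    and c\<beta>: "continuous_on (cball 0 (box_radius TYPE('a) + 2)) \<beta>'"
    and a: "norm a \<le> 1" and b: "norm b \<le> 1"
  shows "integral domain_box (\<lambda>z. (\<alpha>' z \<bullet> a) * (\<beta>' z \<bullet> b)) =
    integral domain_box (\<lambda>z. (\<alpha>' z \<bullet> b) * (\<beta>' z \<bullet> a))"
proof -
  let ?\<rho> = "box_radius TYPE('a)"
  let ?I = "\<lambda>t. integral domain_box (\<lambda>z. (\<alpha>' z \<bullet> a) * \<beta> (z + t *\<^sub>R b))"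
  let ?J = "\<lambda>t. integral domain_box (\<lambda>z. \<alpha> (z + t *\<^sub>R (-b)) * (\<beta>' z \<bullet> a))"
  have small: "norm (t *\<^sub>R b) \<le> 1" if "t \<in> {-1<..<1}" for t
    using that b by (auto intro!: mult_le_one)
  have near: "norm (z + t *\<^sub>R b) \<le> ?\<rho> + 1" "norm (z + t *\<^sub>R (-b)) \<le> ?\<rho> + 1"
    if "t \<in> {-1<..<1}" "z \<in> domain_box" for t z
    using norm_domain_box_add[OF that(2), of "t *\<^sub>R b" 1] norm_domain_box_add[OF that(2), of "-(t *\<^sub>R b)" 1]
      small[OF that(1)] by auto
  have near2: "norm (z + t *\<^sub>R b) \<le> ?\<rho> + 2" if "t \<in> {-1<..<1}" "norm z \<le> ?\<rho> + 1" for t z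
    using norm_triangle_ineq[of z "t *\<^sub>R b"] small[OF that(1)] that(2) by linarith
  have "norm z \<le> ?\<rho> + 1 \<and> norm z \<le> ?\<rho> + 2" if "z \<in> domain_box" for z :: 'a
    using norm_domain_box[OF that] by linarith
  then have sub: "(domain_box::'a set) \<subseteq> cball 0 (?\<rho> + 1)" "(domain_box::'a set) \<subseteq> cball 0 (?\<rho> + 2)"
    by auto
  have contc: "continuous_on (cball 0 (?\<rho> + 1)) \<alpha>" "continuous_on (cball 0 (?\<rho> + 2)) \<beta>"
    by (auto intro!: GDERIV_continuous_on \<alpha> \<beta>)
  have cP: "continuous_on domain_box \<alpha>'" "continuous_on domain_box \<beta>'"
    using c\<alpha> c\<beta> sub continuous_on_subset by blast+
  have I: "(?I has_real_derivative integral domain_box (\<lambda>z. (\<alpha>' z \<bullet> a) * (\<beta>' (z + 0 *\<^sub>R b) \<bullet> b))) (at 0)"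
  proof (rule integral_has_real_derivative[where a="-1" and b=1])
    fix t z assume tz: "t \<in> {-1<..<1::real}" "z \<in> (domain_box::'a set)"
    have "((\<lambda>t. \<beta> (z + t *\<^sub>R b)) has_real_derivative \<beta>' (z + t *\<^sub>R b) \<bullet> b) (at t)"
      using near(1)[OF tz] by (intro GDERIV_compose_line \<beta>) linarith
    then show "((\<lambda>t. (\<alpha>' z \<bullet> a) * \<beta> (z + t *\<^sub>R b)) has_real_derivative
        (\<alpha>' z \<bullet> a) * (\<beta>' (z + t *\<^sub>R b) \<bullet> b)) (at t)"
      by (rule DERIV_cmult)
  next
    fix t :: real assume t: "t \<in> {-1<..<1}"
    have "continuous_on domain_box (\<lambda>z. \<beta> (z + t *\<^sub>R b))"
      by (rule continuous_on_compose2[OF contc(2)])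
        (use near(1)[OF t] in \<open>fastforce intro!: continuous_intros\<close>)+
    then show "continuous_on domain_box (\<lambda>z. (\<alpha>' z \<bullet> a) * \<beta> (z + t *\<^sub>R b))"
      by (intro continuous_intros cP)
  next
    have 1: "continuous_on ({-1<..<1} \<times> domain_box) (\<lambda>p. \<beta>' (snd p + fst p *\<^sub>R b))"
      by (rule continuous_on_compose2[OF c\<beta>]) (use near(1) in \<open>fastforce intro!: continuous_intros\<close>)+
    have 2: "continuous_on ({-1<..<1::real} \<times> domain_box) (\<lambda>p. \<alpha>' (snd p))"
      by (rule continuous_on_compose2[OF cP(1)]) (auto intro!: continuous_intros)
    show "continuous_on ({-1<..<1} \<times> domain_box) (\<lambda>(t, z). (\<alpha>' z \<bullet> a) * (\<beta>' (z + t *\<^sub>R b) \<bullet> b))"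
      unfolding split_beta by (intro continuous_intros 1 2)
  qed simp
  have J: "(?J has_real_derivative integral domain_box (\<lambda>z. (\<alpha>' (z + 0 *\<^sub>R (-b)) \<bullet> (-b)) * (\<beta>' z \<bullet> a))) (at 0)"
  proof (rule integral_has_real_derivative[where a="-1" and b=1])
    fix t z assume tz: "t \<in> {-1<..<1::real}" "z \<in> (domain_box::'a set)"
    have "((\<lambda>t. \<alpha> (z + t *\<^sub>R (-b))) has_real_derivative \<alpha>' (z + t *\<^sub>R (-b)) \<bullet> (-b)) (at t)"
      by (intro GDERIV_compose_line \<alpha> near tz)
    then show "((\<lambda>t. \<alpha> (z + t *\<^sub>R (-b)) * (\<beta>' z \<bullet> a)) has_real_derivative
        (\<alpha>' (z + t *\<^sub>R (-b)) \<bullet> (-b)) * (\<beta>' z \<bullet> a)) (at t)"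
      by (rule DERIV_cmult_right)
  next
    fix t :: real assume t: "t \<in> {-1<..<1}"
    have "continuous_on domain_box (\<lambda>z. \<alpha> (z + t *\<^sub>R (-b)))"
      by (rule continuous_on_compose2[OF contc(1)])
        (use near(2)[OF t] in \<open>fastforce intro!: continuous_intros\<close>)+
    then show "continuous_on domain_box (\<lambda>z. \<alpha> (z + t *\<^sub>R (-b)) * (\<beta>' z \<bullet> a))"
      by (intro continuous_intros cP)
  next
    have 1: "continuous_on ({-1<..<1} \<times> domain_box) (\<lambda>p. \<alpha>' (snd p + fst p *\<^sub>R (-b)))"
      by (rule continuous_on_compose2[OF c\<alpha>]) (use near(2) in \<open>fastforce intro!: continuous_intros\<close>)+
    have 2: "continuous_on ({-1<..<1::real} \<times> domain_box) (\<lambda>p. \<beta>' (snd p))"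
      by (rule continuous_on_compose2[OF cP(2)]) (auto intro!: continuous_intros)
    show "continuous_on ({-1<..<1} \<times> domain_box) (\<lambda>(t, z). (\<alpha>' (z + t *\<^sub>R (-b)) \<bullet> (-b)) * (\<beta>' z \<bullet> a))"
      unfolding split_beta by (intro continuous_intros 1 2)
  qed simp
  \<comment> \<open>Integrate by parts in direction a, then shift the variable so that the
    translation acts on \<alpha>. The derivative in t now falls on \<alpha>, and \<beta> is never
    differentiated twice.\<close>
  have IJ: "?I t = - ?J t" if t: "t \<in> {-1<..<1}" for t
  proof -
    have "?I t = - integral domain_box (\<lambda>z. \<alpha> z * (\<beta>' (z + t *\<^sub>R b) \<bullet> a))"
    proof (rule integral_by_parts_domain_box[OF \<alpha> c\<alpha> supp _ _ a])
      show "GDERIV (\<lambda>z. \<beta> (z + t *\<^sub>R b)) z :> \<beta>' (z + t *\<^sub>R b)" if "norm z \<le> ?\<rho> + 1" for z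
        by (intro GDERIV_translate \<beta> near2 t that)
      show "continuous_on (cball 0 (?\<rho> + 1)) (\<lambda>z. \<beta>' (z + t *\<^sub>R b))"
        by (rule continuous_on_compose2[OF c\<beta>]) (use near2[OF t] in \<open>auto intro!: continuous_intros\<close>)
    qed auto
    also have "integral domain_box (\<lambda>z. \<alpha> z * (\<beta>' (z + t *\<^sub>R b) \<bullet> a)) = ?J t"
    proof -
      have "integral domain_box (\<lambda>z. (\<lambda>z. \<alpha> z * (\<beta>' (z + t *\<^sub>R b) \<bullet> a)) (z + t *\<^sub>R (-b))) =
         integral domain_box (\<lambda>z. \<alpha> z * (\<beta>' (z + t *\<^sub>R b) \<bullet> a))"
        by (rule integral_translate_unit_support) (use supp small[OF t] in auto)
      then show ?thesis by simp
    qed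
    finally show ?thesis .
  qed
  have "(?I has_real_derivative - integral domain_box (\<lambda>z. (\<alpha>' (z + 0 *\<^sub>R (-b)) \<bullet> (-b)) * (\<beta>' z \<bullet> a))) (at 0)"
    by (rule has_field_derivative_transform_within_open[OF DERIV_minus[OF J], where S="{-1<..<1}"])
      (simp_all add: IJ)
  from DERIV_unique[OF I this] show ?thesis by simp
qed

section \<open>Mollification by a radial kernel\<close>

text \<open>For j \<ge> 1 this is of class C^(j - 1), which decides the exponents below. For j = 0
  it is constantly 1, so compact support requires a positive exponent.\<close>

definition bump :: "nat \<Rightarrow> 'a::real_inner \<Rightarrow> real" where
  "bump j z = max 0 (1 - z \<bullet> z) ^ j"

lemma continuous_on_bump [continuous_intros]:
  fixes f :: "'b::topological_space \<Rightarrow> 'a::real_inner"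
  shows "continuous_on S f \<Longrightarrow> continuous_on S (\<lambda>x. bump j (f x))"
  unfolding bump_def by (intro continuous_intros)

lemma bump_eq_0: "norm z \<ge> 1 \<Longrightarrow> 0 < j \<Longrightarrow> bump j z = 0"
  unfolding bump_def power2_norm_eq_inner[symmetric] by (simp add: max_absorb1 one_le_power)

text \<open>An exponent of at least 2 makes the difference quotient at 0 equal to
  \<open>max 0 h ^ Suc n\<close>, which tends to 0.\<close>

lemma DERIV_pos_part_power:
  "((\<lambda>s::real. max 0 s ^ Suc (Suc n)) has_real_derivative real (Suc (Suc n)) * max 0 s ^ Suc n) (at s)"
proof -
  consider "s > 0" | "s < 0" | "s = 0" by linarith
  then show ?thesis
  proof cases
    case 1
    have "((\<lambda>s::real. s ^ Suc (Suc n)) has_real_derivative real (Suc (Suc n)) * s ^ Suc n) (at s)"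
      by (rule derivative_eq_intros refl | simp)+
    then show ?thesis
      using 1 by (auto intro: has_field_derivative_transform_within_open[where S="{0<..}"])
  next
    case 2
    have "((\<lambda>s::real. max 0 s ^ Suc (Suc n)) has_real_derivative 0) (at s)"
      by (rule has_field_derivative_transform_within_open[where S="{..<0}" and f="\<lambda>s. 0"])
        (use 2 in \<open>auto simp: max_absorb1\<close>)
    then show ?thesis
      using 2 by (simp add: max_absorb1)
  next
    case 3
    have "((\<lambda>h::real. max 0 h ^ Suc n) \<longlongrightarrow> max 0 0 ^ Suc n) (at 0)"
      by (intro tendsto_intros)
    moreover have "eventually (\<lambda>h::real. max 0 h ^ Suc n = (max 0 (0 + h) ^ Suc (Suc n) - max 0 0 ^ Suc (Suc n)) / h) (at 0)"
      by (auto simp: eventually_at_filter max_def)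
    ultimately have "((\<lambda>h::real. (max 0 (0 + h) ^ Suc (Suc n) - max 0 0 ^ Suc (Suc n)) / h) \<longlongrightarrow> 0) (at 0)"
      by (simp add: tendsto_cong)
    then show ?thesis
      using 3 by (simp add: DERIV_def)
  qed
qed

lemma GDERIV_bump:
  "GDERIV (bump (Suc (Suc n))) z :> (- 2 * real (Suc (Suc n)) * bump (Suc n) z) *\<^sub>R z"
proof -
  have "GDERIV (\<lambda>z. 1 - z \<bullet> z) z :> - 2 *\<^sub>R z"
    unfolding gderiv_def by (auto intro!: derivative_eq_intros simp: inner_commute)
  from GDERIV_DERIV_compose[OF this DERIV_pos_part_power[of n]]
  show ?thesis
    unfolding bump_def[abs_def] by (rule GDERIV_subst) (simp add: algebra_simps)
qed

lemma GDERIV_inner_const: "GDERIV (\<lambda>z. z \<bullet> b) z :> b"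
  unfolding gderiv_def by (auto intro!: derivative_eq_intros)

lemma GDERIV_cmult: "GDERIV f z :> D \<Longrightarrow> GDERIV (\<lambda>z. c * f z) z :> c *\<^sub>R D"
  using GDERIV_mult[OF GDERIV_const, of f z D c] by simp

definition test_fun :: "('a::euclidean_space \<Rightarrow> real) \<Rightarrow> ('a \<Rightarrow> 'a) \<Rightarrow> bool" where
  "test_fun \<phi> \<phi>' \<longleftrightarrow> (\<forall>z. GDERIV \<phi> z :> \<phi>' z) \<and> continuous_on UNIV \<phi>' \<and> (\<forall>z. norm z \<ge> 1 \<longrightarrow> \<phi> z = 0)"

lemma test_fun_continuous:
  assumes "test_fun \<phi> \<phi>'"
  shows "continuous_on S \<phi>" "continuous_on S \<phi>'"
  using assms unfolding test_fun_def
  by (auto intro: GDERIV_continuous_on continuous_on_subset)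

text \<open>
  The regularity argument rests on a radial kernel \<open>k\<close> with \<open>k(z) z = - \<nabla>L(z)\<close>: the dilations
  \<open>k\<^sub>r\<close> of such a kernel satisfy \<open>d k\<^sub>r / d r = r \<Delta>L\<^sub>r\<close>, so that the \<open>r\<close>-derivative of a mollification
  is controlled by the Laplacian of the mollified function. Here \<open>L = bump 4\<close> and \<open>k = 8 bump 3\<close>.
\<close>

definition mollifier :: "'a::euclidean_space \<Rightarrow> real" where
  "mollifier z = 8 * bump 3 z"

definition mollifier_grad :: "'a::euclidean_space \<Rightarrow> 'a" where
  "mollifier_grad z = (- 48 * bump 2 z) *\<^sub>R z"

text \<open>Second directional derivatives of \<open>mollifier\<close>. The factor
  \<open>bump 1\<close> is merely continuous, which is enough for integrating against it.\<close>

definition mollifier_hess :: "'a::euclidean_space \<Rightarrow> 'a \<Rightarrow> 'a \<Rightarrow> real" where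
  "mollifier_hess b c z = - 48 * (b \<bullet> c) * bump 2 z + 192 * (z \<bullet> b) * (z \<bullet> c) * bump 1 z"

text \<open>Second directional derivatives of L = \<open>bump 4\<close>. The exponent 4 leaves these
  of class C^1, so that they can serve as test functions for a weak divergence.\<close>

definition potential_hess :: "'a::euclidean_space \<Rightarrow> 'a \<Rightarrow> 'a \<Rightarrow> real" where
  "potential_hess b c z = - 8 * (b \<bullet> c) * bump 3 z + 48 * (z \<bullet> b) * (z \<bullet> c) * bump 2 z"

definition mollifier_grad_grad :: "'a::euclidean_space \<Rightarrow> 'a \<Rightarrow> 'a" where
  "mollifier_grad_grad b z = (- 48 * bump 2 z) *\<^sub>R b + (192 * (z \<bullet> b) * bump 1 z) *\<^sub>R z"

text \<open>The derivatives in directions b and c applied to the gradient of L, which is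
  \<open>- (mollifier z *\<^sub>R z)\<close>. In this form the third derivatives of L are expressed
  through derivatives of the kernel.\<close>

definition potential_hess_grad :: "'a::euclidean_space \<Rightarrow> 'a \<Rightarrow> 'a \<Rightarrow> 'a" where
  "potential_hess_grad b c z =
     - (mollifier_hess b c z *\<^sub>R z + (mollifier_grad z \<bullet> c) *\<^sub>R b + (mollifier_grad z \<bullet> b) *\<^sub>R c)"

definition potential_grad_grad :: "'a::euclidean_space \<Rightarrow> 'a \<Rightarrow> 'a" where
  "potential_grad_grad b z = (- 8 * bump 3 z) *\<^sub>R b + (48 * (z \<bullet> b) * bump 2 z) *\<^sub>R z"

lemma GDERIV_bump_numeral:
  "GDERIV (bump 2) z :> (- 4 * bump 1 z) *\<^sub>R z" "GDERIV (bump 3) z :> (- 6 * bump 2 z) *\<^sub>R z"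
  using GDERIV_bump[of 0 z] GDERIV_bump[of 1 z] by (simp_all add: numeral_2_eq_2 numeral_3_eq_3)

lemma test_fun_mollifier: "test_fun mollifier mollifier_grad"
  unfolding test_fun_def
proof (intro conjI allI impI)
  show "GDERIV mollifier z :> mollifier_grad z" for z :: 'a
    using GDERIV_cmult[OF GDERIV_bump_numeral(2), of 8 z]
    by (simp add: mollifier_def[abs_def] mollifier_grad_def)
  show "continuous_on UNIV (mollifier_grad :: 'a \<Rightarrow> 'a)"
    unfolding mollifier_grad_def by (intro continuous_intros)
qed (simp add: mollifier_def bump_eq_0)

lemma test_fun_mollifier_grad: "test_fun (\<lambda>z. mollifier_grad z \<bullet> b) (mollifier_grad_grad b)"
  unfolding test_fun_def
proof (intro conjI allI impI)
  show "GDERIV (\<lambda>z. mollifier_grad z \<bullet> b) z :> mollifier_grad_grad b z" for z :: 'a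
  proof -
    have "(\<lambda>z. mollifier_grad z \<bullet> b) = (\<lambda>z. - 48 * (bump 2 z * (z \<bullet> b)))"
      by (simp add: mollifier_grad_def fun_eq_iff)
    then show ?thesis
      using GDERIV_cmult[OF GDERIV_mult[OF GDERIV_bump_numeral(1) GDERIV_inner_const], of "-48" b z]
      by (elim ssubst GDERIV_subst) (simp add: mollifier_grad_grad_def algebra_simps)
  qed
  show "continuous_on UNIV (mollifier_grad_grad b)"
    unfolding mollifier_grad_grad_def by (intro continuous_intros)
qed (simp add: mollifier_grad_def bump_eq_0)

lemma test_fun_potential_grad: "test_fun (\<lambda>z. - 8 * bump 3 z * (z \<bullet> b)) (potential_grad_grad b)"
  unfolding test_fun_def
proof (intro conjI allI impI)
  show "GDERIV (\<lambda>z. - 8 * bump 3 z * (z \<bullet> b)) z :> potential_grad_grad b z" for z :: 'a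
    using GDERIV_cmult[OF GDERIV_mult[OF GDERIV_bump_numeral(2) GDERIV_inner_const], of "-8" b z]
    unfolding mult.assoc by (rule GDERIV_subst) (simp add: potential_grad_grad_def algebra_simps)
  show "continuous_on UNIV (potential_grad_grad b)"
    unfolding potential_grad_grad_def by (intro continuous_intros)
qed (simp add: bump_eq_0)

lemma mollifier_grad_grad_inner: "mollifier_grad_grad b z \<bullet> c = mollifier_hess b c z"
  by (simp add: mollifier_grad_grad_def mollifier_hess_def inner_add_left algebra_simps)

lemma potential_grad_grad_inner: "potential_grad_grad b z \<bullet> c = potential_hess b c z"
  by (simp add: potential_grad_grad_def potential_hess_def inner_add_left algebra_simps)

lemma mollifier_hess_commute: "mollifier_hess b c z = mollifier_hess c b z"
  by (simp add: mollifier_hess_def inner_commute mult_ac)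

lemma test_fun_potential_hess: "test_fun (potential_hess b c) (potential_hess_grad b c)"
  unfolding test_fun_def
proof (intro conjI allI impI)
  show "GDERIV (potential_hess b c) z :> potential_hess_grad b c z" for z :: 'a
  proof -
    have "GDERIV (\<lambda>z. (- 8 * (b \<bullet> c)) * bump 3 z + 48 * ((z \<bullet> b) * ((z \<bullet> c) * bump 2 z))) z :>
      (- 8 * (b \<bullet> c)) *\<^sub>R ((- 6 * bump 2 z) *\<^sub>R z) +
      48 *\<^sub>R ((z \<bullet> b) *\<^sub>R ((z \<bullet> c) *\<^sub>R ((- 4 * bump 1 z) *\<^sub>R z) + bump 2 z *\<^sub>R c)
        + ((z \<bullet> c) * bump 2 z) *\<^sub>R b)"
      by (intro GDERIV_add GDERIV_cmult GDERIV_mult GDERIV_bump_numeral GDERIV_inner_const)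
    moreover have "(\<lambda>z. (- 8 * (b \<bullet> c)) * bump 3 z + 48 * ((z \<bullet> b) * ((z \<bullet> c) * bump 2 z))) = potential_hess b c"
      by (simp add: potential_hess_def fun_eq_iff)
    moreover have "(- 8 * (b \<bullet> c)) *\<^sub>R ((- 6 * bump 2 z) *\<^sub>R z) +
      48 *\<^sub>R ((z \<bullet> b) *\<^sub>R ((z \<bullet> c) *\<^sub>R ((- 4 * bump 1 z) *\<^sub>R z) + bump 2 z *\<^sub>R c)
        + ((z \<bullet> c) * bump 2 z) *\<^sub>R b) = potential_hess_grad b c z"
      unfolding potential_hess_grad_def mollifier_hess_def mollifier_grad_def
      by (simp add: algebra_simps)
    ultimately show ?thesis by simp
  qed
  show "continuous_on UNIV (potential_hess_grad b c)"
    unfolding potential_hess_grad_def mollifier_hess_def mollifier_grad_def by (intro continuous_intros)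
qed (simp add: potential_hess_def bump_eq_0)

lemma continuous_on_mollifier_hess: "continuous_on S (mollifier_hess b c)"
  unfolding mollifier_hess_def[abs_def] by (intro continuous_intros)

section \<open>Averages of dilated functions, and divergence in the weak sense\<close>

definition average :: "('a::euclidean_space \<Rightarrow> real) \<Rightarrow> ('a \<Rightarrow> real) \<Rightarrow> real \<Rightarrow> 'a \<Rightarrow> real" where
  "average \<phi> w r x = integral domain_box (\<lambda>z. \<phi> z * w (x + r *\<^sub>R z))"

text \<open>All points \<open>x + r *\<^sub>R z\<close> with
  \<open>norm z \<le> box_radius + 2\<close> stay in S. The margin 2 is that of
  \<open>integral_gradient_swap\<close>, which translates once and integrates by parts once, each at
  the cost of 1.\<close>

abbreviation room :: "'a::euclidean_space set \<Rightarrow> 'a \<Rightarrow> real \<Rightarrow> bool" where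
  "room S x r \<equiv> cball x (r * (box_radius TYPE('a) + 2)) \<subseteq> S"

lemma roomD:
  fixes x :: "'a::euclidean_space"
  assumes "room S x r" "norm z \<le> box_radius TYPE('a) + 2" "0 \<le> r"
  shows "x + r *\<^sub>R z \<in> S"
proof -
  have "norm (r *\<^sub>R z) \<le> r * (box_radius TYPE('a) + 2)"
    using assms(2,3) by (simp add: mult_left_mono)
  then have "x + r *\<^sub>R z \<in> cball x (r * (box_radius TYPE('a) + 2))"
    by (simp add: dist_norm)
  then show ?thesis using assms(1) by blast
qed

lemma room_mono:
  fixes x :: "'a::euclidean_space"
  assumes "room S x R" "r \<le> R"
  shows "room S x r"
proof -
  have "r * (box_radius TYPE('a) + 2) \<le> R * (box_radius TYPE('a) + 2)"
    using assms(2) by (intro mult_right_mono) auto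
  then show ?thesis using assms(1) by (meson order_trans subset_cball)
qed

lemma domain_box_room:
  fixes x :: "'a::euclidean_space"
  assumes "room S x r" "z \<in> domain_box" "0 \<le> r"
  shows "x + r *\<^sub>R z \<in> S"
  using roomD[OF assms(1) _ assms(3), of z] norm_domain_box[OF assms(2)] by linarith

lemma continuous_on_dilation:
  fixes x :: "'a::euclidean_space"
  assumes "continuous_on S w" "room S x r" "0 \<le> r"
  shows "continuous_on domain_box (\<lambda>z. w (x + r *\<^sub>R z))"
    "d \<le> box_radius TYPE('a) + 2 \<Longrightarrow> continuous_on (cball 0 d) (\<lambda>z. w (x + r *\<^sub>R z))"
proof -
  show "continuous_on domain_box (\<lambda>z. w (x + r *\<^sub>R z))"
    using domain_box_room[OF assms(2) _ assms(3)]
    by (intro continuous_on_compose2[OF assms(1)] continuous_intros) blast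
  show "continuous_on (cball 0 d) (\<lambda>z. w (x + r *\<^sub>R z))" if d: "d \<le> box_radius TYPE('a) + 2"
  proof (intro continuous_on_compose2[OF assms(1)] continuous_intros)
    have "x + r *\<^sub>R z \<in> S" if "norm z \<le> d" for z
      using roomD[OF assms(2) _ assms(3), of z] d that by linarith
    then show "(\<lambda>z. x + r *\<^sub>R z) ` cball 0 d \<subseteq> S"
      by auto
  qed
qed

text \<open>The function w is evaluated at \<open>x + r *\<^sub>R z\<close>, so each derivative
  moved from the kernel to w brings a factor r.\<close>

lemma average_by_parts:
  fixes x :: "'a::euclidean_space"
  assumes \<phi>: "test_fun \<phi> \<phi>'"
    and w: "\<And>y. y \<in> S \<Longrightarrow> GDERIV w y :> G y" and G: "continuous_on S G"
    and r: "room S x r" "0 \<le> r" and b: "norm b \<le> 1"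
  shows "average (\<lambda>z. \<phi>' z \<bullet> b) w r x = - r * average \<phi> (\<lambda>y. G y \<bullet> b) r x"
proof -
  have "integral domain_box (\<lambda>z. (\<phi>' z \<bullet> b) * w (x + r *\<^sub>R z)) =
      - integral domain_box (\<lambda>z. \<phi> z * ((r *\<^sub>R G (x + r *\<^sub>R z)) \<bullet> b))"
  proof (rule integral_by_parts_domain_box[OF _ _ _ _ _ b])
    show "GDERIV (\<lambda>z. w (x + r *\<^sub>R z)) z :> r *\<^sub>R G (x + r *\<^sub>R z)"
      if "norm z \<le> box_radius TYPE('a) + 1" for z
      by (intro GDERIV_compose_affine w roomD[OF r(1)]) (use that r in linarith)+
    show "continuous_on (cball 0 (box_radius TYPE('a) + 1)) (\<lambda>z. r *\<^sub>R G (x + r *\<^sub>R z))"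
      by (intro continuous_intros continuous_on_dilation(2)[OF G r]) simp
  qed (use \<phi> in \<open>auto simp: test_fun_def intro: continuous_on_subset\<close>)
  also have "integral domain_box (\<lambda>z. \<phi> z * ((r *\<^sub>R G (x + r *\<^sub>R z)) \<bullet> b)) =
      r * integral domain_box (\<lambda>z. \<phi> z * (G (x + r *\<^sub>R z) \<bullet> b))"
    unfolding integral_mult_right[symmetric] by (simp add: mult_ac)
  finally show ?thesis by (simp add: average_def)
qed

lemma average_by_parts2:
  fixes x :: "'a::euclidean_space"
  assumes w: "\<And>y. y \<in> S \<Longrightarrow> GDERIV w y :> G y" and G: "continuous_on S G"
    and r: "room S x r" "0 \<le> r" and b: "norm c \<le> 1"
  shows "average (mollifier_hess b c) w r x = - r * average (\<lambda>z. mollifier_grad z \<bullet> b) (\<lambda>y. G y \<bullet> c) r x"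
  using average_by_parts[OF test_fun_mollifier_grad w G r b, of b] by (simp add: mollifier_grad_grad_inner)

lemma average_deriv_line:
  fixes x :: "'a::euclidean_space"
  assumes \<phi>: "continuous_on domain_box \<phi>"
    and w: "\<And>y. y \<in> S \<Longrightarrow> GDERIV w y :> G y" and G: "continuous_on S G"
    and r: "room S x r" "0 < r" and b: "norm b \<le> 1"
  shows "((\<lambda>t. average \<phi> w r (x + t *\<^sub>R b)) has_real_derivative average \<phi> (\<lambda>y. G y \<bullet> b) r x) (at 0)"
proof -
  let ?\<rho> = "box_radius TYPE('a)"
  have near: "(x + t *\<^sub>R b) + r *\<^sub>R z \<in> S" if t: "t \<in> {-r<..<r}" and z: "z \<in> domain_box" for t z
  proof -
    \<comment> \<open>Moving x by t b amounts to moving z by (t / r) b, which has length at most 1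
      for |t| < r and is therefore covered by the margin in \<open>room\<close>.\<close>
    have "norm ((t / r) *\<^sub>R b) \<le> 1 * 1"
      using t r(2) b unfolding norm_scaleR by (intro mult_mono) auto
    then have "x + r *\<^sub>R (z + (t / r) *\<^sub>R b) \<in> S"
      using norm_domain_box_add[OF z, of "(t / r) *\<^sub>R b" 1] r by (intro roomD) auto
    then show ?thesis using r by (simp add: algebra_simps)
  qed
  have w': "continuous_on S w" by (rule GDERIV_continuous_on[OF w])
  have "((\<lambda>t. integral domain_box (\<lambda>z. \<phi> z * w ((x + t *\<^sub>R b) + r *\<^sub>R z))) has_real_derivative
      integral domain_box (\<lambda>z. \<phi> z * (G ((x + 0 *\<^sub>R b) + r *\<^sub>R z) \<bullet> b))) (at 0)"
  proof (rule integral_has_real_derivative[where a="-r" and b=r])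
    fix t z assume tz: "t \<in> {-r<..<r}" "z \<in> (domain_box::'a set)"
    have "((\<lambda>t. w ((x + r *\<^sub>R z) + t *\<^sub>R b)) has_real_derivative G ((x + r *\<^sub>R z) + t *\<^sub>R b) \<bullet> b) (at t)"
      by (intro GDERIV_compose_line w) (use near[OF tz] in \<open>simp add: add_ac\<close>)
    then show "((\<lambda>t. \<phi> z * w ((x + t *\<^sub>R b) + r *\<^sub>R z)) has_real_derivative
        \<phi> z * (G ((x + t *\<^sub>R b) + r *\<^sub>R z) \<bullet> b)) (at t)"
      by (intro DERIV_cmult) (simp add: add_ac)
  next
    fix t assume t: "t \<in> {-r<..<r}"
    show "continuous_on domain_box (\<lambda>z. \<phi> z * w ((x + t *\<^sub>R b) + r *\<^sub>R z))"
      by (intro continuous_on_mult \<phi> continuous_on_compose2[OF w'])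
        (use near[OF t] in \<open>auto intro!: continuous_intros\<close>)
  next
    have 1: "continuous_on ({-r<..<r} \<times> domain_box) (\<lambda>p. G ((x + fst p *\<^sub>R b) + r *\<^sub>R snd p))"
      by (rule continuous_on_compose2[OF G]) (use near in \<open>auto intro!: continuous_intros\<close>)
    have 2: "continuous_on ({-r<..<r} \<times> domain_box) (\<lambda>p. \<phi> (snd p))"
      by (rule continuous_on_compose2[OF \<phi>]) (auto intro!: continuous_intros)
    show "continuous_on ({-r<..<r} \<times> domain_box) (\<lambda>(t, z). \<phi> z * (G ((x + t *\<^sub>R b) + r *\<^sub>R z) \<bullet> b))"
      unfolding split_beta by (intro continuous_intros 1 2)
  qed (use r in simp)
  then show ?thesis by (simp add: average_def)
qed

lemma average_deriv_radius:
  fixes x :: "'a::euclidean_space"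
  assumes \<phi>: "continuous_on domain_box \<phi>"
    and w: "\<And>y. y \<in> S \<Longrightarrow> GDERIV w y :> G y" and G: "continuous_on S G"
    and R: "room S x R" and r: "0 < r" "r < R"
  shows "((\<lambda>r. average \<phi> w r x) has_real_derivative
      integral domain_box (\<lambda>z. \<phi> z * (G (x + r *\<^sub>R z) \<bullet> z))) (at r)"
proof -
  have near: "x + t *\<^sub>R z \<in> S" if t: "t \<in> {0<..<R}" and z: "z \<in> domain_box" for t z
    using domain_box_room[OF room_mono[OF R, of t] z] t by auto
  have w': "continuous_on S w" by (rule GDERIV_continuous_on[OF w])
  show ?thesis
    unfolding average_def
  proof (rule integral_has_real_derivative[where a=0 and b=R])
    fix t z assume tz: "t \<in> {0<..<R}" "z \<in> (domain_box::'a set)"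
    show "((\<lambda>t. \<phi> z * w (x + t *\<^sub>R z)) has_real_derivative \<phi> z * (G (x + t *\<^sub>R z) \<bullet> z)) (at t)"
      by (intro DERIV_cmult GDERIV_compose_line w near tz)
  next
    fix t assume t: "t \<in> {0<..<R}"
    show "continuous_on domain_box (\<lambda>z. \<phi> z * w (x + t *\<^sub>R z))"
      by (intro continuous_on_mult \<phi> continuous_on_compose2[OF w'])
        (use near[OF t] in \<open>auto intro!: continuous_intros\<close>)
  next
    have 1: "continuous_on ({0<..<R} \<times> domain_box) (\<lambda>p. G (x + fst p *\<^sub>R snd p))"
      by (rule continuous_on_compose2[OF G]) (use near in \<open>auto intro!: continuous_intros\<close>)
    have 2: "continuous_on ({0<..<R} \<times> domain_box) (\<lambda>p. \<phi> (snd p))"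
      by (rule continuous_on_compose2[OF \<phi>]) (auto intro!: continuous_intros)
    show "continuous_on ({0<..<R} \<times> domain_box) (\<lambda>(t, z). \<phi> z * (G (x + t *\<^sub>R z) \<bullet> z))"
      unfolding split_beta by (intro continuous_intros 1 2)
  qed (use r in simp)
qed

text \<open>The weak form of div G = h, tested with functions dilated to radius r about x and
  written in the variable z; the chain rule accounts for the factor r.\<close>

definition weak_div :: "'a::euclidean_space set \<Rightarrow> ('a \<Rightarrow> 'a) \<Rightarrow> ('a \<Rightarrow> real) \<Rightarrow> bool" where
  "weak_div S G h \<longleftrightarrow> (\<forall>\<phi> \<phi>' x r. test_fun \<phi> \<phi>' \<and> 0 < r \<and> room S x r \<longrightarrow>
     integral domain_box (\<lambda>z. \<phi>' z \<bullet> G (x + r *\<^sub>R z)) = - r * average \<phi> h r x)"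

lemma weak_divD:
  "weak_div S G h \<Longrightarrow> test_fun \<phi> \<phi>' \<Longrightarrow> 0 < r \<Longrightarrow> room S x r \<Longrightarrow>
    integral domain_box (\<lambda>z. \<phi>' z \<bullet> G (x + r *\<^sub>R z)) = - r * average \<phi> h r x"
  unfolding weak_div_def by blast

lemma integral_inner_average:
  fixes x :: "'a::euclidean_space"
  assumes c: "continuous_on domain_box \<psi>" and G: "continuous_on S G" and r: "room S x r" "0 \<le> r"
  shows "integral domain_box (\<lambda>z. \<psi> z \<bullet> G (x + r *\<^sub>R z)) =
    (\<Sum>b\<in>Basis. average (\<lambda>z. \<psi> z \<bullet> b) (\<lambda>y. G y \<bullet> b) r x)"
proof -
  have "integral domain_box (\<lambda>z. \<Sum>b\<in>Basis. (\<psi> z \<bullet> b) * (G (x + r *\<^sub>R z) \<bullet> b)) =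
    (\<Sum>b\<in>Basis. average (\<lambda>z. \<psi> z \<bullet> b) (\<lambda>y. G y \<bullet> b) r x)"
    unfolding average_def
    by (rule integral_sum)
      (auto intro!: integrable_continuous continuous_intros c continuous_on_dilation(1)[OF G r])
  then show ?thesis
    by (simp add: euclidean_inner[symmetric])
qed

lemma weak_div_classical:
  fixes G :: "'a::euclidean_space \<Rightarrow> 'a"
  assumes G: "\<And>b y. b \<in> Basis \<Longrightarrow> y \<in> S \<Longrightarrow> GDERIV (\<lambda>y. G y \<bullet> b) y :> H b y"
    and H: "\<And>b. b \<in> Basis \<Longrightarrow> continuous_on S (H b)"
  shows "weak_div S G (\<lambda>y. \<Sum>b\<in>Basis. H b y \<bullet> b)"
  unfolding weak_div_def
proof (intro allI impI, elim conjE)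
  fix \<phi> :: "'a \<Rightarrow> real" and \<phi>' x and r :: real
  assume \<phi>: "test_fun \<phi> \<phi>'" and r: "0 < r" "room S x r"
  have "continuous_on S (\<lambda>y. \<Sum>b\<in>Basis. (G y \<bullet> b) *\<^sub>R b)"
    by (intro continuous_on_sum continuous_on_scaleR continuous_on_const GDERIV_continuous_on[OF G])
  then have cG: "continuous_on S G" by (simp add: euclidean_representation)
  have "integral domain_box (\<lambda>z. \<phi>' z \<bullet> G (x + r *\<^sub>R z)) =
      (\<Sum>b\<in>Basis. average (\<lambda>z. \<phi>' z \<bullet> b) (\<lambda>y. G y \<bullet> b) r x)"
    using r by (intro integral_inner_average[OF _ cG] test_fun_continuous[OF \<phi>]) auto
  also have "\<dots> = (\<Sum>b\<in>Basis. - r * average \<phi> (\<lambda>y. H b y \<bullet> b) r x)"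
    using r by (intro sum.cong refl average_by_parts[OF \<phi> G H]) auto
  also have "\<dots> = - r * (\<Sum>b\<in>Basis. average \<phi> (\<lambda>y. H b y \<bullet> b) r x)"
    by (rule sum_distrib_left[symmetric])
  also have "(\<Sum>b\<in>Basis. average \<phi> (\<lambda>y. H b y \<bullet> b) r x) =
      integral domain_box (\<lambda>z. \<Sum>b\<in>Basis. \<phi> z * (H b (x + r *\<^sub>R z) \<bullet> b))"
    unfolding average_def using r
    by (intro integral_sum[symmetric]) (auto intro!: integrable_continuous continuous_intros
        test_fun_continuous[OF \<phi>] continuous_on_dilation(1)[OF H, of _ x r])
  finally show "integral domain_box (\<lambda>z. \<phi>' z \<bullet> G (x + r *\<^sub>R z)) =
      - r * average \<phi> (\<lambda>y. \<Sum>b\<in>Basis. H b y \<bullet> b) r x"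
    by (simp add: average_def sum_distrib_left)
qed

text \<open>The average divided by \<open>r\<^sup>2\<close> is a second derivative of the mollified
  w. Testing the weak divergence with a second derivative of L yields three terms: the kernel
  Hessian times z is the radius derivative of the average, and the other two are equal to - 1 / r
  times the average after an integration by parts.\<close>

lemma mollifier_hess_average_deriv:
  fixes x :: "'a::euclidean_space"
  assumes w: "\<And>y. y \<in> S \<Longrightarrow> GDERIV w y :> G y" and G: "continuous_on S G"
    and weak: "weak_div S G h"
    and R: "room S x R" and r: "0 < r" "r < R" and bc: "norm b \<le> 1" "norm c \<le> 1"
  shows "((\<lambda>r. average (mollifier_hess b c) w r x / r\<^sup>2) has_real_derivative
    average (potential_hess b c) h r x / r) (at r)"
proof -
  have room: "room S x r" using room_mono[OF R] r by simp
  let ?A = "average (mollifier_hess b c) w r x"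
  let ?I = "integral domain_box (\<lambda>z. mollifier_hess b c z * (G (x + r *\<^sub>R z) \<bullet> z))"
  let ?P = "\<lambda>b c. average (\<lambda>z. mollifier_grad z \<bullet> b) (\<lambda>y. G y \<bullet> c) r x"
  have A: "?A = - r * ?P b c" "?A = - r * ?P c b"
    using average_by_parts2[OF w G room _ bc(2), of b] average_by_parts2[OF w G room _ bc(1), of c] r
    by (simp_all add: mollifier_hess_commute[of b c, abs_def])
  have cG: "continuous_on domain_box (\<lambda>z. G (x + r *\<^sub>R z))"
    using continuous_on_dilation(1)[OF G room] r by simp
  have "- r * average (potential_hess b c) h r x =
      integral domain_box (\<lambda>z. potential_hess_grad b c z \<bullet> G (x + r *\<^sub>R z))"
    using weak_divD[OF weak test_fun_potential_hess r(1) room] by simp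
  also have "\<dots> = integral domain_box (\<lambda>z. - (mollifier_hess b c z * (G (x + r *\<^sub>R z) \<bullet> z)
      + (mollifier_grad z \<bullet> c) * (G (x + r *\<^sub>R z) \<bullet> b) + (mollifier_grad z \<bullet> b) * (G (x + r *\<^sub>R z) \<bullet> c)))"
    by (intro integral_cong)
      (simp add: potential_hess_grad_def inner_add_left inner_diff_right inner_commute[of _ "G _"])
  also have "\<dots> = - (?I + ?P c b + ?P b c)"
  proof -
    note cs = cG continuous_on_mollifier_hess test_fun_continuous[OF test_fun_mollifier]
    have "(\<lambda>z. mollifier_hess b c z * (G (x + r *\<^sub>R z) \<bullet> z)) integrable_on domain_box"
      "(\<lambda>z. (mollifier_grad z \<bullet> c) * (G (x + r *\<^sub>R z) \<bullet> b)) integrable_on domain_box"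
      "(\<lambda>z. (mollifier_grad z \<bullet> b) * (G (x + r *\<^sub>R z) \<bullet> c)) integrable_on domain_box"
      by (intro integrable_continuous continuous_intros cs)+
    then show ?thesis
      by (simp only: average_def integral_neg integral_add integrable_add)
  qed
  finally have "?I = r * average (potential_hess b c) h r x + 2 * ?A / r"
    using A r by (simp add: field_simps)
  moreover have "((\<lambda>r. average (mollifier_hess b c) w r x / r\<^sup>2) has_real_derivative
      (?I * r\<^sup>2 - ?A * (2 * r)) / (r\<^sup>2 * r\<^sup>2)) (at r)"
    using r by (intro DERIV_divide average_deriv_radius[OF continuous_on_mollifier_hess w G R])
      (auto intro!: derivative_eq_intros)
  \<comment> \<open>The summand 2 A / r is cancelled by the derivative of
    \<open>1 / r\<^sup>2\<close>, so that only the term with h survives.\<close>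
  moreover have "((r * P + 2 * A / r) * r\<^sup>2 - A * (2 * r)) / (r\<^sup>2 * r\<^sup>2) = P / r" for A P
    using r by (simp add: field_simps power2_eq_square)
  ultimately show ?thesis by simp
qed

section \<open>Hoelder data and convergence of the mollified second derivatives\<close>

definition holder_on :: "'a::euclidean_space set \<Rightarrow> real \<Rightarrow> real \<Rightarrow> ('a \<Rightarrow> real) \<Rightarrow> bool" where
  "holder_on S \<alpha> K h \<longleftrightarrow> (\<forall>x\<in>S. \<forall>y\<in>S. \<bar>h x - h y\<bar> \<le> K * norm (x - y) powr \<alpha>)"

lemma continuous_bound_domain_box:
  fixes f :: "'a::euclidean_space \<Rightarrow> real"
  assumes "continuous_on domain_box f"
  obtains B where "0 \<le> B" "\<And>z. z \<in> domain_box \<Longrightarrow> \<bar>f z\<bar> \<le> B"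
proof -
  have "bounded (f ` domain_box)"
    using assms by (intro compact_imp_bounded compact_continuous_image) auto
  then obtain B where "\<forall>y\<in>f ` domain_box. norm y \<le> B"
    unfolding bounded_iff by blast
  then show ?thesis
    using that[of "max B 0"] by fastforce
qed

lemma abs_integral_domain_box_le:
  fixes f :: "'a::euclidean_space \<Rightarrow> real"
  assumes "continuous_on domain_box f" "0 \<le> B" "\<And>z. z \<in> domain_box \<Longrightarrow> \<bar>f z\<bar> \<le> B"
  shows "\<bar>integral domain_box f\<bar> \<le> B * measure lborel (domain_box :: 'a set)"
  using has_integral_bound[OF assms(2) integrable_integral[OF integrable_continuous[OF assms(1)]]] assms(3)
  by simp

text \<open>A second derivative of L is a first derivative of the compactly supported function
  \<open>- 8 * bump 3 z * (z \<bullet> b)\<close>.\<close>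

lemma integral_potential_hess: "norm c \<le> 1 \<Longrightarrow> integral domain_box (potential_hess b c) = 0"
  using integral_gradient_eq_0[of "\<lambda>z. - 8 * bump 3 z * (z \<bullet> b)" "potential_grad_grad b" c]
    test_fun_potential_grad[of b]
  by (auto simp: test_fun_def potential_grad_grad_inner[abs_def] intro: continuous_on_subset)

text \<open>The kernel has integral 0, so h may be replaced by h (x + r z) - h x, which is of size
  \<open>r powr \<alpha>\<close>. The constant is chosen before S, h, x and r, which makes the later
  estimates uniform in the centre.\<close>

lemma potential_average_bound:
  fixes b c :: "'a::euclidean_space"
  assumes c: "norm c \<le> 1" and K: "0 \<le> K" and \<alpha>: "0 < \<alpha>"
  obtains C where "0 \<le> C"
    "\<And>S h x r. continuous_on S h \<Longrightarrow> holder_on S \<alpha> K h \<Longrightarrow> room S x r \<Longrightarrow> 0 < r \<Longrightarrow>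
       \<bar>average (potential_hess b c) h r x\<bar> \<le> C * r powr \<alpha>"
proof -
  let ?\<rho> = "box_radius TYPE('a)"
  have cp: "continuous_on domain_box (potential_hess b c)"
    by (rule test_fun_continuous[OF test_fun_potential_hess])
  obtain B where B: "0 \<le> B" "\<And>z. z \<in> domain_box \<Longrightarrow> \<bar>potential_hess b c z\<bar> \<le> B"
    using continuous_bound_domain_box[OF cp] by blast
  define C where "C = B * (K * ?\<rho> powr \<alpha>) * measure lborel (domain_box :: 'a set)"
  show ?thesis
  proof (rule that[of C])
    show "0 \<le> C"
      unfolding C_def using B K by (intro mult_nonneg_nonneg measure_nonneg) auto
  next
    fix S and h :: "'a \<Rightarrow> real" and x and r :: real
    assume h: "continuous_on S h" "holder_on S \<alpha> K h" and r: "room S x r" "0 < r"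
    have ch: "continuous_on domain_box (\<lambda>z. h (x + r *\<^sub>R z))"
      using continuous_on_dilation(1)[OF h(1) r(1)] r by simp
    have "average (potential_hess b c) h r x =
        integral domain_box (\<lambda>z. potential_hess b c z * h (x + r *\<^sub>R z))
        - integral domain_box (\<lambda>z. potential_hess b c z * h x)"
      by (simp add: average_def integral_potential_hess[OF c])
    also have "\<dots> = integral domain_box
        (\<lambda>z. potential_hess b c z * h (x + r *\<^sub>R z) - potential_hess b c z * h x)"
      by (intro integral_diff[symmetric] integrable_continuous continuous_intros cp ch)
    finally have eq: "average (potential_hess b c) h r x =
        integral domain_box (\<lambda>z. potential_hess b c z * (h (x + r *\<^sub>R z) - h x))"
      by (simp add: algebra_simps)
    have "\<bar>integral domain_box (\<lambda>z. potential_hess b c z * (h (x + r *\<^sub>R z) - h x))\<bar> \<le>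
        B * (K * (?\<rho> powr \<alpha> * r powr \<alpha>)) * measure lborel (domain_box :: 'a set)"
    proof (rule abs_integral_domain_box_le)
      show "continuous_on domain_box (\<lambda>z. potential_hess b c z * (h (x + r *\<^sub>R z) - h x))"
        by (intro continuous_intros cp ch)
      show "0 \<le> B * (K * (?\<rho> powr \<alpha> * r powr \<alpha>))"
        using B K by auto
      fix z :: 'a assume z: "z \<in> domain_box"
      have "x + r *\<^sub>R z \<in> S" "x \<in> S"
        using domain_box_room[OF r(1) z] roomD[OF r(1), of 0] r(2) by auto
      then have "\<bar>h (x + r *\<^sub>R z) - h x\<bar> \<le> K * norm (r *\<^sub>R z) powr \<alpha>"
        using h(2) unfolding holder_on_def by fastforce
      moreover have "norm (r *\<^sub>R z) powr \<alpha> \<le> (r * ?\<rho>) powr \<alpha>"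
        using norm_domain_box[OF z] r \<alpha> by (intro powr_mono2) auto
      then have "K * norm (r *\<^sub>R z) powr \<alpha> \<le> K * (r * ?\<rho>) powr \<alpha>"
        using K by (rule mult_left_mono)
      moreover have "(r * ?\<rho>) powr \<alpha> = ?\<rho> powr \<alpha> * r powr \<alpha>"
        using r by (simp only: powr_mult mult.commute)
      ultimately have "\<bar>h (x + r *\<^sub>R z) - h x\<bar> \<le> K * (?\<rho> powr \<alpha> * r powr \<alpha>)"
        by simp
      then show "\<bar>potential_hess b c z * (h (x + r *\<^sub>R z) - h x)\<bar> \<le> B * (K * (?\<rho> powr \<alpha> * r powr \<alpha>))"
        unfolding abs_mult using B z by (intro mult_mono) auto
    qed
    then show "\<bar>average (potential_hess b c) h r x\<bar> \<le> C * r powr \<alpha>"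
      unfolding eq C_def by (simp add: mult_ac)
  qed
qed

text \<open>Adding M to, or subtracting it from, \<open>C / \<alpha> * t powr \<alpha>\<close> gives
  a nondecreasing function. As \<alpha> > 0, the bound does not deteriorate when s tends to
  0.\<close>

lemma abs_diff_le_powr:
  fixes M :: "real \<Rightarrow> real"
  assumes der: "\<And>t. s \<le> t \<Longrightarrow> t \<le> r \<Longrightarrow> (M has_real_derivative M' t) (at t)"
    and bound: "\<And>t. s \<le> t \<Longrightarrow> t \<le> r \<Longrightarrow> \<bar>M' t\<bar> \<le> C * t powr (\<alpha> - 1)"
    and s: "0 < s" "s \<le> r" and \<alpha>: "0 < \<alpha>" and C: "0 \<le> C"
  shows "\<bar>M r - M s\<bar> \<le> C / \<alpha> * r powr \<alpha>"
proof -
  let ?F = "\<lambda>t. C / \<alpha> * t powr \<alpha>"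
  have F: "(?F has_real_derivative C * t powr (\<alpha> - 1)) (at t)" if "s \<le> t" for t
    using that s \<alpha> by (auto intro!: derivative_eq_intros)
  have "?F s - M s \<le> ?F r - M r"
  proof (rule DERIV_nonneg_imp_nondecreasing[OF s(2)], intro exI conjI)
    fix t assume t: "s \<le> t" "t \<le> r"
    show "((\<lambda>t. ?F t - M t) has_real_derivative C * t powr (\<alpha> - 1) - M' t) (at t)"
      by (intro DERIV_diff F der t)
    show "0 \<le> C * t powr (\<alpha> - 1) - M' t" using bound[OF t] by linarith
  qed
  moreover have "?F s + M s \<le> ?F r + M r"
  proof (rule DERIV_nonneg_imp_nondecreasing[OF s(2)], intro exI conjI)
    fix t assume t: "s \<le> t" "t \<le> r"
    show "((\<lambda>t. ?F t + M t) has_real_derivative C * t powr (\<alpha> - 1) + M' t) (at t)"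
      by (intro DERIV_add F der t)
    show "0 \<le> C * t powr (\<alpha> - 1) + M' t" using bound[OF t] by linarith
  qed
  moreover have "0 \<le> ?F s" using C \<alpha> by simp
  ultimately show ?thesis by linarith
qed

text \<open>The radius derivative is O(t^(\<alpha> - 1)), and integrating it from s to r gives a
  Cauchy estimate as the radii shrink, with one constant for all centres.\<close>

lemma mollifier_hess_average_cauchy:
  fixes b c :: "'a::euclidean_space"
  assumes b: "norm b \<le> 1" and c: "norm c \<le> 1" and K: "0 \<le> K" and \<alpha>: "0 < \<alpha>"
    and w: "\<And>y. y \<in> S \<Longrightarrow> GDERIV w y :> G y" "continuous_on S G"
    and h: "weak_div S G h" "continuous_on S h" "holder_on S \<alpha> K h"
  obtains C where "0 \<le> C"
    "\<And>x r s R. room S x R \<Longrightarrow> 0 < s \<Longrightarrow> s \<le> r \<Longrightarrow> r < R \<Longrightarrow>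
       \<bar>average (mollifier_hess b c) w r x / r\<^sup>2 - average (mollifier_hess b c) w s x / s\<^sup>2\<bar> \<le> C * r powr \<alpha>"
proof -
  obtain C where C: "0 \<le> C"
    "\<And>S h x r. continuous_on S h \<Longrightarrow> holder_on S \<alpha> K h \<Longrightarrow> room S x r \<Longrightarrow> 0 < r \<Longrightarrow>
       \<bar>average (potential_hess b c) h r x\<bar> \<le> C * r powr \<alpha>"
    using potential_average_bound[OF c K \<alpha>, of b] by blast
  show ?thesis
  proof (rule that[of "C / \<alpha>"])
    fix x and r s R :: real
    assume R: "room S x R" and s: "0 < s" "s \<le> r" "r < R"
    show "\<bar>average (mollifier_hess b c) w r x / r\<^sup>2 - average (mollifier_hess b c) w s x / s\<^sup>2\<bar>
        \<le> C / \<alpha> * r powr \<alpha>"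
    proof (rule abs_diff_le_powr[OF _ _ s(1,2) \<alpha> C(1)])
      fix t assume t: "s \<le> t" "t \<le> r"
      show "((\<lambda>t. average (mollifier_hess b c) w t x / t\<^sup>2) has_real_derivative
          average (potential_hess b c) h t x / t) (at t)"
        by (rule mollifier_hess_average_deriv[OF w h(1) R]) (use t s b c in auto)
      have "\<bar>average (potential_hess b c) h t x\<bar> \<le> C * t powr \<alpha>"
        using t s by (intro C(2)[OF h(2,3)] room_mono[OF R]) auto
      then show "\<bar>average (potential_hess b c) h t x / t\<bar> \<le> C * t powr (\<alpha> - 1)"
        using t s by (simp add: powr_diff divide_right_mono)
    qed
  qed (use C \<alpha> in simp)
qed

text \<open>The average is continuous in the radius down to 0, where the integrand is
  \<open>\<phi> z * w x\<close>.\<close>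

lemma average_at_right_0:
  fixes x :: "'a::euclidean_space"
  assumes \<phi>: "continuous_on domain_box \<phi>" and w: "continuous_on S w" and R: "room S x R" "0 < R"
    and r: "r \<longlonglongrightarrow> 0" "\<And>n. 0 < r n" "\<And>n. r n < R"
  shows "(\<lambda>n. average \<phi> w (r n) x) \<longlonglongrightarrow> integral domain_box \<phi> * w x"
proof -
  have near: "x + t *\<^sub>R z \<in> S" if t: "t \<in> {0..R}" and z: "z \<in> domain_box" for t z
    using domain_box_room[OF room_mono[OF R(1), of t] z] t by auto
  have 1: "continuous_on ({0..R} \<times> domain_box) (\<lambda>p. w (x + fst p *\<^sub>R snd p))"
    by (rule continuous_on_compose2[OF w]) (use near in \<open>auto intro!: continuous_intros\<close>)
  have 2: "continuous_on ({0..R} \<times> domain_box) (\<lambda>p. \<phi> (snd p))"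
    by (rule continuous_on_compose2[OF \<phi>]) (auto intro!: continuous_intros)
  have "continuous_on ({0..R} \<times> domain_box) (\<lambda>(t, z). \<phi> z * w (x + t *\<^sub>R z))"
    unfolding split_beta by (intro continuous_intros 1 2)
  then have "continuous_on {0..R} (\<lambda>t. average \<phi> w t x)"
    unfolding average_def by (rule integral_continuous_on_param)
  then have "(\<lambda>n. average \<phi> w (r n) x) \<longlonglongrightarrow> average \<phi> w 0 x"
    by (rule continuous_on_tendsto_compose[OF _ r(1)]) (use R r(2,3) in \<open>auto intro!: always_eventually less_imp_le\<close>)
  then show ?thesis by (simp add: average_def)
qed

lemma integral_mollifier_pos: "integral domain_box (mollifier :: 'a::euclidean_space \<Rightarrow> real) > 0"
proof -
  have c: "continuous_on domain_box (mollifier :: 'a \<Rightarrow> real)"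
    by (rule test_fun_continuous[OF test_fun_mollifier])
  have "integral domain_box (mollifier :: 'a \<Rightarrow> real) \<noteq> 0"
  proof
    assume "integral domain_box (mollifier :: 'a \<Rightarrow> real) = 0"
    then have "(mollifier has_integral 0) (domain_box :: 'a set)"
      using integrable_integral[OF integrable_continuous[OF c]] by simp
    then have "mollifier (0::'a) = 0"
      by (rule has_integral_0_cbox_imp_0[OF c, rotated])
        (auto simp: mollifier_def bump_def box_ne_empty mem_box)
    then show False by (simp add: mollifier_def bump_def)
  qed
  moreover have "0 \<le> integral domain_box (mollifier :: 'a \<Rightarrow> real)"
    by (intro integral_nonneg integrable_continuous c) (simp add: mollifier_def bump_def)
  ultimately show ?thesis by linarith
qed

text \<open>Since the radii decrease, the bound at one radius controls the distance to all later
  terms, and thus also to the limit.\<close>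

lemma convergent_of_powr_bound:
  fixes M :: "real \<Rightarrow> real"
  assumes M: "\<And>r s. 0 < s \<Longrightarrow> s \<le> r \<Longrightarrow> r < R \<Longrightarrow> \<bar>M r - M s\<bar> \<le> C * r powr \<alpha>"
    and \<alpha>: "0 < \<alpha>"
    and r: "r \<longlonglongrightarrow> 0" "\<And>n. 0 < r n" "\<And>n. r n < R" "decseq r"
  obtains L where "(\<lambda>n. M (r n)) \<longlonglongrightarrow> L" "\<And>n. \<bar>M (r n) - L\<bar> \<le> C * r n powr \<alpha>"
proof -
  have lim: "(\<lambda>n. C * r n powr \<alpha>) \<longlonglongrightarrow> 0"
    using tendsto_mult[OF tendsto_const tendsto_zero_powrI[OF r(1) tendsto_const _ \<alpha>], of C] r(2)
    by (simp add: less_imp_le)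
  have le: "\<bar>M (r m) - M (r n)\<bar> \<le> C * r m powr \<alpha>" if "m \<le> n" for m n
    using M[OF r(2)[of n] decseqD[OF r(4) that] r(3)[of m]] .
  have "Cauchy (\<lambda>n. M (r n))"
  proof (rule metric_CauchyI)
    fix e :: real assume "0 < e"
    with lim have "eventually (\<lambda>n. C * r n powr \<alpha> < e / 2) sequentially"
      by (intro order_tendstoD) auto
    then obtain N where N: "C * r N powr \<alpha> < e / 2"
      by (meson eventually_sequentially order_refl)
    have "dist (M (r m)) (M (r n)) < e" if "m \<ge> N" "n \<ge> N" for m n
      using le[OF that(1)] le[OF that(2)] N unfolding dist_real_def by linarith
    then show "\<exists>N. \<forall>m\<ge>N. \<forall>n\<ge>N. dist (M (r m)) (M (r n)) < e" by blast
  qed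
  then obtain L where L: "(\<lambda>n. M (r n)) \<longlonglongrightarrow> L"
    using Cauchy_convergent convergent_def by blast
  have "\<bar>M (r n) - L\<bar> \<le> C * r n powr \<alpha>" for n
  proof (rule Lim_bounded)
    show "(\<lambda>m. \<bar>M (r n) - M (r m)\<bar>) \<longlonglongrightarrow> \<bar>M (r n) - L\<bar>"
      by (intro tendsto_intros L)
    show "\<forall>m\<ge>n. \<bar>M (r n) - M (r m)\<bar> \<le> C * r n powr \<alpha>"
      using le by blast
  qed
  then show ?thesis using L that by blast
qed

section \<open>Interior regularity\<close>

text \<open>Along the line through x in direction b, the mollified b-component of G has derivative
  \<open>M b\<close>. The Cauchy estimate makes these derivatives converge uniformly, so the limit,
  a multiple of the b-component of G, is differentiable. The sum of the second derivatives is found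
  by testing the weak divergence with the kernel itself.\<close>

lemma weak_laplacian_second_deriv:
  fixes x :: "'a::euclidean_space"
  assumes S: "open S" "x \<in> S"
    and w: "\<And>y. y \<in> S \<Longrightarrow> GDERIV w y :> G y" and G: "continuous_on S G"
    and h: "weak_div S G h" "continuous_on S h" "holder_on S \<alpha> K h" and K: "0 \<le> K" and \<alpha>: "0 < \<alpha>"
  obtains q where "\<And>b. b \<in> Basis \<Longrightarrow> ((\<lambda>t. G (x + t *\<^sub>R b) \<bullet> b) has_real_derivative q b) (at 0)"
    "(\<Sum>b\<in>Basis. q b) = h x"
proof -
  let ?\<rho> = "box_radius TYPE('a)"
  \<comment> \<open>\<open>average\<close> is not normalised, so limits carry the mass of the
    kernel, which is divided out at the end.\<close>
  define c0 where "c0 = integral domain_box (mollifier :: 'a \<Rightarrow> real)"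
  have c0: "c0 > 0" unfolding c0_def by (rule integral_mollifier_pos)
  obtain e where e: "0 < e" "cball x e \<subseteq> S"
    using S open_contains_cball by blast
  \<comment> \<open>The 3 is one more than \<open>room\<close> asks for, because the centre itself
    moves along the line by up to R.\<close>
  define R where "R = e / (?\<rho> + 3)"
  have R: "0 < R" "R * (?\<rho> + 3) = e"
    using e(1) unfolding R_def by (simp_all add: add_pos_nonneg add_nonneg_pos)
  have room: "room S (x + t *\<^sub>R b) R" if "\<bar>t\<bar> \<le> R" "b \<in> Basis" for t b
  proof -
    have "dist x (x + t *\<^sub>R b) \<le> R" using that by (simp add: dist_norm)
    then have "R * (?\<rho> + 2) + dist x (x + t *\<^sub>R b) \<le> e" using R(2) by (simp add: algebra_simps)
    then have "cball (x + t *\<^sub>R b) (R * (?\<rho> + 2)) \<subseteq> cball x e"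
      by (simp add: cball_subset_cball_iff dist_commute)
    then show ?thesis using e(2) by blast
  qed
  define r where "r n = R / 2 * inverse (real (Suc n))" for n
  have r: "r \<longlonglongrightarrow> 0" "0 < r n" "r n < R" "decseq r" for n
  proof -
    show "r \<longlonglongrightarrow> 0"
      unfolding r_def by (rule tendsto_mult_right_zero[OF LIMSEQ_inverse_real_of_nat])
    show "0 < r n" unfolding r_def using R(1) by simp
    have "R / 2 * inverse (real (Suc n)) \<le> R / 2 * 1"
      using R(1) by (intro mult_left_mono) (auto simp: field_simps)
    then show "r n < R" unfolding r_def using R(1) by linarith
    show "decseq r" unfolding r_def decseq_def using R(1) by (auto intro!: mult_left_mono le_imp_inverse_le)
  qed
  define M where "M b r y = average (mollifier_hess b b) w r y / r\<^sup>2" for b r y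
  have M_eq: "M b s y = - (1 / s) * average (\<lambda>z. mollifier_grad z \<bullet> b) (\<lambda>y. G y \<bullet> b) s y"
    if "b \<in> Basis" "room S y s" "0 < s" for b s y
    unfolding M_def using average_by_parts2[OF w G that(2), of b b] that
    by (simp add: field_simps power2_eq_square)
  have deriv: "\<exists>q. ((\<lambda>t. G (x + t *\<^sub>R b) \<bullet> b) has_real_derivative q) (at 0) \<and>
      (\<lambda>n. M b (r n) x) \<longlonglongrightarrow> c0 * q" if b: "b \<in> Basis" for b
  proof -
    let ?T = "{-R<..<R}"
    have room': "room S (x + t *\<^sub>R b) R" if "t \<in> ?T" for t
      using that by (intro room b) auto
    obtain C where C: "0 \<le> C"
      "\<And>y r s. room S y R \<Longrightarrow> 0 < s \<Longrightarrow> s \<le> r \<Longrightarrow> r < R \<Longrightarrow> \<bar>M b r y - M b s y\<bar> \<le> C * r powr \<alpha>"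
      unfolding M_def
      by (rule mollifier_hess_average_cauchy[of b b K \<alpha> S w G h, OF _ _ K \<alpha> w G h])
        (use b in auto)
    have "\<exists>L. (\<lambda>n. M b (r n) (x + t *\<^sub>R b)) \<longlonglongrightarrow> L \<and>
        (\<forall>n. \<bar>M b (r n) (x + t *\<^sub>R b) - L\<bar> \<le> C * r n powr \<alpha>)" if "t \<in> ?T" for t
      using convergent_of_powr_bound[of R "\<lambda>r. M b r (x + t *\<^sub>R b)" C \<alpha> r, OF C(2)[OF room'[OF that]] \<alpha> r]
      by metis
    then obtain L where L: "\<And>t. t \<in> ?T \<Longrightarrow> (\<lambda>n. M b (r n) (x + t *\<^sub>R b)) \<longlonglongrightarrow> L t"
      "\<And>t n. t \<in> ?T \<Longrightarrow> \<bar>M b (r n) (x + t *\<^sub>R b) - L t\<bar> \<le> C * r n powr \<alpha>"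
      by metis
    \<comment> \<open>This is the mollified b-component of G, written with w and the kernel
      gradient: w has a continuous gradient and can be differentiated under the integral, whereas G
      is only continuous.\<close>
    let ?f = "\<lambda>n t. - (1 / r n) * average (\<lambda>z. mollifier_grad z \<bullet> b) w (r n) (x + t *\<^sub>R b)"
    have cg: "continuous_on domain_box (\<lambda>z. mollifier_grad z \<bullet> b)"
      by (rule test_fun_continuous[OF test_fun_mollifier_grad])
    have f_eq: "?f n t = average mollifier (\<lambda>y. G y \<bullet> b) (r n) (x + t *\<^sub>R b)" if "t \<in> ?T" for n t
      using average_by_parts[OF test_fun_mollifier w G room_mono[OF room'[OF that]], of "r n" b] b r(2)[of n] r(3)[of n]
      by (simp add: less_imp_le)
    have lim: "(\<lambda>n. ?f n t) \<longlonglongrightarrow> c0 * (G (x + t *\<^sub>R b) \<bullet> b)" if "t \<in> ?T" for t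
      unfolding f_eq[OF that] c0_def
      by (rule average_at_right_0[where S=S and R=R])
        (auto intro!: continuous_intros test_fun_continuous[OF test_fun_mollifier] G R r room'[OF that])
    have "\<exists>g. \<forall>t\<in>?T. (\<lambda>n. ?f n t) \<longlonglongrightarrow> g t \<and> (g has_derivative (\<lambda>h. L t * h)) (at t within ?T)"
    proof (rule has_derivative_sequence[where f'="\<lambda>n t h. M b (r n) (x + t *\<^sub>R b) * h"])
      fix n t assume t: "t \<in> ?T"
      have rm: "room S (x + t *\<^sub>R b) (r n)"
        using room_mono[OF room'[OF t]] r(3)[of n] by simp
      have "((\<lambda>s. average (\<lambda>z. mollifier_grad z \<bullet> b) w (r n) ((x + t *\<^sub>R b) + s *\<^sub>R b)) has_real_derivative
          average (\<lambda>z. mollifier_grad z \<bullet> b) (\<lambda>y. G y \<bullet> b) (r n) (x + t *\<^sub>R b)) (at 0)"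
        using b by (intro average_deriv_line[OF cg w G rm r(2)]) auto
      then have "((\<lambda>s. average (\<lambda>z. mollifier_grad z \<bullet> b) w (r n) (x + s *\<^sub>R b)) has_real_derivative
          average (\<lambda>z. mollifier_grad z \<bullet> b) (\<lambda>y. G y \<bullet> b) (r n) (x + t *\<^sub>R b)) (at t)"
        using DERIV_shift[of "\<lambda>s. average (\<lambda>z. mollifier_grad z \<bullet> b) w (r n) (x + s *\<^sub>R b)" _ 0 t]
        by (simp add: algebra_simps)
      from DERIV_cmult[OF this, of "- (1 / r n)"]
      have "(?f n has_real_derivative M b (r n) (x + t *\<^sub>R b)) (at t)"
        by (simp add: M_eq[OF b rm r(2)])
      then show "(?f n has_derivative (\<lambda>h. M b (r n) (x + t *\<^sub>R b) * h)) (at t within ?T)"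
        unfolding has_field_derivative_def by (rule has_derivative_at_withinI)
    next
      fix \<epsilon> :: real assume \<epsilon>: "0 < \<epsilon>"
      have "(\<lambda>n. C * r n powr \<alpha>) \<longlonglongrightarrow> 0"
        using tendsto_mult[OF tendsto_const tendsto_zero_powrI[OF r(1) tendsto_const _ \<alpha>], of C] r(2)
        by (simp add: less_imp_le)
      then have "eventually (\<lambda>n. C * r n powr \<alpha> < \<epsilon>) sequentially"
        using \<epsilon> by (intro order_tendstoD) auto
      then show "\<forall>\<^sub>F n in sequentially. \<forall>t\<in>?T. \<forall>h. norm (M b (r n) (x + t *\<^sub>R b) * h - L t * h) \<le> \<epsilon> * norm h"
      proof eventually_elim
        case (elim n)
        show ?case
        proof (intro ballI allI)
          fix t h assume t: "t \<in> ?T"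
          have "\<bar>M b (r n) (x + t *\<^sub>R b) - L t\<bar> * \<bar>h\<bar> \<le> \<epsilon> * \<bar>h\<bar>"
            using L(2)[OF t, of n] elim by (intro mult_right_mono) auto
          then show "norm (M b (r n) (x + t *\<^sub>R b) * h - L t * h) \<le> \<epsilon> * norm h"
            by (simp add: abs_mult[symmetric] algebra_simps)
        qed
      qed
    next
      show "(\<lambda>n. ?f n 0) \<longlonglongrightarrow> c0 * (G (x + 0 *\<^sub>R b) \<bullet> b)"
        by (rule lim) (use R in simp)
    qed (use R in auto)
    then obtain g where g: "\<And>t. t \<in> ?T \<Longrightarrow> (\<lambda>n. ?f n t) \<longlonglongrightarrow> g t"
      "(g has_derivative (\<lambda>h. L 0 * h)) (at 0 within ?T)"
      using R(1) by fastforce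
    have "(g has_real_derivative L 0) (at 0)"
      using g(2) R(1) at_within_open[of 0 ?T] by (simp add: has_field_derivative_def)
    then have "((\<lambda>t. c0 * (G (x + t *\<^sub>R b) \<bullet> b)) has_real_derivative L 0) (at 0)"
      by (rule has_field_derivative_transform_within_open[where S="?T"])
        (use R(1) LIMSEQ_unique[OF g(1) lim] in auto)
    from DERIV_cdivide[OF this, of c0]
    have "((\<lambda>t. G (x + t *\<^sub>R b) \<bullet> b) has_real_derivative L 0 / c0) (at 0)"
      using c0 by simp
    moreover have "(\<lambda>n. M b (r n) x) \<longlonglongrightarrow> c0 * (L 0 / c0)"
      using L(1)[of 0] R(1) c0 by simp
    ultimately show ?thesis by blast
  qed
  then obtain q where q: "\<And>b. b \<in> Basis \<Longrightarrow> ((\<lambda>t. G (x + t *\<^sub>R b) \<bullet> b) has_real_derivative q b) (at 0)"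
    "\<And>b. b \<in> Basis \<Longrightarrow> (\<lambda>n. M b (r n) x) \<longlonglongrightarrow> c0 * q b"
    by metis
  have xR: "room S x R" using room[of 0 "SOME b. b \<in> Basis"] R(1) by (simp add: some_in_eq)
  have "(\<Sum>b\<in>Basis. M b (r n) x) = average mollifier h (r n) x" for n
  proof -
    have rm: "room S x (r n)" using room_mono[OF xR] r(3)[of n] by simp
    have "(\<Sum>b\<in>Basis. M b (r n) x) =
        - (1 / r n) * (\<Sum>b\<in>Basis. average (\<lambda>z. mollifier_grad z \<bullet> b) (\<lambda>y. G y \<bullet> b) (r n) x)"
      unfolding sum_distrib_left by (intro sum.cong refl M_eq rm r)
    also have "\<dots> = - (1 / r n) * integral domain_box (\<lambda>z. mollifier_grad z \<bullet> G (x + r n *\<^sub>R z))"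
      using r(2)[of n] integral_inner_average[OF test_fun_continuous(2)[OF test_fun_mollifier] G rm] by simp
    also have "\<dots> = average mollifier h (r n) x"
      using weak_divD[OF h(1) test_fun_mollifier r(2) rm] r(2)[of n] by simp
    finally show ?thesis .
  qed
  moreover have "(\<lambda>n. average mollifier h (r n) x) \<longlonglongrightarrow> c0 * h x"
    unfolding c0_def
    by (rule average_at_right_0[OF test_fun_continuous(1)[OF test_fun_mollifier] h(2) xR R(1) r(1-3)])
  moreover have "(\<lambda>n. \<Sum>b\<in>Basis. M b (r n) x) \<longlonglongrightarrow> (\<Sum>b\<in>Basis. c0 * q b)"
    by (intro tendsto_sum q(2))
  ultimately have "(\<Sum>b\<in>Basis. c0 * q b) = c0 * h x"
    using LIMSEQ_unique by simp
  then have "(\<Sum>b\<in>Basis. q b) = h x"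
    using c0 by (simp add: sum_distrib_left[symmetric])
  then show ?thesis using that q(1) by blast
qed

section \<open>Symmetry and Hoelder continuity of the Hessian of a C^2 function\<close>

lemma gradient_continuous_on:
  fixes G :: "'a::euclidean_space \<Rightarrow> 'a"
  assumes "\<And>b y. b \<in> Basis \<Longrightarrow> y \<in> S \<Longrightarrow> GDERIV (\<lambda>y. G y \<bullet> b) y :> H b y"
  shows "continuous_on S G"
  using GDERIV_continuous_on[OF assms] by (subst continuous_on_componentwise) blast

text \<open>With two classical derivatives at hand, both can be moved to u, so the mollified second
  derivatives converge to a Hessian entry times the mass of the kernel.\<close>

lemma average_mollifier_hess:
  fixes x :: "'a::euclidean_space"
  assumes G: "\<And>y. y \<in> S \<Longrightarrow> GDERIV u y :> G y"
    and H: "\<And>b y. b \<in> Basis \<Longrightarrow> y \<in> S \<Longrightarrow> GDERIV (\<lambda>y. G y \<bullet> b) y :> H b y"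
    and cH: "\<And>b. b \<in> Basis \<Longrightarrow> continuous_on S (H b)"
    and r: "room S x r" "0 < r" and b: "b \<in> Basis" and c: "c \<in> Basis"
  shows "average (mollifier_hess b c) u r x = r\<^sup>2 * average mollifier (\<lambda>y. H c y \<bullet> b) r x"
proof -
  have "average (mollifier_hess b c) u r x =
      - r * average (\<lambda>z. mollifier_grad z \<bullet> b) (\<lambda>y. G y \<bullet> c) r x"
    using average_by_parts2[OF G gradient_continuous_on[OF H] r(1)] r(2) c by simp
  also have "average (\<lambda>z. mollifier_grad z \<bullet> b) (\<lambda>y. G y \<bullet> c) r x =
      - r * average mollifier (\<lambda>y. H c y \<bullet> b) r x"
    using average_by_parts[OF test_fun_mollifier H[OF c] cH[OF c] r(1)] r(2) b by simp
  finally show ?thesis by (simp add: power2_eq_square)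
qed

text \<open>The kernel Hessian is given by a formula symmetric in b and c, so the mollified entries
  agree; the entries themselves are recovered as the radius tends to 0.\<close>

lemma hessian_symmetric:
  fixes x :: "'a::euclidean_space"
  assumes S: "open S" "x \<in> S"
    and G: "\<And>y. y \<in> S \<Longrightarrow> GDERIV u y :> G y"
    and H: "\<And>b y. b \<in> Basis \<Longrightarrow> y \<in> S \<Longrightarrow> GDERIV (\<lambda>y. G y \<bullet> b) y :> H b y"
    and cH: "\<And>b. b \<in> Basis \<Longrightarrow> continuous_on S (H b)"
    and b: "b \<in> Basis" and c: "c \<in> Basis"
  shows "H b x \<bullet> c = H c x \<bullet> b"
proof -
  let ?\<rho> = "box_radius TYPE('a)"
  obtain e where e: "0 < e" "cball x e \<subseteq> S"
    using S open_contains_cball by blast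
  define R where "R = e / (?\<rho> + 2)"
  have R: "0 < R" "room S x R"
    using e unfolding R_def by (simp_all add: add_nonneg_pos less_imp_neq)
  define r where "r n = R / 2 * inverse (real (Suc n))" for n
  have r: "r \<longlonglongrightarrow> 0" "0 < r n" "r n < R" for n
  proof -
    show "r \<longlonglongrightarrow> 0"
      unfolding r_def by (rule tendsto_mult_right_zero[OF LIMSEQ_inverse_real_of_nat])
    show "0 < r n" unfolding r_def using R(1) by simp
    have "R / 2 * inverse (real (Suc n)) \<le> R / 2 * 1"
      using R(1) by (intro mult_left_mono) (auto simp: field_simps)
    then show "r n < R" unfolding r_def using R(1) by linarith
  qed
  have lim: "(\<lambda>n. average mollifier (\<lambda>y. H c y \<bullet> b) (r n) x) \<longlonglongrightarrow>
      integral domain_box (mollifier :: 'a \<Rightarrow> real) * (H c x \<bullet> b)" if "b \<in> Basis" "c \<in> Basis" for b c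
    by (rule average_at_right_0[OF test_fun_continuous(1)[OF test_fun_mollifier] _ R(2,1) r])
      (intro continuous_intros cH that)
  have "average mollifier (\<lambda>y. H c y \<bullet> b) (r n) x = average mollifier (\<lambda>y. H b y \<bullet> c) (r n) x" for n
  proof -
    have rm: "room S x (r n)" using room_mono[OF R(2)] r(3)[of n] by simp
    show ?thesis
      using average_mollifier_hess[OF G H cH rm r(2) b c] average_mollifier_hess[OF G H cH rm r(2) c b]
        r(2)[of n] by (simp add: mollifier_hess_commute[of b c, abs_def])
  qed
  then have "integral domain_box (mollifier :: 'a \<Rightarrow> real) * (H c x \<bullet> b) =
      integral domain_box (mollifier :: 'a \<Rightarrow> real) * (H b x \<bullet> c)"
    using LIMSEQ_unique[OF lim[OF b c]] lim[OF c b] by simp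
  then show ?thesis
    using integral_mollifier_pos[where 'a='a] by simp
qed

text \<open>Since the Laplacian is Lipschitz, a multiple of each Hessian entry is approximated by
  \<open>M r\<close> up to O(r). Since u is Lipschitz, \<open>M r\<close> is Lipschitz with a
  constant O(\<open>1 / r\<^sup>2\<close>). Compare two points at a radius adapted to their
  distance.\<close>

lemma hessian_holder:
  fixes x0 :: "'a::euclidean_space"
  assumes S: "open S" "x0 \<in> S"
    and G: "\<And>y. y \<in> S \<Longrightarrow> GDERIV u y :> G y"
    and H: "\<And>b y. b \<in> Basis \<Longrightarrow> y \<in> S \<Longrightarrow> GDERIV (\<lambda>y. G y \<bullet> b) y :> H b y"
    and cH: "\<And>b. b \<in> Basis \<Longrightarrow> continuous_on S (H b)"
    and lap: "holder_on S 1 K (\<lambda>y. \<Sum>b\<in>Basis. H b y \<bullet> b)" and K: "0 \<le> K"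
    and lip: "\<And>y z. y \<in> S \<Longrightarrow> z \<in> S \<Longrightarrow> \<bar>u y - u z\<bar> \<le> \<Lambda> * norm (y - z)" and \<Lambda>: "0 \<le> \<Lambda>"
  obtains \<delta> where "0 < \<delta>" "ball x0 \<delta> \<subseteq> S"
    "\<And>b c. b \<in> Basis \<Longrightarrow> c \<in> Basis \<Longrightarrow> \<exists>C\<ge>0. holder_on (ball x0 \<delta>) (1/3) C (\<lambda>y. H c y \<bullet> b)"
proof -
  let ?\<rho> = "box_radius TYPE('a)"
  let ?h = "\<lambda>y. \<Sum>b\<in>Basis. H b y \<bullet> b"
  define c0 where "c0 = integral domain_box (mollifier :: 'a \<Rightarrow> real)"
  have c0: "c0 > 0" unfolding c0_def by (rule integral_mollifier_pos)
  have cG: "continuous_on S G" by (rule gradient_continuous_on[OF H])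
  have ch: "continuous_on S ?h" by (intro continuous_intros cH)
  have weak: "weak_div S G ?h" by (rule weak_div_classical[OF H cH])
  obtain e where e: "0 < e" "cball x0 e \<subseteq> S"
    using S open_contains_cball by blast
  define R where "R = min 1 (e / (?\<rho> + 3))"
  have R: "0 < R" "R \<le> 1" "R * (?\<rho> + 3) \<le> e"
    using e(1) unfolding R_def min_def by (auto simp: field_simps add_pos_nonneg add_nonneg_pos)
  \<comment> \<open>Two points of the ball have distance less than R^3, so the radius |y - z|^(1/3)
    used for them is less than R. The cap R \<le> 1 ensures R^3 \<le> R and hence \<delta> \<le>
    R.\<close>
  define \<delta> where "\<delta> = R ^ 3 / 2"
  have \<delta>: "0 < \<delta>" "\<delta> \<le> R"
    using R power_decreasing[of 1 3 R] unfolding \<delta>_def by auto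
  have room: "room S y R" if "y \<in> ball x0 \<delta>" for y
  proof -
    have "R * (?\<rho> + 2) + dist x0 y \<le> e" using R(3) that \<delta> by (simp add: algebra_simps)
    then have "cball y (R * (?\<rho> + 2)) \<subseteq> cball x0 e"
      by (simp add: cball_subset_cball_iff dist_commute)
    then show ?thesis using e(2) by blast
  qed
  have sub: "ball x0 \<delta> \<subseteq> S"
    using roomD[OF room, of _ 0] R(1) by force
  have "\<exists>C\<ge>0. holder_on (ball x0 \<delta>) (1/3) C (\<lambda>y. H c y \<bullet> b)" if b: "b \<in> Basis" and c: "c \<in> Basis" for b c
  proof -
    define M where "M r y = average (mollifier_hess b c) u r y / r\<^sup>2" for r y
    obtain C where C: "0 \<le> C"
      "\<And>y r s. room S y R \<Longrightarrow> 0 < s \<Longrightarrow> s \<le> r \<Longrightarrow> r < R \<Longrightarrow> \<bar>M r y - M s y\<bar> \<le> C * r powr 1"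
      unfolding M_def
      by (rule mollifier_hess_average_cauchy[of b c K 1 S u G, OF _ _ K _ G cG weak ch lap])
        (use b c in auto)
    \<comment> \<open>Let the smaller radius in the Cauchy estimate tend to 0; the limit is known
      because u is of class C^2.\<close>
    have near: "\<bar>M r y - c0 * (H c y \<bullet> b)\<bar> \<le> C * r" if y: "room S y R" and r: "0 < r" "r < R" for y r
    proof -
      define s where "s n = r * inverse (real (Suc n))" for n
      have s: "s \<longlonglongrightarrow> 0" "0 < s n" "s n \<le> r" for n
      proof -
        show "s \<longlonglongrightarrow> 0"
          unfolding s_def by (rule tendsto_mult_right_zero[OF LIMSEQ_inverse_real_of_nat])
        show "0 < s n" unfolding s_def using r(1) by simp
        show "s n \<le> r" unfolding s_def using r(1) by (simp add: field_simps)
      qed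
      have "M (s n) y = average mollifier (\<lambda>y. H c y \<bullet> b) (s n) y" for n
      proof -
        have rm: "room S y (s n)" using room_mono[OF y] s(3)[of n] r by simp
        show ?thesis
          using average_mollifier_hess[OF G H cH rm s(2) b c] s(2)[of n] by (simp add: M_def)
      qed
      moreover have "(\<lambda>n. average mollifier (\<lambda>y. H c y \<bullet> b) (s n) y) \<longlonglongrightarrow> c0 * (H c y \<bullet> b)"
        unfolding c0_def
        by (rule average_at_right_0[OF test_fun_continuous(1)[OF test_fun_mollifier] _ y R(1) s(1,2)])
          (use s(3) r(2) cH[OF c] in \<open>auto intro!: continuous_intros intro: le_less_trans\<close>)
      ultimately have "(\<lambda>n. \<bar>M r y - M (s n) y\<bar>) \<longlonglongrightarrow> \<bar>M r y - c0 * (H c y \<bullet> b)\<bar>"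
        by (auto intro!: tendsto_intros)
      moreover have "\<forall>n\<ge>0. \<bar>M r y - M (s n) y\<bar> \<le> C * r"
        using C(2)[OF y s(2,3) r(2)] r(1) by simp
      ultimately show ?thesis by (rule Lim_bounded)
    qed
    have ck: "continuous_on domain_box (mollifier_hess b c)"
      by (rule continuous_on_mollifier_hess)
    obtain B where B: "0 \<le> B" "\<And>z. z \<in> domain_box \<Longrightarrow> \<bar>mollifier_hess b c z\<bar> \<le> B"
      using continuous_bound_domain_box[OF ck] by blast
    define D where "D = B * \<Lambda> * measure lborel (domain_box :: 'a set)"
    have D: "0 \<le> D" unfolding D_def using B(1) \<Lambda> by (intro mult_nonneg_nonneg measure_nonneg)
    have lipM: "\<bar>M r y - M r z\<bar> \<le> D * norm (y - z) / r\<^sup>2"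
      if y: "room S y r" and z: "room S z r" and r: "0 < r" for y z r
    proof -
      have cu: "continuous_on S u" by (rule GDERIV_continuous_on[OF G])
      note cs = ck continuous_on_dilation(1)[OF cu y] continuous_on_dilation(1)[OF cu z]
      have "average (mollifier_hess b c) u r y - average (mollifier_hess b c) u r z =
          integral domain_box (\<lambda>v. mollifier_hess b c v * u (y + r *\<^sub>R v) - mollifier_hess b c v * u (z + r *\<^sub>R v))"
        unfolding average_def using r
        by (intro integral_diff[symmetric] integrable_continuous continuous_intros cs) auto
      also have "\<bar>\<dots>\<bar> \<le> (B * (\<Lambda> * norm (y - z))) * measure lborel (domain_box :: 'a set)"
      proof (rule abs_integral_domain_box_le)
        show "continuous_on domain_box
          (\<lambda>v. mollifier_hess b c v * u (y + r *\<^sub>R v) - mollifier_hess b c v * u (z + r *\<^sub>R v))"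
          using r by (intro continuous_intros cs) auto
        fix v :: 'a assume v: "v \<in> domain_box"
        have "\<bar>u (y + r *\<^sub>R v) - u (z + r *\<^sub>R v)\<bar> \<le> \<Lambda> * norm (y - z)"
          using lip[OF domain_box_room[OF y v] domain_box_room[OF z v]] r by simp
        then have "\<bar>mollifier_hess b c v\<bar> * \<bar>u (y + r *\<^sub>R v) - u (z + r *\<^sub>R v)\<bar> \<le> B * (\<Lambda> * norm (y - z))"
          using B v by (intro mult_mono) auto
        then show "\<bar>mollifier_hess b c v * u (y + r *\<^sub>R v) - mollifier_hess b c v * u (z + r *\<^sub>R v)\<bar>
            \<le> B * (\<Lambda> * norm (y - z))"
          by (simp add: abs_mult[symmetric] algebra_simps)
      qed (use B \<Lambda> in simp)
      finally have "\<bar>average (mollifier_hess b c) u r y - average (mollifier_hess b c) u r z\<bar> \<le> D * norm (y - z)"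
        by (simp add: D_def mult_ac)
      then show ?thesis
        using r unfolding M_def diff_divide_distrib[symmetric] by (simp add: divide_right_mono)
    qed
    have "holder_on (ball x0 \<delta>) (1/3) ((2 * C + D) / c0) (\<lambda>y. H c y \<bullet> b)"
      unfolding holder_on_def
    proof (intro ballI)
      fix y z assume yz: "y \<in> ball x0 \<delta>" "z \<in> ball x0 \<delta>"
      show "\<bar>H c y \<bullet> b - H c z \<bullet> b\<bar> \<le> (2 * C + D) / c0 * norm (y - z) powr (1/3)"
      proof (cases "y = z")
        case False
        \<comment> \<open>This choice makes the two errors r and |y - z| / r^2 equal.\<close>
        define r where "r = norm (y - z) powr (1/3)"
        have r0: "0 < r" using False by (simp add: r_def)
        have r3: "r ^ 3 = norm (y - z)"
          using False by (simp add: r_def powr_realpow[symmetric] powr_powr)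
        have "norm (y - z) < 2 * \<delta>"
          using yz dist_triangle_less_add[of y x0 \<delta> z \<delta>] by (simp add: dist_commute dist_norm)
        then have "r ^ 3 < R ^ 3" using r3 by (simp add: \<delta>_def)
        then have rR: "r < R" using R(1) by (rule power_less_imp_less_base[OF _ less_imp_le])
        have "D * norm (y - z) / r\<^sup>2 = D * r"
          unfolding r3[symmetric] using r0 by (simp add: power2_eq_square power3_eq_cube)
        then have "\<bar>M r y - M r z\<bar> \<le> D * r"
          using lipM[OF room_mono[OF room[OF yz(1)]] room_mono[OF room[OF yz(2)]] r0] rR by simp
        then have "\<bar>c0 * (H c y \<bullet> b) - c0 * (H c z \<bullet> b)\<bar> \<le> (2 * C + D) * r"
          using near[OF room[OF yz(1)] r0 rR] near[OF room[OF yz(2)] r0 rR] by (simp add: algebra_simps)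
        then have "c0 * \<bar>H c y \<bullet> b - H c z \<bullet> b\<bar> \<le> (2 * C + D) * r"
          using c0 by (simp add: abs_mult right_diff_distrib[symmetric])
        then show ?thesis
          using c0 unfolding r_def[symmetric] by (simp add: field_simps)
      qed simp
    qed
    moreover have "0 \<le> (2 * C + D) / c0" using C(1) D c0 by simp
    ultimately show ?thesis by blast
  qed
  then show ?thesis using that \<delta>(1) sub by blast
qed

text \<open>
  The divergence identity \<open>div (D\<^sup>2u \<nabla>u - \<Delta>u \<nabla>u) = |D\<^sup>2u|\<^sup>2 - (\<Delta>u)\<^sup>2\<close>, in which no third
  derivatives of \<open>u\<close> occur.
\<close>

lemma weak_div_hessian_minor:
  fixes G :: "'a::euclidean_space \<Rightarrow> 'a"
  assumes H: "\<And>b y. b \<in> Basis \<Longrightarrow> y \<in> S \<Longrightarrow> GDERIV (\<lambda>y. G y \<bullet> b) y :> H b y"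
    and cH: "\<And>b. b \<in> Basis \<Longrightarrow> continuous_on S (H b)"
  shows "weak_div S (\<lambda>y. \<Sum>i\<in>Basis. (H i y \<bullet> G y - (\<Sum>j\<in>Basis. H j y \<bullet> j) * (G y \<bullet> i)) *\<^sub>R i)
    (\<lambda>y. (\<Sum>i\<in>Basis. \<Sum>b\<in>Basis. (H b y \<bullet> i) * (H i y \<bullet> b)) - (\<Sum>j\<in>Basis. H j y \<bullet> j)\<^sup>2)"
  unfolding weak_div_def
proof (intro allI impI, elim conjE)
  fix \<phi> :: "'a \<Rightarrow> real" and \<phi>' x and r :: real
  assume \<phi>: "test_fun \<phi> \<phi>'" and r: "0 < r" "room S x r"
  let ?\<rho> = "box_radius TYPE('a)"
  let ?W = "\<lambda>y. \<Sum>i\<in>Basis. (H i y \<bullet> G y - (\<Sum>j\<in>Basis. H j y \<bullet> j) * (G y \<bullet> i)) *\<^sub>R i"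
  let ?h = "\<lambda>y. (\<Sum>i\<in>Basis. \<Sum>b\<in>Basis. (H b y \<bullet> i) * (H i y \<bullet> b)) - (\<Sum>j\<in>Basis. H j y \<bullet> j)\<^sup>2"
  have cG: "continuous_on S G" by (rule gradient_continuous_on[OF H])
  have r0: "0 \<le> r" using r(1) by simp
  define g where "g z = G (x + r *\<^sub>R z)" for z
  define \<eta> where "\<eta> b z = H b (x + r *\<^sub>R z)" for b z
  have cg: "continuous_on (cball 0 (?\<rho> + 2)) g" "continuous_on domain_box g"
    unfolding g_def using continuous_on_dilation[OF cG r(2) r0] by auto
  have c\<eta>: "continuous_on (cball 0 (?\<rho> + 2)) (\<eta> b)" "continuous_on domain_box (\<eta> b)" if "b \<in> Basis" for b
    unfolding \<eta>_def using continuous_on_dilation[OF cH[OF that] r(2) r0] by auto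
  have dg: "GDERIV (\<lambda>z. g z \<bullet> b) z :> r *\<^sub>R \<eta> b z" if "b \<in> Basis" "norm z \<le> ?\<rho> + 2" for b z
    unfolding g_def \<eta>_def
    using GDERIV_compose_affine[of "\<lambda>y. G y \<bullet> b" x r z, OF H[OF that(1) roomD[OF r(2) that(2) r0]]] .
  define \<alpha>' where "\<alpha>' b z = \<phi> z *\<^sub>R (r *\<^sub>R \<eta> b z) + (g z \<bullet> b) *\<^sub>R \<phi>' z" for b z
  have c\<alpha>: "continuous_on (cball 0 (?\<rho> + 2)) (\<alpha>' b)" "continuous_on domain_box (\<alpha>' b)" if "b \<in> Basis" for b
    unfolding \<alpha>'_def by (intro continuous_intros test_fun_continuous[OF \<phi>] cg c\<eta> that)+
  \<comment> \<open>Here \<alpha> is \<phi> times the b-component of G and \<beta> is the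
    i-component of G, both in the variable z. The directions i and b of the two derivatives are
    exchanged.\<close>
  have swap: "integral domain_box (\<lambda>z. (\<alpha>' b z \<bullet> i) * ((r *\<^sub>R \<eta> i z) \<bullet> b)) =
      integral domain_box (\<lambda>z. (\<alpha>' b z \<bullet> b) * ((r *\<^sub>R \<eta> i z) \<bullet> i))"
    if i: "i \<in> Basis" and b: "b \<in> Basis" for i b
  proof (rule integral_gradient_swap[where \<alpha>="\<lambda>z. \<phi> z * (g z \<bullet> b)" and \<beta>="\<lambda>z. g z \<bullet> i"])
    show "GDERIV (\<lambda>z. \<phi> z * (g z \<bullet> b)) z :> \<alpha>' b z" if "norm z \<le> ?\<rho> + 1" for z
      unfolding \<alpha>'_def using \<phi> that by (intro GDERIV_mult dg b) (auto simp: test_fun_def)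
    show "continuous_on (cball 0 (?\<rho> + 1)) (\<alpha>' b)"
      by (rule continuous_on_subset[OF c\<alpha>(1)[OF b]]) auto
    show "\<phi> z * (g z \<bullet> b) = 0" if "1 \<le> norm z" for z
      using \<phi> that by (simp add: test_fun_def)
  qed (use i b dg c\<eta> in \<open>auto intro!: continuous_intros\<close>)
  have cW: "continuous_on S ?W" and ch: "continuous_on S ?h"
    by (intro continuous_intros cH cG; assumption)+
  note cW' = continuous_on_dilation(1)[OF cW r(2) r0] and ch' = continuous_on_dilation(1)[OF ch r(2) r0]
  \<comment> \<open>Each of these has integral 0. By the product rule, the terms with \<phi> sum to
    \<open>r\<^sup>2\<close> times \<phi> times \<open>?h\<close>, and those with \<phi>' sum to r
    times the inner product of \<phi>' with \<open>?W\<close>.\<close>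
  define D where "D i b z = (\<alpha>' b z \<bullet> i) * ((r *\<^sub>R \<eta> i z) \<bullet> b) - (\<alpha>' b z \<bullet> b) * ((r *\<^sub>R \<eta> i z) \<bullet> i)"
    for i b z
  have intD: "D i b integrable_on domain_box" if "i \<in> Basis" "b \<in> Basis" for i b
    unfolding D_def[abs_def] by (intro integrable_continuous continuous_intros c\<alpha> c\<eta> that)
  have "integral domain_box (D i b) = 0" if i: "i \<in> Basis" and b: "b \<in> Basis" for i b
    unfolding D_def[abs_def] using swap[OF that]
    by (subst integral_diff) (auto intro!: integrable_continuous continuous_intros c\<alpha> c\<eta> that)
  then have "0 = (\<Sum>i\<in>Basis. \<Sum>b\<in>Basis. integral domain_box (D i b))"
    by simp
  also have "\<dots> = (\<Sum>i\<in>Basis. integral domain_box (\<lambda>z. \<Sum>b\<in>Basis. D i b z))"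
    by (intro sum.cong refl integral_sum[symmetric] finite_Basis intD)
  also have "\<dots> = integral domain_box (\<lambda>z. \<Sum>i\<in>Basis. \<Sum>b\<in>Basis. D i b z)"
    by (intro integral_sum[symmetric] integrable_sum finite_Basis intD)
  also have "\<dots> = integral domain_box (\<lambda>z. r * (r * (\<phi> z * ?h (x + r *\<^sub>R z)) + \<phi>' z \<bullet> ?W (x + r *\<^sub>R z)))"
  proof (intro integral_cong)
    fix z
    let ?T = "\<Sum>j\<in>Basis. \<eta> j z \<bullet> j"
    have T2: "?T\<^sup>2 = (\<Sum>i\<in>Basis. \<Sum>b\<in>Basis. (\<eta> b z \<bullet> b) * (\<eta> i z \<bullet> i))"
      by (simp add: power2_eq_square sum_product mult.commute)
    have W: "\<phi>' z \<bullet> ?W (x + r *\<^sub>R z) =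
      (\<Sum>i\<in>Basis. \<Sum>b\<in>Basis. (g z \<bullet> b) * (\<phi>' z \<bullet> i) * (\<eta> i z \<bullet> b)) -
      (\<Sum>i\<in>Basis. \<Sum>b\<in>Basis. (g z \<bullet> b) * (\<phi>' z \<bullet> b) * (\<eta> i z \<bullet> i))"
    proof -
      have "\<phi>' z \<bullet> ?W (x + r *\<^sub>R z) = (\<Sum>i\<in>Basis. (\<eta> i z \<bullet> g z) * (\<phi>' z \<bullet> i)) - (\<Sum>i\<in>Basis. ?T * ((g z \<bullet> i) * (\<phi>' z \<bullet> i)))"
        by (simp add: g_def \<eta>_def inner_sum_right left_diff_distrib right_diff_distrib sum_subtractf mult_ac)
      also have "(\<Sum>i\<in>Basis. (\<eta> i z \<bullet> g z) * (\<phi>' z \<bullet> i)) =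
          (\<Sum>i\<in>Basis. \<Sum>b\<in>Basis. (g z \<bullet> b) * (\<phi>' z \<bullet> i) * (\<eta> i z \<bullet> b))"
        by (subst euclidean_inner) (simp add: sum_distrib_left sum_distrib_right mult_ac)
      also have "(\<Sum>i\<in>Basis. ?T * ((g z \<bullet> i) * (\<phi>' z \<bullet> i))) =
          (\<Sum>i\<in>Basis. \<Sum>b\<in>Basis. (g z \<bullet> b) * (\<phi>' z \<bullet> b) * (\<eta> i z \<bullet> i))"
        by (subst sum.swap) (simp add: sum_distrib_left sum_distrib_right mult_ac)
      finally show ?thesis .
    qed
    have h: "?h (x + r *\<^sub>R z) =
      (\<Sum>i\<in>Basis. \<Sum>b\<in>Basis. (\<eta> b z \<bullet> i) * (\<eta> i z \<bullet> b)) - (\<Sum>i\<in>Basis. \<Sum>b\<in>Basis. (\<eta> b z \<bullet> b) * (\<eta> i z \<bullet> i))"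
      using T2 by (simp add: \<eta>_def)
    show "(\<Sum>i\<in>Basis. \<Sum>b\<in>Basis. D i b z) =
      r * (r * (\<phi> z * ?h (x + r *\<^sub>R z)) + \<phi>' z \<bullet> ?W (x + r *\<^sub>R z))"
      unfolding h W D_def \<alpha>'_def
      by (simp add: sum_distrib_left sum_subtractf[symmetric] sum.distrib[symmetric] algebra_simps)
  qed
  also have "\<dots> = r * (r * average \<phi> ?h r x + integral domain_box (\<lambda>z. \<phi>' z \<bullet> ?W (x + r *\<^sub>R z)))"
  proof -
    have "integral domain_box (\<lambda>z. r * (\<phi> z * ?h (x + r *\<^sub>R z)) + \<phi>' z \<bullet> ?W (x + r *\<^sub>R z)) =
      integral domain_box (\<lambda>z. r * (\<phi> z * ?h (x + r *\<^sub>R z))) + integral domain_box (\<lambda>z. \<phi>' z \<bullet> ?W (x + r *\<^sub>R z))"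
      by (rule integral_add; intro integrable_continuous continuous_on_mult continuous_on_inner continuous_on_const
          test_fun_continuous[OF \<phi>] cW' ch')
    then show ?thesis by (simp add: average_def)
  qed
  finally have "r * average \<phi> ?h r x + integral domain_box (\<lambda>z. \<phi>' z \<bullet> ?W (x + r *\<^sub>R z)) = 0"
    using r(1) by simp
  then show "integral domain_box (\<lambda>z. \<phi>' z \<bullet> ?W (x + r *\<^sub>R z)) = - r * average \<phi> ?h r x"
    by linarith
qed

section \<open>Products of bounded Hoelder functions, and the semilinear equation\<close>

lemma weak_div_subset: "weak_div S G h \<Longrightarrow> T \<subseteq> S \<Longrightarrow> weak_div T G h"
  unfolding weak_div_def by (meson order_trans)

text \<open>The supremum bound is included because Hoelder continuity alone is not preserved by
  products, and the weak Laplacian to be estimated is quadratic in the Hessian.\<close>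

definition bounded_holder_on :: "'a::euclidean_space set \<Rightarrow> real \<Rightarrow> ('a \<Rightarrow> real) \<Rightarrow> bool" where
  "bounded_holder_on S \<alpha> f \<longleftrightarrow> (\<exists>C\<ge>0. holder_on S \<alpha> C f \<and> (\<forall>x\<in>S. \<bar>f x\<bar> \<le> C))"

lemma bounded_holder_onI:
  assumes "holder_on S \<alpha> C f" "0 \<le> C" "\<And>x. x \<in> S \<Longrightarrow> \<bar>f x\<bar> \<le> B"
  shows "bounded_holder_on S \<alpha> f"
proof -
  have "C * norm (x - y) powr \<alpha> \<le> max C B * norm (x - y) powr \<alpha>" for x y :: 'a
    by (intro mult_right_mono) auto
  then have "holder_on S \<alpha> (max C B) f"
    using assms(1) unfolding holder_on_def by (meson order_trans)
  then show ?thesis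
    using assms(2,3) unfolding bounded_holder_on_def by (intro exI[of _ "max C B"]) (auto intro: le_max_iff_disj[THEN iffD2])
qed

lemma bounded_holder_on_0: "bounded_holder_on S \<alpha> (\<lambda>x. 0)"
  unfolding bounded_holder_on_def holder_on_def by (intro exI[of _ 0]) auto

lemma bounded_holder_on_add:
  assumes "bounded_holder_on S \<alpha> f" "bounded_holder_on S \<alpha> g"
  shows "bounded_holder_on S \<alpha> (\<lambda>x. f x + g x)"
proof -
  obtain A B where A: "A \<ge> 0" "holder_on S \<alpha> A f" "\<forall>x\<in>S. \<bar>f x\<bar> \<le> A"
    and B: "B \<ge> 0" "holder_on S \<alpha> B g" "\<forall>x\<in>S. \<bar>g x\<bar> \<le> B"
    using assms unfolding bounded_holder_on_def by blast
  have "holder_on S \<alpha> (A + B) (\<lambda>x. f x + g x)"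
    unfolding holder_on_def
  proof (intro ballI)
    fix x y assume xy: "x \<in> S" "y \<in> S"
    have "\<bar>f x - f y\<bar> \<le> A * norm (x - y) powr \<alpha>" "\<bar>g x - g y\<bar> \<le> B * norm (x - y) powr \<alpha>"
      using A B xy unfolding holder_on_def by auto
    then show "\<bar>f x + g x - (f y + g y)\<bar> \<le> (A + B) * norm (x - y) powr \<alpha>"
      unfolding distrib_right by linarith
  qed
  moreover have "\<bar>f x + g x\<bar> \<le> A + B" if "x \<in> S" for x
    using A(3) B(3) that abs_triangle_ineq[of "f x" "g x"] by fastforce
  ultimately show ?thesis
    using A(1) B(1) unfolding bounded_holder_on_def by (intro exI[of _ "A + B"]) auto
qed

lemma bounded_holder_on_mult:
  assumes "bounded_holder_on S \<alpha> f" "bounded_holder_on S \<alpha> g"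
  shows "bounded_holder_on S \<alpha> (\<lambda>x. f x * g x)"
proof -
  obtain A B where A: "A \<ge> 0" "holder_on S \<alpha> A f" "\<forall>x\<in>S. \<bar>f x\<bar> \<le> A"
    and B: "B \<ge> 0" "holder_on S \<alpha> B g" "\<forall>x\<in>S. \<bar>g x\<bar> \<le> B"
    using assms unfolding bounded_holder_on_def by blast
  have "holder_on S \<alpha> (2 * (A * B)) (\<lambda>x. f x * g x)"
    unfolding holder_on_def
  proof (intro ballI)
    fix x y assume xy: "x \<in> S" "y \<in> S"
    let ?d = "norm (x - y) powr \<alpha>"
    have d: "\<bar>f x - f y\<bar> \<le> A * ?d" "\<bar>g x - g y\<bar> \<le> B * ?d"
      using A B xy unfolding holder_on_def by auto
    have "f x * g x - f y * g y = f x * (g x - g y) + (f x - f y) * g y"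
      by (simp add: algebra_simps)
    also have "\<bar>\<dots>\<bar> \<le> \<bar>f x\<bar> * \<bar>g x - g y\<bar> + \<bar>f x - f y\<bar> * \<bar>g y\<bar>"
      unfolding abs_mult[symmetric] by (rule abs_triangle_ineq)
    also have "\<dots> \<le> A * (B * ?d) + (A * ?d) * B"
      using d A B xy by (intro add_mono mult_mono) auto
    finally show "\<bar>f x * g x - f y * g y\<bar> \<le> 2 * (A * B) * ?d" by simp
  qed
  moreover have "\<bar>f x * g x\<bar> \<le> A * B" if "x \<in> S" for x
    unfolding abs_mult using A B that by (intro mult_mono) auto
  ultimately show ?thesis
    using A(1) B(1) by (intro bounded_holder_onI[where C="2 * (A * B)" and B="A * B"]) auto
qed

lemma bounded_holder_on_minus:
  "bounded_holder_on S \<alpha> f \<Longrightarrow> bounded_holder_on S \<alpha> (\<lambda>x. - f x)"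
  unfolding bounded_holder_on_def holder_on_def by (simp add: abs_minus_commute)

lemma bounded_holder_on_sum:
  "(\<And>i. i \<in> I \<Longrightarrow> bounded_holder_on S \<alpha> (f i)) \<Longrightarrow> bounded_holder_on S \<alpha> (\<lambda>x. \<Sum>i\<in>I. f i x)"
  by (induction I rule: infinite_finite_induct) (auto intro: bounded_holder_on_0 bounded_holder_on_add)

lemma C1_lipschitz_on_cball:
  fixes w :: "'a::euclidean_space \<Rightarrow> real"
  assumes w: "\<And>y. y \<in> cball x e \<Longrightarrow> GDERIV w y :> G y" and G: "continuous_on (cball x e) G"
  obtains \<Lambda> where "0 \<le> \<Lambda>"
    "\<And>y z. y \<in> cball x e \<Longrightarrow> z \<in> cball x e \<Longrightarrow> \<bar>w y - w z\<bar> \<le> \<Lambda> * norm (y - z)"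
proof -
  have "bounded (G ` cball x e)"
    by (intro compact_imp_bounded compact_continuous_image G) auto
  then obtain B where B: "\<And>y. y \<in> cball x e \<Longrightarrow> norm (G y) \<le> B"
    unfolding bounded_iff by blast
  have "norm (w y - w z) \<le> max B 0 * norm (y - z)" if "y \<in> cball x e" "z \<in> cball x e" for y z
  proof (rule differentiable_bound[OF convex_cball _ _ that])
    fix v assume v: "v \<in> cball x e"
    show "(w has_derivative (\<lambda>h. h \<bullet> G v)) (at v within cball x e)"
      using w[OF v] unfolding gderiv_def by (rule has_derivative_at_withinI)
    show "onorm (\<lambda>h. h \<bullet> G v) \<le> max B 0"
    proof (rule onorm_le)
      fix h
      have "\<bar>h \<bullet> G v\<bar> \<le> norm h * norm (G v)" by (rule Cauchy_Schwarz_ineq2)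
      also have "\<dots> \<le> norm h * max B 0" using B[OF v] by (intro mult_left_mono) auto
      finally show "norm (h \<bullet> G v) \<le> max B 0 * norm h" by (simp add: mult.commute)
    qed
  qed
  then show ?thesis using that[of "max B 0"] by simp
qed

text \<open>The derivatives sought are the pure second derivatives of |grad u|^2 / 2. By the
  equation, the vector field of the divergence identity is the gradient of \<open>\<psi>\<close>, so
  \<open>weak_laplacian_second_deriv\<close> differentiates its components; the contribution of l
  F(u), which is of class C^2, is then subtracted.\<close>

lemma semilinear_half_norm_grad_sq:
  fixes u :: "'a::euclidean_space \<Rightarrow> real"
  assumes S: "open S" "x \<in> S"
    and G: "\<And>y. y \<in> S \<Longrightarrow> GDERIV u y :> G y"
    and H: "\<And>b y. b \<in> Basis \<Longrightarrow> y \<in> S \<Longrightarrow> GDERIV (\<lambda>y. G y \<bullet> b) y :> H b y"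
    and cH: "\<And>b. b \<in> Basis \<Longrightarrow> continuous_on S (H b)"
    and sym: "\<And>b c y. b \<in> Basis \<Longrightarrow> c \<in> Basis \<Longrightarrow> y \<in> S \<Longrightarrow> H b y \<bullet> c = H c y \<bullet> b"
    and f: "\<And>s. (f has_real_derivative f' s) (at s)" and cf': "continuous_on UNIV f'"
    and pde: "\<And>y. y \<in> S \<Longrightarrow> (\<Sum>b\<in>Basis. H b y \<bullet> b) = - l * f (u y)"
  obtains q where
    "\<And>b. b \<in> Basis \<Longrightarrow> ((\<lambda>t. H b (x + t *\<^sub>R b) \<bullet> G (x + t *\<^sub>R b)) has_real_derivative q b) (at 0)"
    "(\<Sum>b\<in>Basis. q b) = (\<Sum>b\<in>Basis. (norm (H b x))\<^sup>2) - l * f' (u x) * (norm (G x))\<^sup>2"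
proof -
  obtain e where e: "0 < e" "cball x e \<subseteq> S"
    using S open_contains_cball by blast
  \<comment> \<open>The closed ball is compact and gives Lipschitz constants for u and for its
    Laplacian - l f(u); its interior is the open set on which \<open>hessian_holder\<close> is
    applied.\<close>
  let ?B = "ball x e"
  have BS: "?B \<subseteq> S" "?B \<subseteq> cball x e" using e(2) ball_subset_cball by blast+
  have cG: "continuous_on S G" by (rule gradient_continuous_on[OF H])
  have cu: "continuous_on S u" by (rule GDERIV_continuous_on[OF G])
  obtain \<Lambda> where \<Lambda>: "0 \<le> \<Lambda>"
    "\<And>y z. y \<in> cball x e \<Longrightarrow> z \<in> cball x e \<Longrightarrow> \<bar>u y - u z\<bar> \<le> \<Lambda> * norm (y - z)"
    by (rule C1_lipschitz_on_cball[of x e u G]) (use e G continuous_on_subset[OF cG] in auto)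
  have df: "GDERIV (\<lambda>y. - l * f (u y)) y :> (- l) *\<^sub>R (f' (u y) *\<^sub>R G y)" if "y \<in> S" for y
    by (intro GDERIV_cmult GDERIV_DERIV_compose[OF G[OF that] f])
  have cdf: "continuous_on S (\<lambda>y. (- l) *\<^sub>R (f' (u y) *\<^sub>R G y))"
    by (intro continuous_intros cG continuous_on_compose2[OF cf' cu]) auto
  obtain K where K: "0 \<le> K"
    "\<And>y z. y \<in> cball x e \<Longrightarrow> z \<in> cball x e \<Longrightarrow> \<bar>(- l * f (u y)) - (- l * f (u z))\<bar> \<le> K * norm (y - z)"
    by (rule C1_lipschitz_on_cball[of x e "\<lambda>y. - l * f (u y)" "\<lambda>y. (- l) *\<^sub>R (f' (u y) *\<^sub>R G y)"])
      (use e df continuous_on_subset[OF cdf] in auto)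
  obtain \<delta> where \<delta>: "0 < \<delta>" "ball x \<delta> \<subseteq> ?B"
    "\<And>b c. b \<in> Basis \<Longrightarrow> c \<in> Basis \<Longrightarrow> \<exists>C\<ge>0. holder_on (ball x \<delta>) (1/3) C (\<lambda>y. H c y \<bullet> b)"
  proof (rule hessian_holder[of ?B x u G H K \<Lambda>])
    show "holder_on ?B 1 K (\<lambda>y. \<Sum>b\<in>Basis. H b y \<bullet> b)"
      unfolding holder_on_def
    proof (intro ballI)
      fix y z assume yz: "y \<in> ?B" "z \<in> ?B"
      then have "y \<in> S" "z \<in> S" using BS by blast+
      then show "\<bar>(\<Sum>b\<in>Basis. H b y \<bullet> b) - (\<Sum>b\<in>Basis. H b z \<bullet> b)\<bar> \<le> K * norm (y - z) powr 1"
        using K(2)[of y z] pde yz by simp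
    qed
    show "continuous_on ?B (H b)" if "b \<in> Basis" for b
      by (rule continuous_on_subset[OF cH[OF that] BS(1)])
  qed (use e BS G H K \<Lambda> in auto)
  let ?D = "ball x \<delta>"
  have DS: "?D \<subseteq> S" using \<delta>(2) BS by blast
  have bh: "bounded_holder_on ?D (1/3) (\<lambda>y. H c y \<bullet> b)" if bc: "b \<in> Basis" "c \<in> Basis" for b c
  proof -
    obtain C where C: "C \<ge> 0" "holder_on ?D (1/3) C (\<lambda>y. H c y \<bullet> b)"
      using \<delta>(3)[OF bc] by blast
    have "bounded ((\<lambda>y. H c y \<bullet> b) ` cball x e)"
      using e(2) by (intro compact_imp_bounded compact_continuous_image continuous_intros
          continuous_on_subset[OF cH[OF bc(2)]]) auto
    then obtain B where B: "\<forall>v\<in>(\<lambda>y. H c y \<bullet> b) ` cball x e. norm v \<le> B"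
      unfolding bounded_iff by blast
    show ?thesis
    proof (rule bounded_holder_onI[OF C(2,1)])
      fix y assume "y \<in> ?D"
      then have "y \<in> cball x e" using \<delta>(2) BS(2) by blast
      then show "\<bar>H c y \<bullet> b\<bar> \<le> B" using B by simp
    qed
  qed
  let ?W = "\<lambda>y. \<Sum>i\<in>Basis. (H i y \<bullet> G y - (\<Sum>j\<in>Basis. H j y \<bullet> j) * (G y \<bullet> i)) *\<^sub>R i"
  let ?h = "\<lambda>y. (\<Sum>i\<in>Basis. \<Sum>b\<in>Basis. (H b y \<bullet> i) * (H i y \<bullet> b)) - (\<Sum>j\<in>Basis. H j y \<bullet> j)\<^sup>2"
  have W_inner: "?W y \<bullet> b = H b y \<bullet> G y + l * f (u y) * (G y \<bullet> b)" if "b \<in> Basis" "y \<in> S" for b y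
    using that pde[OF that(2)] by (simp add: inner_sum_left_Basis)
  have weak: "weak_div ?D ?W ?h"
    by (rule weak_div_subset[OF weak_div_hessian_minor[OF H cH] DS])
  have cW: "continuous_on ?D ?W" and ch: "continuous_on ?D ?h"
    using DS by (auto intro!: continuous_intros continuous_on_subset[OF cH] continuous_on_subset[OF cG])
  have "bounded_holder_on ?D (1/3) ?h"
    unfolding diff_conv_add_uminus power2_eq_square
    by (intro bounded_holder_on_add bounded_holder_on_sum bounded_holder_on_mult bounded_holder_on_minus bh)
  then obtain C where C: "0 \<le> C" "holder_on ?D (1/3) C ?h"
    unfolding bounded_holder_on_def by blast
  \<comment> \<open>f is continuous on the whole line; the infinite endpoints give one
    antiderivative valid at every value of u.\<close>
  have "\<exists>F. \<forall>s::real. (-\<infinity>::ereal) < s \<longrightarrow> s < \<infinity> \<longrightarrow> (F has_vector_derivative f s) (at s)"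
    using f by (intro einterval_antiderivative) (auto intro: DERIV_isCont)
  then obtain F where F: "\<And>s. (F has_real_derivative f s) (at s)"
    by (auto simp: has_real_derivative_iff_has_vector_derivative)
  define \<psi> where "\<psi> y = (\<Sum>i\<in>Basis. (1/2) * ((G y \<bullet> i) * (G y \<bullet> i))) + l * F (u y)" for y
  have \<psi>: "GDERIV \<psi> y :> ?W y" if y: "y \<in> S" for y
  proof -
    have "GDERIV \<psi> y :> (\<Sum>i\<in>Basis. (1/2) *\<^sub>R ((G y \<bullet> i) *\<^sub>R H i y + (G y \<bullet> i) *\<^sub>R H i y)) + l *\<^sub>R (f (u y) *\<^sub>R G y)"
    proof -
      have "GDERIV (\<lambda>y. \<Sum>i\<in>Basis. (1/2) * ((G y \<bullet> i) * (G y \<bullet> i))) y :>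
          (\<Sum>i\<in>Basis. (1/2) *\<^sub>R ((G y \<bullet> i) *\<^sub>R H i y + (G y \<bullet> i) *\<^sub>R H i y))"
        unfolding gderiv_def inner_sum_right
        by (intro has_derivative_sum GDERIV_cmult[OF GDERIV_mult[OF H H], unfolded gderiv_def] y)
      then show ?thesis
        unfolding \<psi>_def by (intro GDERIV_add GDERIV_cmult GDERIV_DERIV_compose[OF G[OF y] F])
    qed
    moreover have "(\<Sum>i\<in>Basis. (1/2) *\<^sub>R ((G y \<bullet> i) *\<^sub>R H i y + (G y \<bullet> i) *\<^sub>R H i y)) + l *\<^sub>R (f (u y) *\<^sub>R G y) = ?W y"
    proof (rule euclidean_eqI)
      fix b :: 'a assume b: "b \<in> Basis"
      have "(\<Sum>i\<in>Basis. (G y \<bullet> i) * (H i y \<bullet> b)) = H b y \<bullet> G y"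
        using sym[OF _ b y] by (subst euclidean_inner[of "H b y"]) (simp add: mult.commute)
      then show "((\<Sum>i\<in>Basis. (1/2) *\<^sub>R ((G y \<bullet> i) *\<^sub>R H i y + (G y \<bullet> i) *\<^sub>R H i y)) + l *\<^sub>R (f (u y) *\<^sub>R G y)) \<bullet> b = ?W y \<bullet> b"
        unfolding W_inner[OF b y] by (simp add: inner_add_left inner_sum_left)
    qed
    ultimately show ?thesis by simp
  qed
  obtain q where q: "\<And>b. b \<in> Basis \<Longrightarrow> ((\<lambda>t. ?W (x + t *\<^sub>R b) \<bullet> b) has_real_derivative q b) (at 0)"
    "(\<Sum>b\<in>Basis. q b) = ?h x"
    by (rule weak_laplacian_second_deriv[of ?D x \<psi> ?W ?h "1/3" C])
      (use \<delta>(1) DS \<psi> cW ch weak C in auto)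
  \<comment> \<open>Subtracts the derivative of l f(u) times the b-component of G. In the sum over
    b, l f(u) times the Laplacian is minus the square of the Laplacian, which removes the square in
    \<open>?h\<close>.\<close>
  define p where "p b = q b - l * (f' (u x) * (G x \<bullet> b) * (G x \<bullet> b) + f (u x) * (H b x \<bullet> b))" for b
  show ?thesis
  proof (rule that[of p])
    fix b :: 'a assume b: "b \<in> Basis"
    have Gx: "GDERIV u (x + 0 *\<^sub>R b) :> G x" "GDERIV (\<lambda>y. G y \<bullet> b) (x + 0 *\<^sub>R b) :> H b x"
      using G H b S by auto
    have "((\<lambda>t. f (u (x + t *\<^sub>R b))) has_real_derivative f' (u x) * (G x \<bullet> b)) (at 0)"
      using DERIV_chain2[OF f GDERIV_compose_line[OF Gx(1)]] by simp
    from DERIV_mult[OF this GDERIV_compose_line[OF Gx(2)]]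
    have "((\<lambda>t. f (u (x + t *\<^sub>R b)) * (G (x + t *\<^sub>R b) \<bullet> b)) has_real_derivative
        f' (u x) * (G x \<bullet> b) * (G x \<bullet> b) + f (u x) * (H b x \<bullet> b)) (at 0)"
      by (simp add: mult_ac)
    from DERIV_diff[OF q(1)[OF b] DERIV_cmult[OF this, of l]]
    have "((\<lambda>t. ?W (x + t *\<^sub>R b) \<bullet> b - l * (f (u (x + t *\<^sub>R b)) * (G (x + t *\<^sub>R b) \<bullet> b))) has_real_derivative p b) (at 0)"
      unfolding p_def .
    then show "((\<lambda>t. H b (x + t *\<^sub>R b) \<bullet> G (x + t *\<^sub>R b)) has_real_derivative p b) (at 0)"
    proof (rule has_field_derivative_transform_within_open[where S="{-\<delta><..<\<delta>}"])
      fix t assume "t \<in> {-\<delta><..<\<delta>}"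
      then have "x + t *\<^sub>R b \<in> S" using DS b by (auto simp: dist_norm subset_iff)
      then show "?W (x + t *\<^sub>R b) \<bullet> b - l * (f (u (x + t *\<^sub>R b)) * (G (x + t *\<^sub>R b) \<bullet> b)) =
          H b (x + t *\<^sub>R b) \<bullet> G (x + t *\<^sub>R b)"
        using W_inner[OF b] by simp
    qed (use \<delta> in auto)
  next
    have "(\<Sum>i\<in>Basis. \<Sum>b\<in>Basis. (H b x \<bullet> i) * (H i x \<bullet> b)) = (\<Sum>b\<in>Basis. (norm (H b x))\<^sup>2)"
      unfolding power2_norm_eq_inner
      by (subst euclidean_inner) (intro sum.cong refl, simp add: sym S)
    moreover have "(\<Sum>b\<in>Basis. l * (f' (u x) * (G x \<bullet> b) * (G x \<bullet> b) + f (u x) * (H b x \<bullet> b))) =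
        l * f' (u x) * (norm (G x))\<^sup>2 + l * f (u x) * (\<Sum>b\<in>Basis. H b x \<bullet> b)"
      unfolding power2_norm_eq_inner
      by (subst euclidean_inner[of "G x"]) (simp add: sum.distrib sum_distrib_left algebra_simps)
    ultimately show "(\<Sum>b\<in>Basis. p b) = (\<Sum>b\<in>Basis. (norm (H b x))\<^sup>2) - l * f' (u x) * (norm (G x))\<^sup>2"
      using pde[OF S(2)] q(2) unfolding p_def sum_subtractf by (simp add: power2_eq_square algebra_simps)
  qed
qed

section \<open>Functions with continuous partial derivatives\<close>

text \<open>Walk from x to y one coordinate at a time and apply the mean value inequality on each
  edge; continuity of G makes all partial derivatives on the path close to those at x.\<close>

lemma GDERIV_of_continuous_partials:
  fixes f :: "'a::euclidean_space \<Rightarrow> real"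
  assumes S: "open S" "x \<in> S"
    and der: "\<And>b y. b \<in> Basis \<Longrightarrow> y \<in> S \<Longrightarrow> ((\<lambda>t. f (y + t *\<^sub>R b)) has_real_derivative G y \<bullet> b) (at 0)"
    and G: "continuous_on S G"
  shows "GDERIV f x :> G x"
  unfolding gderiv_def has_derivative_at_alt
proof (intro conjI allI impI)
  show "bounded_linear (\<lambda>h. h \<bullet> G x)" by (rule bounded_linear_inner_left)
next
  fix e :: real assume e: "0 < e"
  \<comment> \<open>Each of the \<open>DIM('a)\<close> edges contributes at most \<epsilon> times
    the norm of h.\<close>
  define \<epsilon> where "\<epsilon> = e / DIM('a)"
  have \<epsilon>: "0 < \<epsilon>" using e by (simp add: \<epsilon>_def)
  obtain d1 where d1: "0 < d1" "ball x d1 \<subseteq> S"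
    using S open_contains_ball by blast
  have "isCont G x" using G S by (simp add: continuous_on_eq_continuous_at)
  then obtain d2 where d2: "0 < d2" "\<And>y. dist y x < d2 \<Longrightarrow> dist (G y) (G x) < \<epsilon>"
    using \<epsilon> unfolding continuous_at_eps_delta dist_norm by blast
  show "\<exists>d>0. \<forall>y. norm (y - x) < d \<longrightarrow> norm (f y - f x - (y - x) \<bullet> G x) \<le> e * norm (y - x)"
  proof (intro exI[of _ "min d1 d2"] conjI allI impI)
    show "0 < min d1 d2" using d1 d2 by simp
  next
    fix y assume y: "norm (y - x) < min d1 d2"
    define h where "h = y - x"
    \<comment> \<open>Every point of the path is x + v with v bounded by h in each coordinate, so
      this covers all edges at once.\<close>
    have small: "x + v \<in> S" "norm (G (x + v) - G x) \<le> \<epsilon>"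
      if v: "\<And>b. b \<in> Basis \<Longrightarrow> \<bar>v \<bullet> b\<bar> \<le> \<bar>h \<bullet> b\<bar>" for v
    proof -
      have "norm v < min d1 d2"
        using norm_le_componentwise[of v h] v y unfolding h_def by fastforce
      then show "x + v \<in> S" "norm (G (x + v) - G x) \<le> \<epsilon>"
        using d1(2) d2(2)[of "x + v"] by (auto simp: dist_norm subset_iff)
    qed
    have "\<bar>f (x + (\<Sum>b\<in>A. (h \<bullet> b) *\<^sub>R b)) - f x - (\<Sum>b\<in>A. (h \<bullet> b) * (G x \<bullet> b))\<bar> \<le> (\<Sum>b\<in>A. \<epsilon> * \<bar>h \<bullet> b\<bar>)"
      if "A \<subseteq> Basis" for A
      using finite_subset[OF that finite_Basis] that
    proof (induction A rule: finite_induct)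
      case (insert c A)
      let ?v = "\<Sum>b\<in>A. (h \<bullet> b) *\<^sub>R b"
      have c: "c \<in> Basis" and A: "A \<subseteq> Basis" using insert.prems by auto
      have v: "?v \<bullet> b = (if b \<in> A then h \<bullet> b else 0)" if "b \<in> Basis" for b
        using inner_sum_left_Basis[OF that] A that insert.hyps(1)
        by (simp add: inner_sum_left inner_Basis subset_iff sum.If_cases if_distrib cong: if_cong sum.cong)
      let ?\<phi> = "\<lambda>t. f (x + ?v + t *\<^sub>R c) - t * (G x \<bullet> c)"
      have "norm (?\<phi> (h \<bullet> c) - ?\<phi> 0) \<le> \<epsilon> * norm (h \<bullet> c - 0)"
      proof (rule field_differentiable_bound[where S="closed_segment 0 (h \<bullet> c)"])
        fix t assume t: "t \<in> closed_segment 0 (h \<bullet> c)"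
        then have t': "\<bar>t\<bar> \<le> \<bar>h \<bullet> c\<bar>"
          by (auto simp: closed_segment_eq_real_ivl split: if_splits)
        have comp: "\<bar>(?v + t *\<^sub>R c) \<bullet> b\<bar> \<le> \<bar>h \<bullet> b\<bar>" if "b \<in> Basis" for b
          using v[OF that] t' c that insert.hyps(2) by (auto simp: inner_add_left inner_Basis)
        note sm = small[OF comp, unfolded add.assoc[symmetric]]
        have "((\<lambda>s. f ((x + ?v + t *\<^sub>R c) + s *\<^sub>R c)) has_real_derivative G (x + ?v + t *\<^sub>R c) \<bullet> c) (at 0)"
          by (rule der[OF c sm(1)])
        then have "((\<lambda>s. f (x + ?v + s *\<^sub>R c)) has_real_derivative G (x + ?v + t *\<^sub>R c) \<bullet> c) (at t)"
          using DERIV_shift[of "\<lambda>s. f (x + ?v + s *\<^sub>R c)" _ 0 t] by (simp add: algebra_simps)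
        moreover have "((\<lambda>s. s * (G x \<bullet> c)) has_real_derivative G x \<bullet> c) (at t)"
          by (auto intro!: derivative_eq_intros)
        ultimately have "(?\<phi> has_real_derivative G (x + ?v + t *\<^sub>R c) \<bullet> c - G x \<bullet> c) (at t)"
          by (rule DERIV_diff)
        then show "(?\<phi> has_field_derivative G (x + ?v + t *\<^sub>R c) \<bullet> c - G x \<bullet> c) (at t within closed_segment 0 (h \<bullet> c))"
          by (rule has_field_derivative_at_within)
        have "\<bar>(G (x + ?v + t *\<^sub>R c) - G x) \<bullet> c\<bar> \<le> norm (G (x + ?v + t *\<^sub>R c) - G x)"
          by (rule Basis_le_norm[OF c])
        then show "norm (G (x + ?v + t *\<^sub>R c) \<bullet> c - G x \<bullet> c) \<le> \<epsilon>"
          using sm(2) by (simp add: inner_diff_left)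
      qed auto
      then show ?case
        using insert.IH[OF A] insert.hyps by (simp add: add_ac algebra_simps)
    qed simp
    from this[of Basis] have "\<bar>f y - f x - h \<bullet> G x\<bar> \<le> (\<Sum>b\<in>(Basis::'a set). \<epsilon> * \<bar>h \<bullet> b\<bar>)"
      by (simp add: euclidean_representation euclidean_inner[symmetric] h_def)
    also have "\<dots> \<le> (\<Sum>b\<in>(Basis::'a set). \<epsilon> * norm h)"
      using \<epsilon> by (intro sum_mono mult_left_mono Basis_le_norm) auto
    also have "\<dots> = e * norm h"
      by (simp add: \<epsilon>_def)
    finally show "norm (f y - f x - (y - x) \<bullet> G x) \<le> e * norm (y - x)"
      by (simp add: h_def)
  qed
qed

section \<open>From witnesses of differentiability to \<open>partial_deriv\<close> and
  \<open>grad\<close>\<close>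

lemma grad_inner_Basis: "b \<in> Basis \<Longrightarrow> grad f x \<bullet> b = partial_deriv b f x"
  by (simp add: grad_def inner_sum_left_Basis)

lemma partial_derivI:
  "((\<lambda>t. f (x + t *\<^sub>R b)) has_real_derivative D) (at 0) \<Longrightarrow> partial_deriv b f x = D"
  unfolding partial_deriv_def by (rule DERIV_imp_deriv)

lemma line_derivative_cong:
  fixes f g :: "'a::real_normed_vector \<Rightarrow> real"
  assumes "open S" "x \<in> S" "\<And>y. y \<in> S \<Longrightarrow> f y = g y"
  shows "((\<lambda>t. f (x + t *\<^sub>R b)) has_real_derivative D) (at 0) \<longleftrightarrow>
    ((\<lambda>t. g (x + t *\<^sub>R b)) has_real_derivative D) (at 0)"
proof (rule DERIV_cong_ev)
  have "((\<lambda>t. x + t *\<^sub>R b) \<longlongrightarrow> x + 0 *\<^sub>R b) (nhds 0)"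
    by (intro tendsto_intros) (auto simp: filterlim_ident)
  then have "eventually (\<lambda>t. x + t *\<^sub>R b \<in> S) (nhds 0)"
    using assms(1,2) by (intro topological_tendstoD) auto
  then show "\<forall>\<^sub>F t in nhds 0. f (x + t *\<^sub>R b) = g (x + t *\<^sub>R b)"
    by eventually_elim (rule assms(3))
qed auto

lemma partial_deriv_cong:
  fixes f g :: "'a::euclidean_space \<Rightarrow> real"
  assumes "open S" "x \<in> S" "\<And>y. y \<in> S \<Longrightarrow> f y = g y"
  shows "partial_deriv b f x = partial_deriv b g x"
  using line_derivative_cong[where f=f and g=g and b=b, OF assms] by (simp only: partial_deriv_def deriv_def)

text \<open>\<open>cont_diff\<close> only provides some function that agrees with the derivative on
  U. Restricting to U and allowing a change of function there makes it possible to take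
  \<open>partial_deriv\<close> itself, whose values on the boundary are not controlled.\<close>

lemma cont_diff_restrict:
  assumes "open U" "U \<subseteq> S"
  shows "cont_diff k U S f \<Longrightarrow> (\<And>x. x \<in> U \<Longrightarrow> f x = f' x) \<Longrightarrow> cont_diff k U U f'"
proof (induction k arbitrary: f f')
  case 0
  then show ?case
    using continuous_on_eq[OF continuous_on_subset[OF _ assms(2)], of f f'] by simp
next
  case (Suc k)
  have "continuous_on U f'"
    using Suc.prems continuous_on_eq[OF continuous_on_subset[OF _ assms(2)], of f f'] by simp
  moreover have "\<exists>g. cont_diff k U U g \<and> (\<forall>x\<in>U. ((\<lambda>t. f' (x + t *\<^sub>R b)) has_real_derivative g x) (at 0))"
    if b: "b \<in> Basis" for b
  proof -
    obtain g where g: "cont_diff k U S g" "\<forall>x\<in>U. ((\<lambda>t. f (x + t *\<^sub>R b)) has_real_derivative g x) (at 0)"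
      using Suc.prems(1) b by auto
    have "\<forall>x\<in>U. ((\<lambda>t. f' (x + t *\<^sub>R b)) has_real_derivative g x) (at 0)"
      using g(2) line_derivative_cong[where f=f and g=f' and b=b, OF assms(1) _ Suc.prems(2)] by blast
    then show ?thesis using Suc.IH[OF g(1) refl] by blast
  qed
  ultimately show ?case by simp
qed

lemma cont_diff_SucD:
  assumes "open U" "cont_diff (Suc k) U U f" "b \<in> Basis"
  shows "cont_diff k U U (partial_deriv b f)"
    and "x \<in> U \<Longrightarrow> ((\<lambda>t. f (x + t *\<^sub>R b)) has_real_derivative partial_deriv b f x) (at 0)"
proof -
  obtain g where g: "cont_diff k U U g" "\<forall>x\<in>U. ((\<lambda>t. f (x + t *\<^sub>R b)) has_real_derivative g x) (at 0)"
    using assms(2,3) by auto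
  then have eq: "g x = partial_deriv b f x" if "x \<in> U" for x
    using that by (auto intro: partial_derivI[symmetric])
  show "cont_diff k U U (partial_deriv b f)"
    by (rule cont_diff_restrict[OF assms(1) order_refl g(1) eq])
  show "((\<lambda>t. f (x + t *\<^sub>R b)) has_real_derivative partial_deriv b f x) (at 0)" if "x \<in> U"
    using g(2) eq[OF that] that by auto
qed

lemma cont_diff_continuous_on: "cont_diff k U S f \<Longrightarrow> continuous_on S f"
  by (cases k) auto

lemma cont_diff_grad:
  fixes f :: "'a::euclidean_space \<Rightarrow> real"
  assumes "open U" "cont_diff (Suc k) U U f"
  shows "continuous_on U (grad f)"
    and "x \<in> U \<Longrightarrow> GDERIV f x :> grad f x"
proof -
  show c: "continuous_on U (grad f)"
    unfolding grad_def[abs_def]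
    by (intro continuous_intros cont_diff_continuous_on[OF cont_diff_SucD(1)[OF assms]])
  show "GDERIV f x :> grad f x" if "x \<in> U"
    by (rule GDERIV_of_continuous_partials[OF assms(1) that _ c])
      (simp add: grad_inner_Basis cont_diff_SucD(2)[OF assms])
qed

lemma cont_diff_hessian:
  fixes f :: "'a::euclidean_space \<Rightarrow> real"
  assumes "open U" "cont_diff (Suc (Suc k)) U U f" "b \<in> Basis"
  shows "continuous_on U (grad (partial_deriv b f))"
    and "x \<in> U \<Longrightarrow> GDERIV (\<lambda>x. grad f x \<bullet> b) x :> grad (partial_deriv b f) x"
  using cont_diff_grad[OF assms(1) cont_diff_SucD(1)[OF assms]]
  by (simp_all add: grad_inner_Basis[OF assms(3), of f, abs_def])

lemma mixed_partials_commute: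
  fixes f :: "'a::euclidean_space \<Rightarrow> real"
  assumes "open U" "cont_diff (Suc (Suc k)) U U f" "x \<in> U" "b \<in> Basis" "c \<in> Basis"
  shows "partial_deriv b (partial_deriv c f) x = partial_deriv c (partial_deriv b f) x"
  using hessian_symmetric[OF assms(1,3) cont_diff_grad(2)[OF assms(1,2)] cont_diff_hessian(2)[OF assms(1,2)]
      cont_diff_hessian(1)[OF assms(1,2)] assms(5,4)] assms(4,5)
  by (simp add: grad_inner_Basis)

section \<open>Eigenvalues of self-adjoint maps\<close>

text \<open>First variation: for small t of the sign of a the linear term would win. The value t = a
  / k, with k above both 0 and c, is small enough.\<close>

lemma quadratic_bound_imp_eq_0:
  fixes a c :: real
  assumes "\<And>t. 2 * t * a \<le> t\<^sup>2 * c"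
  shows "a = 0"
proof (rule ccontr)
  assume a: "a \<noteq> 0"
  define k where "k = \<bar>c\<bar> + 1"
  have k: "0 < k" "c < k" unfolding k_def by linarith+
  have "2 * (a / k) * a \<le> (a / k)\<^sup>2 * c" by (rule assms)
  then have "2 * a\<^sup>2 * k \<le> a\<^sup>2 * c"
    using k(1) by (simp add: field_simps power2_eq_square)
  then have "2 * k \<le> c" using a by (simp add: mult.commute[of _ "a\<^sup>2"] mult.assoc mult.left_commute)
  then show False using k by linarith
qed

text \<open>Let e maximise the quadratic form of A on the unit sphere of V, with maximum m. Varying
  e shows that A e is orthogonal to every y in V orthogonal to e; for y = A e - m e this forces y =
  0.\<close>

lemma selfadjoint_eigenvector:
  fixes A :: "'a::euclidean_space \<Rightarrow> 'a"
  assumes A: "linear A" and adj: "\<And>x y. A x \<bullet> y = x \<bullet> A y"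
    and V: "subspace V" "A ` V \<subseteq> V" "V \<noteq> {0}"
  obtains e where "e \<in> V" "norm e = 1" "A e = (A e \<bullet> e) *\<^sub>R e"
proof -
  interpret linear A by (rule A)
  let ?K = "V \<inter> sphere 0 1"
  have "compact ?K" using closed_subspace[OF V(1)] by (intro closed_Int_compact) auto
  moreover have "?K \<noteq> {}"
  proof -
    obtain v where "v \<in> V" "v \<noteq> 0" using V(1,3) subspace_0 by blast
    then have "(1 / norm v) *\<^sub>R v \<in> ?K" using V(1) by (simp add: subspace_scale)
    then show ?thesis by blast
  qed
  moreover have "continuous_on ?K (\<lambda>v. A v \<bullet> v)"
    by (intro continuous_intros linear_continuous_on linear_linear[THEN iffD2] A linear_conv_bounded_linear[THEN iffD1])
  ultimately obtain e where e: "e \<in> ?K" "\<And>v. v \<in> ?K \<Longrightarrow> A v \<bullet> v \<le> A e \<bullet> e"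
    using continuous_attains_sup[of ?K "\<lambda>v. A v \<bullet> v"] by blast
  define m where "m = A e \<bullet> e"
  have ee: "e \<in> V" "e \<bullet> e = 1" using e(1) by (auto simp: norm_eq_1)
  have max: "A v \<bullet> v \<le> m * (v \<bullet> v)" if "v \<in> V" for v
  proof (cases "v = 0")
    case False
    have "(1 / norm v) *\<^sub>R v \<in> ?K" using that V(1) False by (simp add: subspace_scale)
    then have "A ((1 / norm v) *\<^sub>R v) \<bullet> ((1 / norm v) *\<^sub>R v) \<le> m"
      unfolding m_def by (rule e(2))
    then have "(A v \<bullet> v) / (norm v)\<^sup>2 \<le> m" by (simp add: scale power2_eq_square)
    then show ?thesis using False by (simp add: field_simps power2_norm_eq_inner[symmetric])
  qed (simp add: zero)
  have orth: "A e \<bullet> y = 0" if y: "y \<in> V" "y \<bullet> e = 0" for y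
  proof (rule quadratic_bound_imp_eq_0)
    fix t :: real
    have "A (e + t *\<^sub>R y) \<bullet> (e + t *\<^sub>R y) \<le> m * ((e + t *\<^sub>R y) \<bullet> (e + t *\<^sub>R y))"
      using ee y V(1) by (intro max) (simp add: subspace_add subspace_scale)
    moreover have "A y \<bullet> e = A e \<bullet> y" using adj[of y e] by (simp add: inner_commute)
    ultimately show "2 * t * (A e \<bullet> y) \<le> t\<^sup>2 * (m * (y \<bullet> y) - A y \<bullet> y)"
      using ee(2) y(2) m_def
      by (simp add: add scale inner_add_left inner_add_right inner_commute[of e y] algebra_simps power2_eq_square)
  qed
  let ?y = "A e - m *\<^sub>R e"
  have "?y \<in> V" using ee V by (intro subspace_diff subspace_scale) auto
  moreover have ye: "?y \<bullet> e = 0" using ee(2) by (simp add: inner_diff_left m_def)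
  ultimately have "A e \<bullet> ?y = 0" by (rule orth)
  then have "?y \<bullet> ?y = 0" using ye by (simp add: inner_diff_left inner_commute)
  then have "A e = m *\<^sub>R e" by simp
  then show ?thesis using that[of e] e(1) m_def by simp
qed

text \<open>The vectors of V orthogonal to an eigenvector form a smaller invariant subspace. The
  statement for arbitrary invariant subspaces is what the induction on the dimension
  requires.\<close>

lemma selfadjoint_eigenbasis:
  fixes A :: "'a::euclidean_space \<Rightarrow> 'a"
  assumes A: "linear A" and adj: "\<And>x y. A x \<bullet> y = x \<bullet> A y"
  shows "subspace V \<Longrightarrow> A ` V \<subseteq> V \<Longrightarrow>
    \<exists>B. pairwise orthogonal B \<and> (\<forall>e\<in>B. norm e = 1 \<and> A e = (A e \<bullet> e) *\<^sub>R e) \<and> span B = V"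
proof (induction "dim V" arbitrary: V rule: less_induct)
  case less
  show ?case
  proof (cases "V = {0}")
    case True
    then show ?thesis by (intro exI[of _ "{}"]) auto
  next
    case False
    obtain e where e: "e \<in> V" "norm e = 1" "A e = (A e \<bullet> e) *\<^sub>R e"
      using selfadjoint_eigenvector[OF A adj less.prems False] .
    have ee: "e \<bullet> e = 1" using e(2) by (simp add: norm_eq_1)
    define V' where "V' = {v \<in> V. v \<bullet> e = 0}"
    have sub: "subspace V'"
      using less.prems(1) unfolding V'_def subspace_def by (simp add: inner_add_left)
    have inv: "A ` V' \<subseteq> V'"
    proof -
      have "A v \<bullet> e = 0" if "v \<bullet> e = 0" for v
        unfolding adj using that by (subst e(3)) simp
      then show ?thesis using less.prems(2) unfolding V'_def by auto
    qed
    have "e \<notin> V'" using ee unfolding V'_def by simp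
    then have "V' \<subset> V" using e(1) unfolding V'_def by blast
    then have "dim V' < dim V"
      using less.prems(1) sub by (intro dim_psubset) (simp add: span_eq_iff[THEN iffD2])
    from less.hyps[OF this sub inv] obtain B where B: "pairwise orthogonal B"
      "\<forall>e\<in>B. norm e = 1 \<and> A e = (A e \<bullet> e) *\<^sub>R e" "span B = V'" by blast
    have "B \<subseteq> V'" using B(3) span_superset by blast
    then have "pairwise orthogonal (insert e B)"
      using B(1) unfolding V'_def by (auto simp: pairwise_insert orthogonal_def inner_commute)
    moreover have "span (insert e B) = V"
    proof
      show "span (insert e B) \<subseteq> V"
        using e(1) \<open>B \<subseteq> V'\<close> less.prems(1) unfolding V'_def by (intro span_minimal) auto
      show "V \<subseteq> span (insert e B)"
      proof
        fix v assume "v \<in> V"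
        then have "v - (v \<bullet> e) *\<^sub>R e \<in> V'"
          using e(1) ee less.prems(1) unfolding V'_def
          by (simp add: subspace_diff subspace_scale inner_diff_left)
        then show "v \<in> span (insert e B)" unfolding span_insert B(3) by blast
      qed
    qed
    ultimately show ?thesis using e B(2) by (intro exI[of _ "insert e B"]) auto
  qed
qed

text \<open>In an orthonormal eigenbasis, each eigenspace is spanned by the basis vectors with that
  eigenvalue. The weighted sum is thus the sum of squared eigenvalues over the basis, that is, the
  squared Hilbert-Schmidt norm, which every orthonormal basis computes.\<close>

lemma sum_eigenvalues_sq:
  fixes A :: "'a::euclidean_space \<Rightarrow> 'a"
  assumes A: "linear A" and adj: "\<And>x y. A x \<bullet> y = x \<bullet> A y"
  shows "finite {\<kappa>. \<exists>w. A w = \<kappa> *\<^sub>R w \<and> w \<noteq> 0}"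
    and "(\<Sum>\<kappa> | \<exists>w. A w = \<kappa> *\<^sub>R w \<and> w \<noteq> 0. real (dim {w. A w = \<kappa> *\<^sub>R w}) * \<kappa>\<^sup>2) = (\<Sum>b\<in>Basis. (norm (A b))\<^sup>2)"
proof -
  interpret linear A by (rule A)
  obtain B where B: "pairwise orthogonal B" "\<And>e. e \<in> B \<Longrightarrow> norm e = 1"
    "\<And>e. e \<in> B \<Longrightarrow> A e = (A e \<bullet> e) *\<^sub>R e" "span B = UNIV"
    using selfadjoint_eigenbasis[OF A adj subspace_UNIV] by auto
  have ind: "independent B"
    using B(2)[of 0] by (intro pairwise_orthogonal_independent B(1)) auto
  have fin: "finite B" using ind by (rule independent_imp_finite)
  define ev where "ev e = A e \<bullet> e" for e
  have A_ev: "A e = ev e *\<^sub>R e" if "e \<in> B" for e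
    unfolding ev_def by (rule B(3)[OF that])
  have expand: "(\<Sum>e\<in>B. (w \<bullet> e) *\<^sub>R e) = w" for w
    by (rule orthonormal_basis_expand[OF B(1,2) _ fin]) (auto simp: B(4))
  have parseval: "(norm w)\<^sup>2 = (\<Sum>e\<in>B. (w \<bullet> e)\<^sup>2)" for w
  proof -
    have "w \<bullet> w = w \<bullet> (\<Sum>e\<in>B. (w \<bullet> e) *\<^sub>R e)" by (simp add: expand)
    then show ?thesis
      unfolding power2_norm_eq_inner by (simp only: inner_sum_right inner_scaleR_right power2_eq_square)
  qed
  have coord: "w \<bullet> e = 0" if "A w = \<kappa> *\<^sub>R w" "e \<in> B" "ev e \<noteq> \<kappa>" for w e \<kappa>
  proof -
    have "\<kappa> * (w \<bullet> e) = ev e * (w \<bullet> e)"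
      using adj[of w e] that(1) A_ev[OF that(2)] by simp
    then show ?thesis using that(3) by simp
  qed
  have space: "{w. A w = \<kappa> *\<^sub>R w} = span {e \<in> B. ev e = \<kappa>}" for \<kappa>
  proof
    show "{w. A w = \<kappa> *\<^sub>R w} \<subseteq> span {e \<in> B. ev e = \<kappa>}"
    proof
      fix w assume "w \<in> {w. A w = \<kappa> *\<^sub>R w}"
      then have w: "A w = \<kappa> *\<^sub>R w" by simp
      have "(\<Sum>e\<in>B. (w \<bullet> e) *\<^sub>R e) \<in> span {e \<in> B. ev e = \<kappa>}"
      proof (rule span_sum)
        show "(w \<bullet> e) *\<^sub>R e \<in> span {e \<in> B. ev e = \<kappa>}" if e: "e \<in> B" for e
          by (cases "ev e = \<kappa>") (use e coord[OF w e] in \<open>auto intro: span_scale span_base span_zero\<close>)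
      qed
      then show "w \<in> span {e \<in> B. ev e = \<kappa>}" by (simp add: expand)
    qed
    have "subspace {w. A w = \<kappa> *\<^sub>R w}"
      unfolding subspace_def by (simp add: add scale zero scaleR_add_right scaleR_left_commute)
    then show "span {e \<in> B. ev e = \<kappa>} \<subseteq> {w. A w = \<kappa> *\<^sub>R w}"
      using A_ev by (intro span_minimal) auto
  qed
  have dim: "dim {w. A w = \<kappa> *\<^sub>R w} = card {e \<in> B. ev e = \<kappa>}" for \<kappa>
    unfolding space by (intro dim_span_eq_card_independent independent_mono[OF ind]) auto
  have eigs: "{\<kappa>. \<exists>w. A w = \<kappa> *\<^sub>R w \<and> w \<noteq> 0} = ev ` B"
  proof (intro equalityI subsetI)
    fix \<kappa> assume "\<kappa> \<in> {\<kappa>. \<exists>w. A w = \<kappa> *\<^sub>R w \<and> w \<noteq> 0}"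
    then obtain w where w: "A w = \<kappa> *\<^sub>R w" "w \<noteq> 0" by blast
    then have "(norm w)\<^sup>2 \<noteq> 0" by simp
    then have "(\<Sum>e\<in>B. (w \<bullet> e)\<^sup>2) \<noteq> 0" unfolding parseval .
    then obtain e where "e \<in> B" "w \<bullet> e \<noteq> 0"
      by (rule sum.not_neutral_contains_not_neutral) simp
    then show "\<kappa> \<in> ev ` B" using coord[OF w(1)] by blast
  next
    fix \<kappa> assume "\<kappa> \<in> ev ` B"
    then obtain e where "e \<in> B" "\<kappa> = ev e" by blast
    then show "\<kappa> \<in> {\<kappa>. \<exists>w. A w = \<kappa> *\<^sub>R w \<and> w \<noteq> 0}" using A_ev B(2)[of e] by fastforce
  qed
  show "finite {\<kappa>. \<exists>w. A w = \<kappa> *\<^sub>R w \<and> w \<noteq> 0}" unfolding eigs using fin by simp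
  have "(\<Sum>\<kappa>\<in>ev ` B. real (dim {w. A w = \<kappa> *\<^sub>R w}) * \<kappa>\<^sup>2) = (\<Sum>\<kappa>\<in>ev ` B. \<Sum>e\<in>{e \<in> B. ev e = \<kappa>}. (ev e)\<^sup>2)"
    by (simp add: dim)
  also have "\<dots> = (\<Sum>e\<in>B. (ev e)\<^sup>2)"
    by (rule sum.image_gen[OF fin, symmetric])
  also have "\<dots> = (\<Sum>e\<in>B. (norm (A e))\<^sup>2)"
    by (intro sum.cong refl) (simp add: A_ev B(2) power_mult_distrib)
  also have "\<dots> = (\<Sum>e\<in>B. \<Sum>b\<in>Basis. (A e \<bullet> b)\<^sup>2)"
    unfolding power2_norm_eq_inner by (subst euclidean_inner) (simp add: power2_eq_square)
  \<comment> \<open>By self-adjointness the entries can be read with the roles of the two bases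
    exchanged; Parseval in the eigenbasis then finishes.\<close>
  also have "\<dots> = (\<Sum>b\<in>Basis. \<Sum>e\<in>B. (A b \<bullet> e)\<^sup>2)"
    by (subst sum.swap) (intro sum.cong refl, metis adj inner_commute)
  also have "\<dots> = (\<Sum>b\<in>Basis. (norm (A b))\<^sup>2)"
    by (simp add: parseval)
  finally show "(\<Sum>\<kappa> | \<exists>w. A w = \<kappa> *\<^sub>R w \<and> w \<noteq> 0. real (dim {w. A w = \<kappa> *\<^sub>R w}) * \<kappa>\<^sup>2) =
      (\<Sum>b\<in>Basis. (norm (A b))\<^sup>2)"
    unfolding eigs .
qed

text \<open>
  The map \<open>N\<close> is the differential of a unit normal \<open>\<nu>\<close>. It is self-adjoint on the tangent space
  \<open>\<nu>\<^sup>\<bottom>\<close>, and composing it with the projection onto that space only adds the eigenvalue \<open>0\<close>.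
\<close>

lemma sum_tangential_eigenvalues_sq:
  fixes N :: "'a::euclidean_space \<Rightarrow> 'a"
  assumes N: "linear N" and \<nu>: "norm \<nu> = 1" and normal: "\<And>w. N w \<bullet> \<nu> = 0"
    and adj: "\<And>v w. v \<bullet> \<nu> = 0 \<Longrightarrow> w \<bullet> \<nu> = 0 \<Longrightarrow> N v \<bullet> w = v \<bullet> N w"
    and C: "\<And>\<kappa>. C \<kappa> = {w. w \<bullet> \<nu> = 0 \<and> N w = \<kappa> *\<^sub>R w}"
  shows "(\<Sum>\<kappa> | \<exists>w\<in>C \<kappa>. w \<noteq> 0. real (dim (C \<kappa>)) * \<kappa>\<^sup>2) =
    (\<Sum>b\<in>Basis. (norm (N (b - (b \<bullet> \<nu>) *\<^sub>R \<nu>)))\<^sup>2)"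
proof -
  interpret linear N by (rule N)
  define P where "P w = w - (w \<bullet> \<nu>) *\<^sub>R \<nu>" for w
  define A where "A w = N (P w)" for w
  have \<nu>\<nu>: "\<nu> \<bullet> \<nu> = 1" using \<nu> by (simp add: norm_eq_1)
  have P\<nu>: "P w \<bullet> \<nu> = 0" for w by (simp add: P_def inner_diff_left \<nu>\<nu>)
  have "linear P"
    unfolding P_def by (intro linearI) (simp_all add: inner_add_left algebra_simps)
  then have lin: "linear A" unfolding A_def using linear_compose[OF _ N, of P] by (simp add: o_def)
  have NP: "N v \<bullet> P w = N v \<bullet> w" for v w
    by (simp add: P_def inner_diff_right normal)
  have A_adj: "A v \<bullet> w = v \<bullet> A w" for v w
    using adj[OF P\<nu> P\<nu>, of v w] NP[of "P v" w] NP[of "P w" v] by (simp add: A_def inner_commute)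
  \<comment> \<open>For \<kappa> \<noteq> 0 an eigenvector of A lies in the range of N and is
    therefore orthogonal to \<nu>. At \<kappa> = 0 the two spaces differ by \<nu> itself, but there
    the weight \<open>\<kappa>\<^sup>2\<close> vanishes.\<close>
  have nz: "C \<kappa> = {w. A w = \<kappa> *\<^sub>R w}" if "\<kappa> \<noteq> 0" for \<kappa>
  proof (intro equalityI subsetI)
    fix w assume "w \<in> C \<kappa>"
    then show "w \<in> {w. A w = \<kappa> *\<^sub>R w}" by (simp add: C A_def P_def)
  next
    fix w assume "w \<in> {w. A w = \<kappa> *\<^sub>R w}"
    then have w: "A w = \<kappa> *\<^sub>R w" by simp
    then have "\<kappa> * (w \<bullet> \<nu>) = 0" using normal[of "P w"] by (simp add: A_def)
    then have "w \<bullet> \<nu> = 0" using that by simp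
    then show "w \<in> C \<kappa>" using w by (simp add: C A_def P_def)
  qed
  let ?K = "{\<kappa>. \<exists>w\<in>C \<kappa>. w \<noteq> 0}" and ?E = "{\<kappa>. \<exists>w. A w = \<kappa> *\<^sub>R w \<and> w \<noteq> 0}"
  have fE: "finite ?E" by (rule sum_eigenvalues_sq(1)[OF lin A_adj])
  have eq: "?K - {0} = ?E - {0}" using nz by auto
  have fK: "finite ?K" using finite_Diff[OF fE, of "{0}"] unfolding eq[symmetric] by simp
  have "(\<Sum>\<kappa>\<in>?K. real (dim (C \<kappa>)) * \<kappa>\<^sup>2) = (\<Sum>\<kappa>\<in>?K - {0}. real (dim (C \<kappa>)) * \<kappa>\<^sup>2)"
    by (rule sum.mono_neutral_right[OF fK]) auto
  also have "\<dots> = (\<Sum>\<kappa>\<in>?E - {0}. real (dim {w. A w = \<kappa> *\<^sub>R w}) * \<kappa>\<^sup>2)"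
    unfolding eq by (intro sum.cong refl) (simp add: nz)
  also have "\<dots> = (\<Sum>\<kappa>\<in>?E. real (dim {w. A w = \<kappa> *\<^sub>R w}) * \<kappa>\<^sup>2)"
    by (rule sum.mono_neutral_left[OF fE]) auto
  also have "\<dots> = (\<Sum>b\<in>Basis. (norm (A b))\<^sup>2)"
    by (rule sum_eigenvalues_sq(2)[OF lin A_adj])
  finally show ?thesis by (simp add: A_def P_def)
qed

section \<open>Geometry of the graph\<close>

lemma sum_Basis_prod_real:
  fixes f :: "'a::euclidean_space \<times> real \<Rightarrow> 'b::comm_monoid_add"
  shows "(\<Sum>b\<in>Basis. f b) = (\<Sum>b\<in>Basis. f (b, 0)) + f (0, 1)"
  unfolding Basis_prod_def
  by (subst sum.union_disjoint) (auto simp: sum.reindex inj_on_def)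

text \<open>The differential of the unit normal (- grad u, 1) / W, with D the Hessian of u, p = grad
  u and w = W. The terms with \<open>w ^ 3\<close> come from differentiating 1 / W. Only
  \<open>fst v\<close> enters, as the normal does not depend on the height.\<close>

definition graph_weingarten ::
  "('a::euclidean_space \<Rightarrow> 'a) \<Rightarrow> 'a \<Rightarrow> real \<Rightarrow> 'a \<times> real \<Rightarrow> 'a \<times> real" where
  "graph_weingarten D p w v =
     (((D p \<bullet> fst v) / w ^ 3) *\<^sub>R p - (1 / w) *\<^sub>R D (fst v), - ((D p \<bullet> fst v) / w ^ 3))"

lemma linear_graph_weingarten:
  assumes "linear D"
  shows "linear (graph_weingarten D p w)"
proof -
  interpret linear D by (rule assms)
  show ?thesis
    by (intro linearI)
      (simp_all add: graph_weingarten_def add scale inner_add_right add_divide_distrib algebra_simps)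
qed

lemma graph_weingarten_normal:
  fixes D :: "'a::euclidean_space \<Rightarrow> 'a"
  assumes adj: "\<And>h k. D h \<bullet> k = h \<bullet> D k" and w: "0 < w" "w\<^sup>2 = 1 + p \<bullet> p"
  shows "graph_weingarten D p w v \<bullet> ((1 / w) *\<^sub>R (- p, 1)) = 0"
proof -
  let ?a = "D p \<bullet> fst v"
  have "D (fst v) \<bullet> p = ?a" using adj[of "fst v" p] by (simp add: inner_commute)
  then have "graph_weingarten D p w v \<bullet> ((1 / w) *\<^sub>R (- p, 1)) =
      (?a / w - ?a / w ^ 3 * (1 + p \<bullet> p)) / w"
    by (simp add: graph_weingarten_def inner_diff_left inner_Pair add_divide_distrib diff_divide_distrib algebra_simps)
  also have "\<dots> = 0"
    using w(1) unfolding w(2)[symmetric] by (simp add: power2_eq_square power3_eq_cube)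
  finally show ?thesis .
qed

text \<open>Between tangent vectors the terms with \<open>w ^ 3\<close> cancel, and what is left is
  - 1 / w times the Hessian form: the second fundamental form of the graph.\<close>

lemma graph_weingarten_selfadjoint:
  fixes D :: "'a::euclidean_space \<Rightarrow> 'a"
  assumes adj: "\<And>h k. D h \<bullet> k = h \<bullet> D k"
    and v: "snd v = p \<bullet> fst v" and v': "snd v' = p \<bullet> fst v'"
  shows "graph_weingarten D p w v \<bullet> v' = v \<bullet> graph_weingarten D p w v'"
proof -
  have "graph_weingarten D p w v \<bullet> v' = - (D (fst v) \<bullet> fst v') / w"
    using v' by (simp add: graph_weingarten_def inner_prod_def inner_diff_left)
  moreover have "v \<bullet> graph_weingarten D p w v' = - (fst v \<bullet> D (fst v')) / w"
    using v by (simp add: graph_weingarten_def inner_prod_def inner_diff_right inner_commute)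
  ultimately show ?thesis by (simp add: adj)
qed

text \<open>With h = \<open>fst v\<close>, the squared norm of the image of v times
  \<open>w\<^sup>2\<close> is |D h|^2 - (D p \<bullet> h)^2 / w^2. This is summed over the
  horizontal parts of the projected basis vectors.\<close>

lemma sum_graph_weingarten_sq:
  fixes D :: "'a::euclidean_space \<Rightarrow> 'a"
  assumes D: "linear D" and adj: "\<And>h k. D h \<bullet> k = h \<bullet> D k" and w: "0 < w" "w\<^sup>2 = 1 + p \<bullet> p"
  defines "\<nu> \<equiv> (1 / w) *\<^sub>R (- p, 1)"
  shows "(\<Sum>b\<in>Basis. (norm (graph_weingarten D p w (b - (b \<bullet> \<nu>) *\<^sub>R \<nu>)))\<^sup>2) * w\<^sup>2 =
    (\<Sum>b\<in>Basis. (norm (D b))\<^sup>2) - 2 * (D p \<bullet> D p) / w\<^sup>2 + (D p \<bullet> p)\<^sup>2 / w ^ 4"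
proof -
  interpret linear D by (rule D)
  let ?q = "D p"
  define n where "n h = (D h \<bullet> D h) - (?q \<bullet> h)\<^sup>2 / w\<^sup>2" for h
  have norm_N: "(norm (graph_weingarten D p w v))\<^sup>2 * w\<^sup>2 = n (fst v)" for v
  proof -
    let ?a = "?q \<bullet> fst v"
    have Dp: "D (fst v) \<bullet> p = ?a" "p \<bullet> D (fst v) = ?a"
      using adj[of "fst v" p] by (simp_all add: inner_commute)
    have "(norm (graph_weingarten D p w v))\<^sup>2 =
        (?a / w ^ 3)\<^sup>2 * (1 + p \<bullet> p) - 2 * (?a / w ^ 3) * (?a / w) + (D (fst v) \<bullet> D (fst v)) / w\<^sup>2"
      unfolding power2_norm_eq_inner
      by (simp add: graph_weingarten_def inner_prod_def inner_diff_left inner_diff_right Dp algebra_simps add_divide_distrib power2_eq_square)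
    also have "\<dots> * w\<^sup>2 = n (fst v)"
      using w(1) unfolding w(2)[symmetric] n_def by (simp add: field_simps power2_eq_square power3_eq_cube)
    finally show ?thesis .
  qed
  define c where "c b = (p \<bullet> b) / w\<^sup>2" for b
  have proj: "fst ((b, 0) - ((b, 0) \<bullet> \<nu>) *\<^sub>R \<nu>) = b - c b *\<^sub>R p"
    "fst ((0, 1) - ((0, 1) \<bullet> \<nu>) *\<^sub>R \<nu>) = (1 / w\<^sup>2) *\<^sub>R p" for b
    by (simp_all add: \<nu>_def c_def inner_Pair power2_eq_square inner_commute)
  have "(\<Sum>b\<in>Basis. (norm (graph_weingarten D p w (b - (b \<bullet> \<nu>) *\<^sub>R \<nu>)))\<^sup>2) * w\<^sup>2 =
      (\<Sum>b\<in>Basis. n (b - c b *\<^sub>R p)) + n ((1 / w\<^sup>2) *\<^sub>R p)"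
    by (simp only: sum_Basis_prod_real distrib_right sum_distrib_right norm_N proj)
  also have "(\<Sum>b\<in>Basis. n (b - c b *\<^sub>R p)) =
      (\<Sum>b\<in>Basis. D b \<bullet> D b) - 2 * (\<Sum>b\<in>Basis. c b * (D b \<bullet> ?q)) + (\<Sum>b\<in>Basis. (c b)\<^sup>2) * (?q \<bullet> ?q)
      - ((\<Sum>b\<in>Basis. (?q \<bullet> b)\<^sup>2) - 2 * (?q \<bullet> p) * (\<Sum>b\<in>Basis. c b * (?q \<bullet> b)) + (\<Sum>b\<in>Basis. (c b)\<^sup>2) * (?q \<bullet> p)\<^sup>2) / w\<^sup>2"
  proof -
    have "n (b - c b *\<^sub>R p) = (D b \<bullet> D b) - 2 * (c b * (D b \<bullet> ?q)) + (c b)\<^sup>2 * (?q \<bullet> ?q)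
      - ((?q \<bullet> b)\<^sup>2 - 2 * (?q \<bullet> p) * (c b * (?q \<bullet> b)) + (c b)\<^sup>2 * (?q \<bullet> p)\<^sup>2) / w\<^sup>2" for b
    proof -
      have "D (b - c b *\<^sub>R p) \<bullet> D (b - c b *\<^sub>R p) = (D b \<bullet> D b) - 2 * (c b * (D b \<bullet> ?q)) + (c b)\<^sup>2 * (?q \<bullet> ?q)"
        by (simp add: diff scale inner_diff_left inner_diff_right inner_commute power2_eq_square algebra_simps)
      moreover have "(?q \<bullet> (b - c b *\<^sub>R p))\<^sup>2 = (?q \<bullet> b)\<^sup>2 - 2 * (?q \<bullet> p) * (c b * (?q \<bullet> b)) + (c b)\<^sup>2 * (?q \<bullet> p)\<^sup>2"
        by (simp add: inner_diff_right power2_eq_square algebra_simps)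
      ultimately show ?thesis by (simp add: n_def)
    qed
    then show ?thesis
      by (simp only: sum.distrib sum_subtractf sum_distrib_left[symmetric] sum_distrib_right[symmetric] sum_divide_distrib[symmetric])
  qed
  also have "(\<Sum>b\<in>Basis. c b * (D b \<bullet> ?q)) = (?q \<bullet> ?q) / w\<^sup>2"
    unfolding c_def adj[of _ ?q] by (subst (3) euclidean_inner)
      (simp add: adj[of p "D p"] euclidean_inner[of p] sum_divide_distrib inner_commute)
  also have "(\<Sum>b\<in>Basis. (c b)\<^sup>2) = (p \<bullet> p) / w ^ 4"
    unfolding c_def euclidean_inner[of p p]
    by (simp add: sum_divide_distrib power2_eq_square power4_eq_xxxx mult.assoc)
  also have "(\<Sum>b\<in>Basis. (?q \<bullet> b)\<^sup>2) = ?q \<bullet> ?q"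
    by (subst (2) euclidean_inner) (simp add: power2_eq_square)
  also have "(\<Sum>b\<in>Basis. c b * (?q \<bullet> b)) = (?q \<bullet> p) / w\<^sup>2"
    unfolding c_def by (subst (2) euclidean_inner) (simp add: sum_divide_distrib mult.commute)
  also have "n ((1 / w\<^sup>2) *\<^sub>R p) = (?q \<bullet> ?q) / w ^ 4 - (?q \<bullet> p)\<^sup>2 / w ^ 6"
    by (simp add: n_def scale power2_eq_square power4_eq_xxxx eval_nat_numeral)
  finally have eq: "(\<Sum>b\<in>Basis. (norm (graph_weingarten D p w (b - (b \<bullet> \<nu>) *\<^sub>R \<nu>)))\<^sup>2) * w\<^sup>2 =
    (\<Sum>b\<in>Basis. D b \<bullet> D b) - 2 * ((?q \<bullet> ?q) / w\<^sup>2) + (p \<bullet> p) / w ^ 4 * (?q \<bullet> ?q)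
      - (?q \<bullet> ?q - 2 * (?q \<bullet> p) * ((?q \<bullet> p) / w\<^sup>2) + (p \<bullet> p) / w ^ 4 * (?q \<bullet> p)\<^sup>2) / w\<^sup>2
      + ((?q \<bullet> ?q) / w ^ 4 - (?q \<bullet> p)\<^sup>2 / w ^ 6)" .
  \<comment> \<open>The quantities left are linked only by
    \<open>w\<^sup>2 = 1 + p \<bullet> p\<close>; for abstract real numbers the rest is field
    arithmetic.\<close>
  have "S - 2 * (X / w\<^sup>2) + g / w ^ 4 * X - (X - 2 * s * (s / w\<^sup>2) + g / w ^ 4 * s\<^sup>2) / w\<^sup>2
      + (X / w ^ 4 - s\<^sup>2 / w ^ 6) = S - 2 * X / w\<^sup>2 + s\<^sup>2 / w ^ 4" if "w\<^sup>2 = 1 + g" for S X s g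
  proof -
    have g: "g = w\<^sup>2 - 1" using that by simp
    show ?thesis
      unfolding g using w(1) by (simp add: divide_simps) (simp add: algebra_simps eval_nat_numeral)
  qed
  from this[OF w(2)] show ?thesis
    unfolding eq by (simp add: power2_norm_eq_inner)
qed

section \<open>Functions on the product space, and the curvature identity for graphs\<close>

lemma partial_deriv_comp_fst:
  fixes g :: "'a::euclidean_space \<Rightarrow> real" and p :: "'a \<times> real"
  shows "partial_deriv (b, 0) (\<lambda>p. g (fst p)) p = partial_deriv b g (fst p)"
    and "partial_deriv (0, c) (\<lambda>p. g (fst p)) p = 0"
  by (simp_all add: partial_deriv_def)

lemma grad_comp_fst:
  fixes g :: "'a::euclidean_space \<Rightarrow> real" and p :: "'a \<times> real"
  shows "grad (\<lambda>p. g (fst p)) p = (grad g (fst p), 0)"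
  unfolding grad_def sum_Basis_prod_real
  by (simp add: partial_deriv_comp_fst sum_prod prod_eq_iff fst_sum snd_sum)

text \<open>Both sides apply \<open>deriv\<close> to the same functions of t, so the equality holds
  for arbitrary g, default values included.\<close>

lemma laplacian_comp_fst:
  fixes g :: "'a::euclidean_space \<Rightarrow> real" and p :: "'a \<times> real"
  shows "laplacian (\<lambda>p. g (fst p)) p = laplacian g (fst p)"
proof -
  have "partial_deriv (b, 0) (\<lambda>p :: 'a \<times> real. g (fst p)) = (\<lambda>p. partial_deriv b g (fst p))"
    for b :: 'a and g
    by (intro ext partial_deriv_comp_fst)
  moreover have "partial_deriv (0, c) (\<lambda>p :: 'a \<times> real. g (fst p)) = (\<lambda>p. 0)" for c and g :: "'a \<Rightarrow> real"
    by (intro ext partial_deriv_comp_fst)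
  moreover have "partial_deriv c (\<lambda>p :: 'a \<times> real. 0) p = 0" for c
    by (simp add: partial_deriv_def)
  ultimately show ?thesis
    unfolding laplacian_def sum_Basis_prod_real by simp
qed

lemma grad_cong:
  fixes f g :: "'a::euclidean_space \<Rightarrow> real"
  assumes "open S" "x \<in> S" "\<And>y. y \<in> S \<Longrightarrow> f y = g y"
  shows "grad f x = grad g x"
  unfolding grad_def by (intro sum.cong refl arg_cong2[where f=scaleR] partial_deriv_cong[OF assms])

lemma laplacian_cong:
  fixes f g :: "'a::euclidean_space \<Rightarrow> real"
  assumes "open S" "x \<in> S" "\<And>y. y \<in> S \<Longrightarrow> f y = g y"
  shows "laplacian f x = laplacian g x"
  unfolding laplacian_def
  by (intro sum.cong refl partial_deriv_cong[OF assms(1,2)] partial_deriv_cong[OF assms(1) _ assms(3)])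

lemma partial_deriv_graph_fun:
  fixes u :: "'a::euclidean_space \<Rightarrow> real"
  shows "((\<lambda>t. u (fst p + t *\<^sub>R b)) has_real_derivative D) (at 0) \<Longrightarrow>
      partial_deriv (b, 0) (graph_fun u) p = partial_deriv b u (fst p)"
    and "partial_deriv (0, 1) (graph_fun u) p = - 1"
proof -
  show "partial_deriv (b, 0) (graph_fun u) p = partial_deriv b u (fst p)"
    if "((\<lambda>t. u (fst p + t *\<^sub>R b)) has_real_derivative D) (at 0)"
  proof -
    have "((\<lambda>t. graph_fun u (p + t *\<^sub>R (b, 0))) has_real_derivative D) (at 0)"
      using DERIV_diff[OF that DERIV_const[of "snd p"]] by (simp add: graph_fun_def case_prod_beta)
    then show ?thesis using that by (simp add: partial_derivI)
  qed
  have "((\<lambda>t. u (fst p) - (snd p + t)) has_real_derivative - 1) (at 0)"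
    by (auto intro!: derivative_eq_intros)
  then show "partial_deriv (0, 1) (graph_fun u) p = - 1"
    by (intro partial_derivI) (simp add: graph_fun_def case_prod_beta)
qed

lemma graph_fun_derivatives:
  fixes u :: "'a::euclidean_space \<Rightarrow> real"
  assumes \<Omega>: "open \<Omega>" and u: "cont_diff (Suc k) \<Omega> \<Omega> u" and x: "x \<in> \<Omega>"
  shows "grad (graph_fun u) (x, s) = (grad u x, - 1)"
    and "laplacian (graph_fun u) (x, s) = laplacian u x"
proof -
  have b: "partial_deriv (b, 0) (graph_fun u) p = partial_deriv b u (fst p)"
    if "b \<in> Basis" "p \<in> \<Omega> \<times> UNIV" for b and p :: "'a \<times> real"
    using partial_deriv_graph_fun(1)[OF cont_diff_SucD(2)[OF \<Omega> u that(1)], of p] that(2) by auto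
  show "grad (graph_fun u) (x, s) = (grad u x, - 1)"
    unfolding grad_def sum_Basis_prod_real using x
    by (simp add: b partial_deriv_graph_fun(2) sum_prod prod_eq_iff fst_sum snd_sum)
  have op: "open (\<Omega> \<times> (UNIV :: real set))" using \<Omega> by (simp add: open_Times)
  have "partial_deriv (b, 0) (partial_deriv (b, 0) (graph_fun u)) (x, s) = partial_deriv b (partial_deriv b u) x"
    if "b \<in> Basis" for b
    using partial_deriv_cong[where b="(b, 0)", OF op _ b[OF that], of "(x, s)"] x by (simp add: partial_deriv_comp_fst)
  moreover have "partial_deriv (0, 1) (partial_deriv (0, 1) (graph_fun u)) (x, s) = 0"
    unfolding partial_deriv_graph_fun(2)[abs_def] by (simp add: partial_deriv_def)
  ultimately show "laplacian (graph_fun u) (x, s) = laplacian u x"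
    unfolding laplacian_def sum_Basis_prod_real by simp
qed

text \<open>The part common to both cases. As W times the b-derivative of W is
  \<open>grad (partial_deriv b u) \<bullet> grad u\<close>, the second derivatives of W exist as
  soon as the derivatives \<open>q b\<close> of these products do; the two cases differ only in how
  the sum of the \<open>q b\<close> is found.\<close>

lemma graph_laplacian_norm_grad:
  fixes u :: "'a::euclidean_space \<Rightarrow> real"
  assumes \<Omega>: "open \<Omega>" and u: "cont_diff 2 \<Omega> \<Omega> u" and x: "x \<in> \<Omega>"
    and q: "\<And>b. b \<in> Basis \<Longrightarrow> ((\<lambda>t. grad (partial_deriv b u) (x + t *\<^sub>R b) \<bullet> grad u (x + t *\<^sub>R b))
      has_real_derivative q b) (at 0)"
  shows "laplacian (norm_grad u) (x, s) * norm_grad u (x, s) =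
      (\<Sum>b\<in>Basis. q b) - (\<Sum>b\<in>Basis. (norm (grad (partial_deriv b u) x))\<^sup>2)
      + second_form_sq u x * (norm_grad u (x, s))\<^sup>2
      + (norm (tangential_grad u (norm_grad u) (x, s)))\<^sup>2"
    and "(norm_grad u (x, s))\<^sup>2 = 1 + (norm (grad u x))\<^sup>2"
    and "unit_normal u (x, s) = (1 / norm_grad u (x, s)) *\<^sub>R (- grad u x, 1)"
    and "norm_grad u (x, s) > 0"
proof -
  have u2: "cont_diff (Suc (Suc 0)) \<Omega> \<Omega> u" using u by (simp add: numeral_2_eq_2)
  define G where "G = grad u"
  define H where "H b = grad (partial_deriv b u)" for b
  note dG = cont_diff_grad(2)[OF \<Omega> u2, folded G_def]
  have dH: "GDERIV (\<lambda>y. G y \<bullet> b) y :> H b y" if "b \<in> Basis" "y \<in> \<Omega>" for b y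
    unfolding G_def H_def by (rule cont_diff_hessian(2)[OF \<Omega> u2 that])
  have cH: "continuous_on \<Omega> (H b)" if "b \<in> Basis" for b
    unfolding H_def by (rule cont_diff_hessian(1)[OF \<Omega> u2 that])
  have sym: "H b y \<bullet> c = H c y \<bullet> b" if "b \<in> Basis" "c \<in> Basis" "y \<in> \<Omega>" for b c y
    by (rule hessian_symmetric[OF \<Omega> that(3) dG dH cH that(1,2)])
  define W where "W y = sqrt (1 + (norm (G y))\<^sup>2)" for y
  have W: "0 < W y" "(W y)\<^sup>2 = 1 + G y \<bullet> G y" for y
    unfolding W_def by (simp_all add: add_pos_nonneg power2_norm_eq_inner)
  have op: "open (\<Omega> \<times> (UNIV :: real set))" using \<Omega> by (simp add: open_Times)
  have grad_graph: "grad (graph_fun u) p = (G (fst p), - 1)" if "p \<in> \<Omega> \<times> UNIV" for p :: "'a \<times> real"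
    using graph_fun_derivatives(1)[OF \<Omega> u2, of "fst p" "snd p"] that by (auto simp: G_def)
  have ng: "norm_grad u p = W (fst p)" if "p \<in> \<Omega> \<times> UNIV" for p :: "'a \<times> real"
    unfolding norm_grad_def grad_graph[OF that] by (simp add: norm_Pair W_def add.commute)
  have un: "unit_normal u p = (1 / W (fst p)) *\<^sub>R (- G (fst p), 1)" if "p \<in> \<Omega> \<times> UNIV" for p :: "'a \<times> real"
    unfolding unit_normal_def ng[OF that] grad_graph[OF that] by (simp add: divide_inverse)
  have xs: "(x, r) \<in> \<Omega> \<times> UNIV" for r :: real using x by simp
  show "(norm_grad u (x, s))\<^sup>2 = 1 + (norm (grad u x))\<^sup>2"
    using W(2)[of x] ng[OF xs] by (simp add: G_def power2_norm_eq_inner)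
  show "unit_normal u (x, s) = (1 / norm_grad u (x, s)) *\<^sub>R (- grad u x, 1)"
    using un[OF xs] ng[OF xs] by (simp add: G_def)
  show "norm_grad u (x, s) > 0"
    using W(1)[of x] ng[OF xs] by simp
  \<comment> \<open>The Hessian of u applied to grad u, so that the gradient of W is Q / W.\<close>
  define Q where "Q y = (\<Sum>i\<in>Basis. (G y \<bullet> i) *\<^sub>R H i y)" for y
  have Q_inner: "Q y \<bullet> b = H b y \<bullet> G y" if "b \<in> Basis" "y \<in> \<Omega>" for b y
    unfolding Q_def inner_sum_left using sym[OF _ that]
    by (subst euclidean_inner[of "H b y"]) (simp add: mult.commute)
  have dW: "GDERIV W y :> (1 / W y) *\<^sub>R Q y" if y: "y \<in> \<Omega>" for y
  proof -
    have "GDERIV (\<lambda>y. \<Sum>i\<in>Basis. (G y \<bullet> i) * (G y \<bullet> i)) y :> (\<Sum>i\<in>Basis. (G y \<bullet> i) *\<^sub>R H i y + (G y \<bullet> i) *\<^sub>R H i y)"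
      unfolding gderiv_def inner_sum_right
      by (intro has_derivative_sum GDERIV_mult[OF dH dH, unfolded gderiv_def] y)
    from GDERIV_add[OF GDERIV_const[of 1] this]
    have "GDERIV (\<lambda>y. 1 + (\<Sum>i\<in>Basis. (G y \<bullet> i) * (G y \<bullet> i))) y :> 2 *\<^sub>R Q y"
      by (simp only: Q_def scaleR_sum_right scaleR_2 add_0_left)
    then have "GDERIV (\<lambda>y. 1 + (norm (G y))\<^sup>2) y :> 2 *\<^sub>R Q y"
      by (simp only: power2_norm_eq_inner euclidean_inner[symmetric])
    moreover have "(sqrt has_real_derivative inverse (W y) / 2) (at (1 + (norm (G y))\<^sup>2))"
      unfolding W_def by (intro DERIV_real_sqrt) (simp add: add_pos_nonneg)
    ultimately have "GDERIV (\<lambda>y. sqrt (1 + (norm (G y))\<^sup>2)) y :> (inverse (W y) / 2) *\<^sub>R (2 *\<^sub>R Q y)"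
      by (rule GDERIV_DERIV_compose)
    then show ?thesis
      unfolding W_def[abs_def] by (rule GDERIV_subst) (simp add: inverse_eq_divide)
  qed
  have pW: "partial_deriv b W y = (H b y \<bullet> G y) / W y" if "b \<in> Basis" "y \<in> \<Omega>" for b y
  proof -
    have "((\<lambda>t. W (y + t *\<^sub>R b)) has_real_derivative ((1 / W y) *\<^sub>R Q y) \<bullet> b) (at 0)"
      by (rule GDERIV_compose_line[of W y 0 b, simplified]) (rule dW[OF that(2)])
    then show ?thesis
      using Q_inner[OF that] by (simp add: partial_derivI)
  qed
  have ppW: "partial_deriv b (partial_deriv b W) x = q b / W x - (H b x \<bullet> G x)\<^sup>2 / W x ^ 3"
    if b: "b \<in> Basis" for b
  proof -
    have "partial_deriv b (partial_deriv b W) x = partial_deriv b (\<lambda>y. (H b y \<bullet> G y) / W y) x"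
      by (rule partial_deriv_cong[OF \<Omega> x pW[OF b]])
    also have "\<dots> = (q b * W x - (H b x \<bullet> G x) * ((H b x \<bullet> G x) / W x)) / (W x * W x)"
    proof (rule partial_derivI)
      have "((\<lambda>t. W (x + t *\<^sub>R b)) has_real_derivative (H b x \<bullet> G x) / W x) (at 0)"
        using GDERIV_compose_line[of W x 0 b "(1 / W x) *\<^sub>R Q x"] dW[OF x] Q_inner[OF b x] by simp
      from DERIV_divide[OF q[OF b, folded H_def G_def] this]
      show "((\<lambda>t. (H b (x + t *\<^sub>R b) \<bullet> G (x + t *\<^sub>R b)) / W (x + t *\<^sub>R b)) has_real_derivative
          (q b * W x - (H b x \<bullet> G x) * ((H b x \<bullet> G x) / W x)) / (W x * W x)) (at 0)"
        using W(1)[of x] by simp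
    qed
    also have "\<dots> = q b / W x - (H b x \<bullet> G x)\<^sup>2 / W x ^ 3"
      using W(1)[of x] by (simp add: field_simps power2_eq_square power3_eq_cube)
    finally show ?thesis .
  qed
  have QQ: "Q x \<bullet> Q x = (\<Sum>b\<in>Basis. (H b x \<bullet> G x)\<^sup>2)"
    by (subst euclidean_inner) (simp add: Q_inner x power2_eq_square)
  have lap: "laplacian (norm_grad u) (x, s) * W x = (\<Sum>b\<in>Basis. q b) - (Q x \<bullet> Q x) / (W x)\<^sup>2"
  proof -
    have "laplacian (norm_grad u) (x, s) = laplacian W x"
      using laplacian_cong[OF op xs ng] by (simp add: laplacian_comp_fst)
    also have "\<dots> = (\<Sum>b\<in>Basis. q b) / W x - (Q x \<bullet> Q x) / W x ^ 3"
      unfolding laplacian_def QQ by (simp add: ppW sum_subtractf sum_divide_distrib)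
    finally show ?thesis
      using W(1)[of x] by (simp add: field_simps power2_eq_square power3_eq_cube)
  qed
  have gW: "grad (norm_grad u) (x, s) = ((1 / W x) *\<^sub>R Q x, 0)"
  proof -
    have "grad (norm_grad u) (x, s) = (grad W x, 0)"
      using grad_cong[OF op xs ng] by (simp add: grad_comp_fst)
    also have "grad W x = (1 / W x) *\<^sub>R Q x"
      by (rule euclidean_eqI) (simp add: grad_inner_Basis pW x Q_inner)
    finally show ?thesis .
  qed
  let ?\<nu> = "(1 / W x) *\<^sub>R (- G x, 1) :: 'a \<times> real"
  have \<nu>\<nu>: "?\<nu> \<bullet> ?\<nu> = 1"
  proof -
    have "?\<nu> \<bullet> ?\<nu> = (1 + G x \<bullet> G x) / (W x)\<^sup>2"
      by (simp add: inner_Pair add_divide_distrib power2_eq_square)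
    also have "\<dots> = 1"
      unfolding W(2)[symmetric] using W(1)[of x] by simp
    finally show ?thesis .
  qed
  have tan: "(norm (tangential_grad u (norm_grad u) (x, s)))\<^sup>2 =
      (Q x \<bullet> Q x) / (W x)\<^sup>2 - (Q x \<bullet> G x)\<^sup>2 / W x ^ 4"
  proof -
    have nn: "unit_normal u (x, s) \<bullet> unit_normal u (x, s) = 1"
      using \<nu>\<nu> un[OF xs] by simp
    have "(norm (tangential_grad u (norm_grad u) (x, s)))\<^sup>2 =
      grad (norm_grad u) (x, s) \<bullet> grad (norm_grad u) (x, s)
        - (unit_normal u (x, s) \<bullet> grad (norm_grad u) (x, s))\<^sup>2"
      unfolding tangential_grad_def power2_norm_eq_inner
      by (simp add: inner_diff_left inner_diff_right nn inner_commute power2_eq_square)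
    also have "unit_normal u (x, s) \<bullet> grad (norm_grad u) (x, s) = - (Q x \<bullet> G x) / (W x)\<^sup>2"
      unfolding gW un[OF xs] by (simp add: inner_Pair inner_commute power2_eq_square)
    also have "grad (norm_grad u) (x, s) \<bullet> grad (norm_grad u) (x, s) = (Q x \<bullet> Q x) / (W x)\<^sup>2"
      unfolding gW by (simp add: inner_Pair power2_eq_square)
    finally show ?thesis by (simp add: power_divide)
  qed
  define D where "D h = (\<Sum>i\<in>Basis. (h \<bullet> i) *\<^sub>R H i x)" for h
  have D_inner: "D h \<bullet> c = h \<bullet> H c x" if "c \<in> Basis" for h c
    unfolding D_def inner_sum_left using sym[OF _ that x]
    by (subst euclidean_inner[of h]) simp
  have linD: "linear D"
    by (intro linearI) (simp_all add: D_def inner_add_left scaleR_add_left sum.distrib scaleR_sum_right)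
  have adj: "D h \<bullet> k = h \<bullet> D k" for h k
    by (subst euclidean_inner) (simp add: D_inner, simp add: D_def inner_sum_right mult.commute)
  have DG: "D (G x) = Q x" by (simp add: D_def Q_def)
  have D_Basis: "D b = H b x" if "b \<in> Basis" for b
    using that by (simp add: D_def inner_Basis if_distrib[of "\<lambda>c. c *\<^sub>R _"] cong: if_cong)
  let ?N = "graph_weingarten D (G x) (W x)"
  have "(unit_normal u has_derivative ?N) (at (x, u x))"
  proof -
    have dGx: "(G has_derivative D) (at x)"
    proof -
      have "((\<lambda>y. \<Sum>i\<in>Basis. (G y \<bullet> i) *\<^sub>R i) has_derivative (\<lambda>h. \<Sum>i\<in>Basis. (h \<bullet> H i x) *\<^sub>R i)) (at x)"
        using dH[OF _ x] unfolding gderiv_def by (intro has_derivative_sum has_derivative_scaleR_left)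
      moreover have "(\<Sum>i\<in>Basis. (h \<bullet> H i x) *\<^sub>R i) = D h" for h
        by (rule euclidean_eqI) (simp add: D_inner)
      ultimately show ?thesis by (simp add: euclidean_representation)
    qed
    have fst': "(fst has_derivative fst) (at (x, u x))"
      by (rule bounded_linear_imp_has_derivative[OF bounded_linear_fst])
    have 1: "((\<lambda>p. G (fst p)) has_derivative (\<lambda>v. D (fst v))) (at (x, u x))"
      using has_derivative_compose[OF fst', of G D] dGx by simp
    have 2: "((\<lambda>p. W (fst p)) has_derivative (\<lambda>v. fst v \<bullet> ((1 / W x) *\<^sub>R Q x))) (at (x, u x))"
      using has_derivative_compose[OF fst', of W "\<lambda>h. h \<bullet> ((1 / W x) *\<^sub>R Q x)"] dW[OF x]
      by (simp add: gderiv_def)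
    have "((\<lambda>p. inverse (W (fst p)) *\<^sub>R (- G (fst p), 1::real)) has_derivative
        (\<lambda>v. inverse (W x) *\<^sub>R (- D (fst v), 0) +
          (- (inverse (W x) * (fst v \<bullet> ((1 / W x) *\<^sub>R Q x)) * inverse (W x))) *\<^sub>R (- G x, 1))) (at (x, u x))"
      using has_derivative_scaleR[OF Deriv.has_derivative_inverse[OF _ 2]
          has_derivative_Pair[OF has_derivative_minus[OF 1] has_derivative_const[of "1::real"]]] W(1)[of x]
      by simp
    moreover have "inverse (W x) *\<^sub>R (- D (fst v), 0) +
          (- (inverse (W x) * (fst v \<bullet> ((1 / W x) *\<^sub>R Q x)) * inverse (W x))) *\<^sub>R (- G x, 1) = ?N v" for v
      using W(1)[of x] by (simp add: graph_weingarten_def DG inner_commute field_simps power3_eq_cube)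
    ultimately have "((\<lambda>p. inverse (W (fst p)) *\<^sub>R (- G (fst p), 1)) has_derivative ?N) (at (x, u x))"
      by simp
    then show ?thesis
      by (rule has_derivative_transform_within_open[OF _ op xs]) (simp add: un divide_inverse)
  qed
  then have fd: "frechet_derivative (unit_normal u) (at (x, u x)) = ?N"
    by (rule frechet_derivative_at[symmetric])
  \<comment> \<open>Rewrites the tangent space, defined as a range, as the orthogonal complement of
    the normal, the form used by \<open>sum_tangential_eigenvalues_sq\<close>.\<close>
  have tangent: "v \<bullet> ?\<nu> = 0 \<longleftrightarrow> snd v = G x \<bullet> fst v" for v
    using W(1)[of x] by (simp add: inner_prod_def inner_commute field_simps)
  have space: "curvature_space u x \<kappa> = {v. v \<bullet> ?\<nu> = 0 \<and> ?N v = \<kappa> *\<^sub>R v}" for \<kappa>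
    unfolding curvature_space_def fd graph_tangent_space_def tangent G_def[symmetric]
    by (auto simp: image_iff prod_eq_iff)
  have "second_form_sq u x = (\<Sum>b\<in>Basis. (norm (?N (b - (b \<bullet> ?\<nu>) *\<^sub>R ?\<nu>)))\<^sup>2)"
    unfolding second_form_sq_def principal_curvature_def
  proof (rule sum_tangential_eigenvalues_sq[OF linear_graph_weingarten[OF linD] _ graph_weingarten_normal[OF adj W] _ space])
    show "norm ?\<nu> = 1"
      unfolding norm_eq_1 by (rule \<nu>\<nu>)
    show "?N v \<bullet> w = v \<bullet> ?N w" if "v \<bullet> ?\<nu> = 0" "w \<bullet> ?\<nu> = 0" for v w
      using that unfolding tangent by (intro graph_weingarten_selfadjoint[OF adj])
  qed
  then have A: "second_form_sq u x * (W x)\<^sup>2 =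
      (\<Sum>b\<in>Basis. (norm (H b x))\<^sup>2) - 2 * (Q x \<bullet> Q x) / (W x)\<^sup>2 + (Q x \<bullet> G x)\<^sup>2 / W x ^ 4"
    using sum_graph_weingarten_sq[OF linD adj W[of x]] by (simp add: D_Basis DG)
  show "laplacian (norm_grad u) (x, s) * norm_grad u (x, s) =
      (\<Sum>b\<in>Basis. q b) - (\<Sum>b\<in>Basis. (norm (grad (partial_deriv b u) x))\<^sup>2)
      + second_form_sq u x * (norm_grad u (x, s))\<^sup>2
      + (norm (tangential_grad u (norm_grad u) (x, s)))\<^sup>2"
    \<comment> \<open>In the sum of \<open>tan\<close> and \<open>A\<close> the terms with
      \<open>W x ^ 4\<close> cancel, leaving the squared Hessian norm minus |Q|^2 / W^2; the last
      term is the one in \<open>lap\<close>.\<close>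
    using lap tan A unfolding ng[OF xs] by (simp add: H_def)
qed

section \<open>The two cases of the theorem\<close>

lemma cont_diff_Suc_imp: "cont_diff (Suc k) U S f \<Longrightarrow> cont_diff k U S f"
proof (induction k arbitrary: f)
  case (Suc k)
  have "\<exists>g. cont_diff k U S g \<and> (\<forall>x\<in>U. ((\<lambda>t. f (x + t *\<^sub>R b)) has_real_derivative g x) (at 0))"
    if "b \<in> Basis" for b
    using Suc.prems Suc.IH that unfolding cont_diff.simps(2)[of "Suc k"] by blast
  then show ?case using Suc.prems by simp
qed simp

lemma grad_inner_grad:
  "grad f x \<bullet> grad g y = (\<Sum>b\<in>Basis. partial_deriv b f x * partial_deriv b g y)"
  by (subst euclidean_inner) (simp add: grad_inner_Basis)

text \<open>Mixed partials are commuted once for u and once for its b-derivative, so that the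
  derivative in direction i is applied last and the sum over b becomes the gradient of the
  Laplacian.\<close>

lemma C3_line_derivative:
  fixes u :: "'a::euclidean_space \<Rightarrow> real"
  assumes \<Omega>: "open \<Omega>" and u: "cont_diff 3 \<Omega> \<Omega> u" and x: "x \<in> \<Omega>" and b: "b \<in> Basis"
  shows "((\<lambda>t. grad (partial_deriv b u) (x + t *\<^sub>R b) \<bullet> grad u (x + t *\<^sub>R b)) has_real_derivative
    (norm (grad (partial_deriv b u) x))\<^sup>2 +
    (\<Sum>i\<in>Basis. partial_deriv i u x * partial_deriv i (partial_deriv b (partial_deriv b u)) x)) (at 0)"
proof -
  have u3: "cont_diff (Suc (Suc (Suc 0))) \<Omega> \<Omega> u" using u by (simp add: numeral_3_eq_3)
  note ub = cont_diff_SucD(1)[OF \<Omega> u3]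
  have "((\<lambda>t. partial_deriv i (partial_deriv b u) (x + t *\<^sub>R b) * partial_deriv i u (x + t *\<^sub>R b)) has_real_derivative
      (partial_deriv i (partial_deriv b u) x)\<^sup>2 +
      partial_deriv i u x * partial_deriv i (partial_deriv b (partial_deriv b u)) x) (at 0)"
    if i: "i \<in> Basis" for i
  proof -
    have "((\<lambda>t. partial_deriv i (partial_deriv b u) (x + t *\<^sub>R b)) has_real_derivative
        partial_deriv i (partial_deriv b (partial_deriv b u)) x) (at 0)"
      using cont_diff_SucD(2)[OF \<Omega> cont_diff_SucD(1)[OF \<Omega> ub[OF b] i] b x]
      unfolding mixed_partials_commute[OF \<Omega> ub[OF b] x b i] .
    moreover have "((\<lambda>t. partial_deriv i u (x + t *\<^sub>R b)) has_real_derivative partial_deriv i (partial_deriv b u) x) (at 0)"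
      using cont_diff_SucD(2)[OF \<Omega> ub[OF i] b x] unfolding mixed_partials_commute[OF \<Omega> u3 x b i] .
    ultimately show ?thesis
      by (auto intro!: derivative_eq_intros simp: power2_eq_square)
  qed
  then show ?thesis
    unfolding power2_norm_eq_inner grad_inner_grad sum.distrib[symmetric]
    by (intro DERIV_sum) (simp add: power2_eq_square)
qed

theorem proposition1p2:
  fixes \<Omega> :: "(real ^ 'n) set"
  assumes "smooth_bounded_domain \<Omega>"
  shows
    "(\<forall>u. Ck_closure 3 \<Omega> u \<and> (\<forall>x\<in>frontier \<Omega>. u x = 0) \<and> (\<forall>x\<in>\<Omega>. u x > 0) \<longrightarrow>
        (\<forall>x\<in>\<Omega>. \<forall>s::real.
           (laplacian (norm_grad u) (x, s)
              + unit_normal u (x, s) \<bullet> grad (laplacian (graph_fun u)) (x, s)) * norm_grad u (x, s)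
           = second_form_sq u x * (norm_grad u (x, s))\<^sup>2
              + (norm (tangential_grad u (norm_grad u) (x, s)))\<^sup>2))
     \<and>
     (\<forall>(l::real) (f::real \<Rightarrow> real) u.
        l > 0 \<and> f C1_differentiable_on UNIV \<and> Ck_closure 2 \<Omega> u \<and>
        (\<forall>x\<in>\<Omega>. - laplacian u x = l * f (u x)) \<and> (\<forall>x\<in>frontier \<Omega>. u x = 0) \<longrightarrow>
        (\<forall>x\<in>\<Omega>. \<forall>s::real.
           (laplacian (norm_grad u) (x, s)
              + l * deriv f (u x) * norm_grad u (x, s)) * norm_grad u (x, s)
           = l * deriv f (u x) + second_form_sq u x * (norm_grad u (x, s))\<^sup>2
              + (norm (tangential_grad u (norm_grad u) (x, s)))\<^sup>2))"
proof (rule conjI; intro allI impI ballI; elim conjE)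
  have \<Omega>: "open \<Omega>" using assms by (simp add: smooth_bounded_domain_def)
  have restrict: "cont_diff k \<Omega> \<Omega> u" if "Ck_closure k \<Omega> u" for k and u :: "real ^ 'n \<Rightarrow> real"
    by (rule cont_diff_restrict[OF \<Omega> closure_subset that refl])
  {
    fix u :: "real ^ 'n \<Rightarrow> real" and x :: "real ^ 'n" and s :: real
    assume "Ck_closure 3 \<Omega> u" and x: "x \<in> \<Omega>"
    then have u: "cont_diff 3 \<Omega> \<Omega> u" by (intro restrict)
    then have u3: "cont_diff (Suc (Suc (Suc 0))) \<Omega> \<Omega> u" by (simp add: numeral_3_eq_3)
    note pu = cont_diff_SucD(1)[OF \<Omega> u3]
    have "cont_diff (Suc (Suc 0)) \<Omega> \<Omega> u" by (rule cont_diff_Suc_imp[OF u3])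
    then have u2: "cont_diff 2 \<Omega> \<Omega> u" by (simp add: numeral_2_eq_2)
    \<comment> \<open>Here the sum of the \<open>q b\<close> is the squared Hessian norm, which
      cancels, plus grad u \<bullet> grad (laplacian u).\<close>
    note main = graph_laplacian_norm_grad[OF \<Omega> u2 x C3_line_derivative[OF \<Omega> u x], where s=s]
    let ?W = "norm_grad u (x, s)"
    have "partial_deriv i (laplacian u) x = (\<Sum>b\<in>Basis. partial_deriv i (partial_deriv b (partial_deriv b u)) x)"
      if "i \<in> Basis" for i
      unfolding laplacian_def
      by (intro partial_derivI DERIV_sum cont_diff_SucD(2)[OF \<Omega> cont_diff_SucD(1)[OF \<Omega> pu] that x])
    then have T: "(\<Sum>b\<in>Basis. \<Sum>i\<in>Basis. partial_deriv i u x * partial_deriv i (partial_deriv b (partial_deriv b u)) x) =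
        grad u x \<bullet> grad (laplacian u) x"
      unfolding grad_inner_grad by (subst sum.swap) (simp add: sum_distrib_left)
    have "grad (laplacian (graph_fun u)) (x, s) = (grad (laplacian u) x, 0)"
    proof -
      have "grad (laplacian (graph_fun u)) (x, s) = grad (\<lambda>p. laplacian u (fst p)) (x, s)"
        by (rule grad_cong[of "\<Omega> \<times> UNIV"])
          (use \<Omega> x graph_fun_derivatives(2)[OF \<Omega> u3] in \<open>auto intro: open_Times\<close>)
      then show ?thesis by (simp add: grad_comp_fst)
    qed
    \<comment> \<open>W times the normal is (- grad u, 1), and the Laplacian of v has no vertical
      derivative.\<close>
    then have "(unit_normal u (x, s) \<bullet> grad (laplacian (graph_fun u)) (x, s)) * ?W = - (grad u x \<bullet> grad (laplacian u) x)"
      using main(4) by (simp add: main(3) inner_Pair)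
    then show "(laplacian (norm_grad u) (x, s)
        + unit_normal u (x, s) \<bullet> grad (laplacian (graph_fun u)) (x, s)) * norm_grad u (x, s)
      = second_form_sq u x * (norm_grad u (x, s))\<^sup>2
        + (norm (tangential_grad u (norm_grad u) (x, s)))\<^sup>2"
      using main(1) T by (simp add: distrib_right sum.distrib)
  }
  {
    fix l :: real and f :: "real \<Rightarrow> real" and u :: "real ^ 'n \<Rightarrow> real" and x :: "real ^ 'n" and s :: real
    assume f: "f C1_differentiable_on UNIV" and "Ck_closure 2 \<Omega> u"
      and pde: "\<forall>x\<in>\<Omega>. - laplacian u x = l * f (u x)" and x: "x \<in> \<Omega>"
    then have u: "cont_diff 2 \<Omega> \<Omega> u" by (intro restrict)
    then have u2: "cont_diff (Suc (Suc 0)) \<Omega> \<Omega> u" by (simp add: numeral_2_eq_2)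
    obtain f' where f': "\<And>r. (f has_real_derivative f' r) (at r)" "continuous_on UNIV f'"
      using f unfolding C1_differentiable_on_def by (auto simp: has_real_derivative_iff_has_vector_derivative)
    have df: "deriv f (u x) = f' (u x)" by (rule DERIV_imp_deriv[OF f'(1)])
    have sym: "grad (partial_deriv b u) y \<bullet> c = grad (partial_deriv c u) y \<bullet> b"
      if "b \<in> Basis" "c \<in> Basis" "y \<in> \<Omega>" for b c y
      using mixed_partials_commute[OF \<Omega> u2 that(3,2,1)] that by (simp add: grad_inner_Basis)
    have lap: "(\<Sum>b\<in>Basis. grad (partial_deriv b u) y \<bullet> b) = - l * f (u y)" if "y \<in> \<Omega>" for y
      using bspec[OF pde that] by (simp add: grad_inner_Basis laplacian_def)
    obtain q where q:
      "\<And>b. b \<in> Basis \<Longrightarrow> ((\<lambda>t. grad (partial_deriv b u) (x + t *\<^sub>R b) \<bullet> grad u (x + t *\<^sub>R b)) has_real_derivative q b) (at 0)"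
      "(\<Sum>b\<in>Basis. q b) = (\<Sum>b\<in>Basis. (norm (grad (partial_deriv b u) x))\<^sup>2) - l * f' (u x) * (norm (grad u x))\<^sup>2"
      using semilinear_half_norm_grad_sq[OF \<Omega> x cont_diff_grad(2)[OF \<Omega> u2] cont_diff_hessian(2)[OF \<Omega> u2]
          cont_diff_hessian(1)[OF \<Omega> u2] sym f' lap] by blast
    note main = graph_laplacian_norm_grad[OF \<Omega> u x q(1), where s=s]
    \<comment> \<open>Of W^2 = 1 + |grad u|^2, the second summand cancels the term with f' in the
      sum of the \<open>q b\<close>, and the 1 produces the extra l f'(u) on the right-hand
      side.\<close>
    have "l * f' (u x) * norm_grad u (x, s) * norm_grad u (x, s) = l * f' (u x) * (1 + (norm (grad u x))\<^sup>2)"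
      using main(2) by (simp add: power2_eq_square)
    then show "(laplacian (norm_grad u) (x, s)
        + l * deriv f (u x) * norm_grad u (x, s)) * norm_grad u (x, s)
      = l * deriv f (u x) + second_form_sq u x * (norm_grad u (x, s))\<^sup>2
        + (norm (tangential_grad u (norm_grad u) (x, s)))\<^sup>2"
      using main(1) q(2) df by (simp add: distrib_right distrib_left)
  }
qed

end
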